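(* Let $N\in\mathbb{N}$. Then $H_q\supseteq\Gamma_1(N)$ for almost all $q\in\mathbb{N}$ coprime to $N$ and for almost all primes $q\nmid N$, in the sense that, as $x\to\infty$, $$\#\{q\in\mathbb{N}:(q,N)=1,\ H_q\supseteq\Gamma_1(N),\ q\le x\}=\Big(\frac{\varphi(N)}{N}+o(1)\Big)x$$ and $$\#\{q\text{ prime}:q\nmid N,\ H_q\supseteq\Gamma_1(N),\ q\le x\}=(1+o(1))\pi(x).$$
   Context: For $q\in\mathbb{N}$ coprime to $N$, $H_q$ denotes the subgroup of $\Gamma_0(N)$ generated by all matrices $\begin{pmatrix}A&B\\C&D\end{pmatrix}\in\Gamma_0(N)$ with $A=q$. $\varphi$ is Euler's totient function and $\pi(x)$ the prime counting function. *)

theory Defs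
  imports "HOL-Analysis.Analysis" "HOL-Number_Theory.Number_Theory"
begin

text \<open>2x2 integer matrices (A B; C D) represented as tuples (A, B, C, D).\<close>
type_synonym mat2 = "int \<times> int \<times> int \<times> int"

definition mmul :: "mat2 \<Rightarrow> mat2 \<Rightarrow> mat2" where
  "mmul M M' = (case M of (a, b, c, d) \<Rightarrow> case M' of (a', b', c', d') \<Rightarrow>
     (a*a' + b*c', a*b' + b*d', c*a' + d*c', c*b' + d*d'))"

definition mid :: mat2 where "mid = (1, 0, 0, 1)"

text \<open>Inverse of a determinant-one matrix.\<close>
definition minv :: "mat2 \<Rightarrow> mat2" where
  "minv M = (case M of (a, b, c, d) \<Rightarrow> (d, -b, -c, a))"

definition mdet :: "mat2 \<Rightarrow> int" where
  "mdet M = (case M of (a, b, c, d) \<Rightarrow> a*d - b*c)"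

definition Gamma0 :: "nat \<Rightarrow> mat2 set" where
  "Gamma0 N = {(a, b, c, d). a*d - b*c = 1 \<and> int N dvd c}"

definition Gamma1 :: "nat \<Rightarrow> mat2 set" where
  "Gamma1 N = {(a, b, c, d). a*d - b*c = 1 \<and> int N dvd c \<and>
                 [a = 1] (mod int N) \<and> [d = 1] (mod int N)}"

inductive_set gen_sub :: "mat2 set \<Rightarrow> mat2 set" for S where
  gen_id: "mid \<in> gen_sub S"
| gen_base: "s \<in> S \<Longrightarrow> s \<in> gen_sub S"
| gen_mul: "x \<in> gen_sub S \<Longrightarrow> y \<in> gen_sub S \<Longrightarrow> mmul x y \<in> gen_sub S"
| gen_inv: "x \<in> gen_sub S \<Longrightarrow> minv x \<in> gen_sub S"

definition H :: "nat \<Rightarrow> nat \<Rightarrow> mat2 set" where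
  "H N q = gen_sub {M \<in> Gamma0 N. fst M = int q}"

end

theory Submission
  imports Defs "HOL-Real_Asymp.Real_Asymp"
begin

text \<open>Let \<open>T = (1 1; 0 1)\<close> and \<open>U = (1 0; N 1)\<close>; both lie in \<open>H N q\<close> when \<open>q\<close> is coprime to \<open>N\<close>.
  A matrix with first column \<open>(a, N s)\<close> therefore lies in \<open>H N q\<close> as soon as some
  \<open>U\<^sup>l T\<^sup>k\<close> moves this column to \<open>(a', c')\<close> with \<open>a' \<equiv> q (mod c')\<close>. For \<open>q = a + N n\<close> this says
  that \<open>m = s + l (a + k N s)\<close> divides \<open>n - k s\<close>. As \<open>Gamma1 N\<close> is finitely generated, it suffices that
  for fixed \<open>a\<close> and \<open>s\<close> all but \<open>o(x / log x)\<close> of the \<open>n \<le> x\<close> satisfy one of these congruences;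
  since \<open>\<pi>(x)\<close> is at least a constant times \<open>x / log x\<close>, this settles integers and primes
  simultaneously.

  The exceptional \<open>n\<close> are counted by a second moment over the pairs \<open>(k, l)\<close> in a box of size a
  small power of \<open>x\<close> for which \<open>m\<close> has no prime factor up to \<open>z\<close>, where \<open>z\<close> is slightly larger than
  \<open>log x\<close>. Two conditions are correlated only if \<open>g = gcd(m, m') > 1\<close>, in which case \<open>g > z\<close>, and
  compatibility forces \<open>k \<equiv> k'\<close> and \<open>l \<equiv> l' (mod g)\<close>; hence the relative variance is about
  \<open>1 / z\<close>, up to powers of \<open>log log x\<close>. The two free parameters \<open>k\<close> and \<open>l\<close> make the expected number of
  successes of order \<open>(log x)\<^sup>2\<close> up to powers of \<open>log log x\<close>.\<close>

section \<open>A Legendre sieve in arithmetic progressions\<close>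

text \<open>Put \<open>e = 2 ^ i\<close>. An \<open>X\<close> is treated at the scale with
  \<open>2 ^ (40 * e) \<le> X < 2 ^ (80 * e)\<close>, so \<open>e\<close> stands for log X and
  \<open>i\<close> for log log X, and the proportion of bad \<open>n\<close> must be o(1/e). With
  \<open>M\<close> the expected number of successes, the second moment bounds this proportion by
  \<open>2 / M\<close> plus a multiple of \<open>e ^ 4 / (z * M ^ 2)\<close>. The first term rules
  out a single parameter, for which \<open>M\<close> has order at most \<open>e\<close>. With
  \<open>M\<close> at least of order \<open>e ^ 2 / i ^ 2\<close> the second term is of order
  \<open>i ^ 4 / z\<close>, so \<open>z\<close> must beat \<open>e * i ^ 4\<close>; it is taken near
  \<open>e ^ (9/8)\<close>. That is the obstacle for the sieve: inclusion-exclusion over all primes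
  up to \<open>z\<close> has far more than \<open>2 ^ (10 * e)\<close> terms, longer than any range
  of \<open>l\<close>, while over the primes up to \<open>e\<close> it has at most
  \<open>2 ^ e\<close>. Hence the sieve in two stages. Prime estimates of Chebyshev strength suffice
  throughout, because powers of \<open>i\<close> are harmless.\<close>

definition sieve_density :: "nat set \<Rightarrow> nat \<Rightarrow> real" where
  "sieve_density P a = (\<Prod>p\<in>P. if p dvd a then 1 else 1 - 1 / real p)"

lemma sieve_density_bounds:
  assumes "\<forall>p\<in>P. prime p"
  shows "0 \<le> sieve_density P a" "sieve_density P a \<le> 1"
proof -
  have "0 \<le> (if p dvd a then 1 else 1 - 1 / real p) \<and> (if p dvd a then 1 else 1 - 1 / real p) \<le> 1"
    if "p \<in> P" for p
    using assms that prime_gt_0_nat[of p] by (auto simp: field_simps)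
  then show "0 \<le> sieve_density P a" "sieve_density P a \<le> 1"
    unfolding sieve_density_def by (auto intro!: prod_nonneg prod_le_1)
qed

text \<open>The \<open>l\<close> with \<open>p dvd s + l * a\<close> form one class
  \<open>l0 + p * j\<close>, and dividing out \<open>p\<close> turns \<open>s + l * a\<close> into
  \<open>s' + j * a\<close>: again a progression with difference \<open>a\<close> and first term
  coprime to \<open>a\<close>. This closure lets the sieve recurse with the same density.\<close>

lemma progression_dvd_card:
  fixes a s p u v :: nat
  assumes p: "prime p" "\<not> p dvd a" and cop: "coprime a s" and uv: "u \<le> v"
    and P: "\<forall>q\<in>P. prime q" "p \<notin> P"
  obtains s' u' v' where "coprime a s'" "u' \<le> v'"
    "\<bar>real (v' - u') - real (v - u) / real p\<bar> \<le> 1"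
    "card {l\<in>{u..<v}. p dvd s + l * a \<and> (\<forall>q\<in>P. \<not> q dvd s + l * a)} =
       card {j\<in>{u'..<v'}. \<forall>q\<in>P. \<not> q dvd s' + j * a}"
proof -
  have p0: "p > 0" using p prime_gt_0_nat by blast
  have cpa: "coprime a p" using p prime_imp_coprime[of p a] coprime_commute[of a p] by simp
  from cong_solve_coprime_nat[OF cpa] obtain y where y: "[a * y = 1] (mod p)" by auto
  \<comment> \<open>\<open>y\<close> inverts \<open>a\<close> modulo \<open>p\<close>, and
    \<open>p - s mod p\<close> represents \<open>- s\<close> in the natural numbers.\<close>
  define l0 where "l0 = (y * (p - s mod p)) mod p"
  have l0p: "l0 < p" using p0 by (simp add: l0_def)
  have "[s + l0 * a = s + (y * (p - s mod p)) * a] (mod p)"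
    by (intro cong_add cong_mult) (auto simp: l0_def cong_def)
  also have "s + (y * (p - s mod p)) * a = s + (a * y) * (p - s mod p)" by (simp only: mult.commute mult.left_commute)
  also have "[s + (a * y) * (p - s mod p) = s + 1 * (p - s mod p)] (mod p)"
    by (intro cong_add cong_mult y) auto
  also have "[s + 1 * (p - s mod p) = s mod p + 1 * (p - s mod p)] (mod p)"
    by (intro cong_add) (auto simp: cong_def)
  also have "s mod p + 1 * (p - s mod p) = p"
    using mod_less_divisor[OF p0, of s] by simp
  finally have "p dvd s + l0 * a" by (simp add: cong_def mod_0_imp_dvd)
  then obtain s' where s': "s + l0 * a = p * s'" by (auto elim: dvdE)
  have cop': "coprime a s'"
  proof (rule coprimeI)
    fix d assume d: "d dvd a" "d dvd s'"
    then have "d dvd s + l0 * a" unfolding s' by simp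
    with d have "d dvd s" by (simp add: dvd_add_left_iff)
    then show "is_unit d" using cop d coprime_common_divisor_nat by auto
  qed
  \<comment> \<open>\<open>u'\<close> and \<open>v'\<close> are the ceilings of
    \<open>(u - l0) / p\<close> and \<open>(v - l0) / p\<close>; \<open>l0 < p\<close> keeps the
    numerators natural.\<close>
  define u' where "u' = (u + (p - 1 - l0)) div p"
  define v' where "v' = (v + (p - 1 - l0)) div p"
  have uv': "u' \<le> v'" unfolding u'_def v'_def using uv by (intro div_le_mono) auto
  have key: "l \<in> {u..<v} \<and> p dvd s + l * a \<longleftrightarrow> (\<exists>j\<in>{u'..<v'}. l = l0 + p * j)" for l
  proof
    assume l: "l \<in> {u..<v} \<and> p dvd s + l * a"
    have "[s + l * a = s + l0 * a] (mod p)"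
      using l \<open>p dvd s + l0 * a\<close> by (simp add: cong_def)
    then have "[l * a = l0 * a] (mod p)" by (simp add: cong_add_lcancel_nat)
    then have "[l = l0] (mod p)" using cpa by (simp add: cong_mult_rcancel_nat)
    then have "l mod p = l0" using l0p by (simp add: cong_def)
    then have lj: "l = l0 + p * (l div p)" by (metis add.commute mult.commute div_mult_mod_eq)
    define j where "j = l div p"
    have l': "l = l0 + p * j" using lj j_def by simp
    have "u' \<le> j"
    proof -
      have "u + (p - 1 - l0) < p * Suc j" using l l' l0p by auto
      then have "u' < Suc j" unfolding u'_def by (metis less_mult_imp_div_less mult.commute)
      then show ?thesis by simp
    qed
    moreover have "j < v'"
    proof -
      have "p * Suc j \<le> v + (p - 1 - l0)" using l l' l0p by auto
      then have "Suc j \<le> v'" unfolding v'_def using p0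
        by (metis div_le_mono nonzero_mult_div_cancel_left not_gr_zero)
      then show ?thesis by simp
    qed
    ultimately show "\<exists>j\<in>{u'..<v'}. l = l0 + p * j" using l' by auto
  next
    assume "\<exists>j\<in>{u'..<v'}. l = l0 + p * j"
    then obtain j where j: "u' \<le> j" "j < v'" "l = l0 + p * j" by auto
    have "u + (p - 1 - l0) < p * Suc j"
    proof -
      have "(u + (p - 1 - l0)) div p < Suc j" using j u'_def by simp
      then show ?thesis using p0 by (simp only: div_less_iff_less_mult mult.commute)
    qed
    then have "u \<le> l" using j l0p by simp
    moreover have "p * Suc j \<le> v + (p - 1 - l0)"
    proof -
      have "Suc j \<le> (v + (p - 1 - l0)) div p" using j v'_def by simp
      then show ?thesis using p0 by (simp only: less_eq_div_iff_mult_less_eq mult.commute)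
    qed
    then have "l < v" using j l0p by simp
    moreover have "s + l * a = p * (s' + j * a)" unfolding j using s' by (simp add: algebra_simps)
    ultimately show "l \<in> {u..<v} \<and> p dvd s + l * a" by simp
  qed
  show ?thesis
  proof (rule that[OF cop' uv'])
    have fl: "real (x div p) \<le> real x / real p \<and> real x / real p < real (x div p) + 1" for x
    proof -
      have "real p * real (x div p) + real (x mod p) = real x"
        by (metis mult_div_mod_eq of_nat_add of_nat_mult)
      moreover have "real (x mod p) < real p" using p0 by simp
      ultimately have "real x - real p < real p * real (x div p)" "real p * real (x div p) \<le> real x"
        by linarith+
      then show ?thesis using p0 by (simp add: field_simps)
    qed
    have "real (v' - u') = real v' - real u'" using uv' by simp
    moreover have "real (v - u) / real p = real (v + (p - 1 - l0)) / real p - real (u + (p - 1 - l0)) / real p"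
      using uv by (simp add: diff_divide_distrib[symmetric])
    ultimately show "\<bar>real (v' - u') - real (v - u) / real p\<bar> \<le> 1"
      using fl[of "v + (p - 1 - l0)"] fl[of "u + (p - 1 - l0)"] unfolding u'_def v'_def by linarith
  next
    have dv: "q dvd s + (l0 + p * j) * a \<longleftrightarrow> q dvd s' + j * a" if "q \<in> P" for q j
    proof -
      have "s + (l0 + p * j) * a = p * (s' + j * a)" using s' by (simp add: algebra_simps)
      moreover have "\<not> q dvd p" using P that p(1) primes_dvd_imp_eq by blast
      ultimately show ?thesis using P that by (simp add: prime_dvd_mult_iff)
    qed
    have "{l\<in>{u..<v}. p dvd s + l * a \<and> (\<forall>q\<in>P. \<not> q dvd s + l * a)} =
      (\<lambda>j. l0 + p * j) ` {j\<in>{u'..<v'}. \<forall>q\<in>P. \<not> q dvd s' + j * a}" (is "?A = ?f ` ?B")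
    proof (rule Set.set_eqI)
      fix l
      have "l \<in> ?A \<longleftrightarrow> (l \<in> {u..<v} \<and> p dvd s + l * a) \<and> (\<forall>q\<in>P. \<not> q dvd s + l * a)" by auto
      also have "\<dots> \<longleftrightarrow> (\<exists>j\<in>{u'..<v'}. l = l0 + p * j \<and> (\<forall>q\<in>P. \<not> q dvd s + l * a))"
        unfolding key by blast
      also have "\<dots> \<longleftrightarrow> l \<in> ?f ` ?B" using dv by auto
      finally show "l \<in> ?A \<longleftrightarrow> l \<in> ?f ` ?B" .
    qed
    moreover have "inj_on ?f ?B" using p0 by (auto simp: inj_on_def)
    ultimately show "card ?A = card ?B" by (simp add: card_image)
  qed
qed

text \<open>A new prime \<open>p\<close> removes the count of the shorter progression from
  \<open>progression_dvd_card\<close>. Both counts obey the induction hypothesis and rounding the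
  length costs at most 1, so the error follows E' = 2 E + 1.\<close>

lemma legendre_sieve:
  fixes a s u v :: nat
  assumes "finite P" "\<forall>q\<in>P. prime q" "coprime a s" "u \<le> v"
  shows "\<bar>real (card {l\<in>{u..<v}. \<forall>q\<in>P. \<not> q dvd s + l * a}) - sieve_density P a * real (v - u)\<bar>
    \<le> 2 ^ card P - 1"
  using assms
proof (induction P arbitrary: s u v rule: finite_induct)
  case empty
  have *: "{l\<in>{u..<v}. \<forall>q\<in>{}. \<not> q dvd s + l * a} = {u..<v}" by auto
  show ?case unfolding * sieve_density_def by simp
next
  case (insert p P)
  let ?N = "\<lambda>P s u v. real (card {l\<in>{u..<v}. \<forall>q\<in>P. \<not> q dvd s + l * a})"
  let ?D = "sieve_density P a"
  have pP: "prime p" "\<forall>q\<in>P. prime q" using insert by auto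
  have D01: "0 \<le> ?D" "?D \<le> 1" using sieve_density_bounds[OF pP(2)] by auto
  have IH: "\<bar>?N P s u v - ?D * real (v - u)\<bar> \<le> 2 ^ card P - 1"
    using insert pP by blast
  have card': "card (insert p P) = Suc (card P)" using insert by simp
  show ?case
  proof (cases "p dvd a")
    case True
    \<comment> \<open>As \<open>a\<close> and \<open>s\<close> are coprime, a prime dividing
      \<open>a\<close> divides no term; hence its factor 1 in \<open>sieve_density\<close>.\<close>
    have "\<not> p dvd s + l * a" for l
    proof
      assume "p dvd s + l * a"
      with True have "p dvd s" by (simp add: dvd_add_left_iff)
      with True insert(5) have "p = 1" using coprime_common_divisor_nat by blast
      then show False using pP(1) by simp
    qed
    then have "{l\<in>{u..<v}. \<forall>q\<in>insert p P. \<not> q dvd s + l * a} = {l\<in>{u..<v}. \<forall>q\<in>P. \<not> q dvd s + l * a}"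
      by auto
    moreover have "sieve_density (insert p P) a = ?D"
      unfolding sieve_density_def using insert True by simp
    moreover have "(2::real) ^ card P \<le> 2 ^ card (insert p P)" unfolding card' by simp
    ultimately show ?thesis using IH by (simp del: power_increasing_iff)
  next
    case False
    obtain s' u' v' where c: "coprime a s'" "u' \<le> v'"
      "\<bar>real (v' - u') - real (v - u) / real p\<bar> \<le> 1"
      "card {l\<in>{u..<v}. p dvd s + l * a \<and> (\<forall>q\<in>P. \<not> q dvd s + l * a)} =
       card {j\<in>{u'..<v'}. \<forall>q\<in>P. \<not> q dvd s' + j * a}"
      by (rule progression_dvd_card[OF pP(1) False insert(5,6) pP(2) insert(2)])
    have IH': "\<bar>?N P s' u' v' - ?D * real (v' - u')\<bar> \<le> 2 ^ card P - 1"
      using insert c pP by blast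
    have "{l\<in>{u..<v}. \<forall>q\<in>P. \<not> q dvd s + l * a} = {l\<in>{u..<v}. \<forall>q\<in>insert p P. \<not> q dvd s + l * a} \<union>
       {l\<in>{u..<v}. p dvd s + l * a \<and> (\<forall>q\<in>P. \<not> q dvd s + l * a)}" by auto
    then have "card {l\<in>{u..<v}. \<forall>q\<in>P. \<not> q dvd s + l * a} = card {l\<in>{u..<v}. \<forall>q\<in>insert p P. \<not> q dvd s + l * a} +
       card {l\<in>{u..<v}. p dvd s + l * a \<and> (\<forall>q\<in>P. \<not> q dvd s + l * a)}"
      by (simp only:) (rule card_Un_disjoint, auto)
    then have N: "?N (insert p P) s u v = ?N P s u v - ?N P s' u' v'" using c(4) by simp
    have D: "sieve_density (insert p P) a * real (v - u) = ?D * real (v - u) - ?D * (real (v - u) / real p)"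
      unfolding sieve_density_def using insert False by (simp add: algebra_simps)
    have "\<bar>?D * real (v' - u') - ?D * (real (v - u) / real p)\<bar> = ?D * \<bar>real (v' - u') - real (v - u) / real p\<bar>"
      by (simp only: right_diff_distrib[symmetric] abs_mult abs_of_nonneg[OF D01(1)])
    also have "\<dots> \<le> 1 * 1" using D01 c(3) by (intro mult_mono) auto
    finally have "\<bar>?D * real (v' - u') - ?D * (real (v - u) / real p)\<bar> \<le> 1" by simp
    then show ?thesis using IH IH' unfolding N D card' power_Suc abs_le_iff by linarith
  qed
qed

lemma legendre_sieve_dvd:
  fixes a s u v p :: nat
  assumes "finite P" "\<forall>q\<in>P. prime q" "coprime a s" "u \<le> v" "prime p" "p \<notin> P"
  shows "real (card {l\<in>{u..<v}. p dvd s + l * a \<and> (\<forall>q\<in>P. \<not> q dvd s + l * a)})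
    \<le> sieve_density P a * (real (v - u) / real p) + 2 ^ card P"
proof (cases "p dvd a")
  case True
  have "\<not> p dvd s + l * a" for l
  proof
    assume "p dvd s + l * a"
    with True have "p dvd s" by (simp add: dvd_add_left_iff)
    with True assms(3) have "p = 1" using coprime_common_divisor_nat by blast
    then show False using assms(5) by simp
  qed
  then show ?thesis using sieve_density_bounds[OF assms(2), of a] by simp
next
  case False
  let ?D = "sieve_density P a"
  have D01: "0 \<le> ?D" "?D \<le> 1" using sieve_density_bounds[OF assms(2)] by auto
  obtain s' u' v' where c: "coprime a s'" "u' \<le> v'"
    "\<bar>real (v' - u') - real (v - u) / real p\<bar> \<le> 1"
    "card {l\<in>{u..<v}. p dvd s + l * a \<and> (\<forall>q\<in>P. \<not> q dvd s + l * a)} =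
     card {j\<in>{u'..<v'}. \<forall>q\<in>P. \<not> q dvd s' + j * a}"
    by (rule progression_dvd_card[OF assms(5) False assms(3,4,2,6)])
  have "?D * real (v' - u') \<le> ?D * (real (v - u) / real p + 1)"
    using D01 c(3) by (intro mult_left_mono) auto
  also have "\<dots> \<le> ?D * (real (v - u) / real p) + 1" using D01 by (simp add: algebra_simps)
  finally show ?thesis
    using legendre_sieve[OF assms(1,2) c(1,2)] c(4) by linarith
qed

text \<open>Removing the primes of \<open>Q\<close> by a union bound makes the error linear in
  \<open>card Q\<close> where inclusion-exclusion would be exponential. This pays off when the
  reciprocals of \<open>Q\<close> have sum well below 1.\<close>

lemma legendre_sieve_union:
  fixes a s u v :: nat
  assumes P: "finite P" "\<forall>q\<in>P. prime q" and Q: "finite Q" "\<forall>q\<in>Q. prime q" "P \<inter> Q = {}"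
    and "coprime a s" "u \<le> v"
  shows "sieve_density P a * real (v - u) * (1 - (\<Sum>p\<in>Q. 1 / real p)) - 2 ^ card P * (1 + real (card Q))
    \<le> real (card {l\<in>{u..<v}. \<forall>q\<in>P \<union> Q. \<not> q dvd s + l * a})"
proof -
  let ?D = "sieve_density P a"
  let ?A = "{l\<in>{u..<v}. \<forall>q\<in>P. \<not> q dvd s + l * a}"
  let ?B = "\<lambda>p. {l\<in>{u..<v}. p dvd s + l * a \<and> (\<forall>q\<in>P. \<not> q dvd s + l * a)}"
  let ?C = "{l\<in>{u..<v}. \<forall>q\<in>P \<union> Q. \<not> q dvd s + l * a}"
  have "?A \<subseteq> ?C \<union> (\<Union>p\<in>Q. ?B p)" by auto
  then have "card ?A \<le> card (?C \<union> (\<Union>p\<in>Q. ?B p))" using Q(1) by (intro card_mono) auto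
  also have "\<dots> \<le> card ?C + card (\<Union>p\<in>Q. ?B p)" by (rule card_Un_le)
  also have "card (\<Union>p\<in>Q. ?B p) \<le> (\<Sum>p\<in>Q. card (?B p))" by (rule card_UN_le[OF Q(1)])
  finally have "real (card ?A) \<le> real (card ?C) + (\<Sum>p\<in>Q. real (card (?B p)))"
    by (simp add: of_nat_le_iff[symmetric, where 'a=real] del: of_nat_le_iff)
  also have "(\<Sum>p\<in>Q. real (card (?B p))) \<le> (\<Sum>p\<in>Q. ?D * (real (v - u) / real p) + 2 ^ card P)"
    using assms by (intro sum_mono legendre_sieve_dvd) auto
  also have "\<dots> = ?D * real (v - u) * (\<Sum>p\<in>Q. 1 / real p) + 2 ^ card P * real (card Q)"
    by (simp add: sum.distrib sum_distrib_left sum_distrib_right mult.commute)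
  finally show ?thesis
    using legendre_sieve[OF P assms(6,7)] by (simp add: algebra_simps)
qed


section \<open>Chebyshev upper bounds in dyadic blocks and a lower bound for the Mertens
  product\<close>

lemma prod_primes_dvd:
  fixes m :: nat
  assumes "finite A" "\<forall>p\<in>A. prime p \<and> p dvd m"
  shows "\<Prod>A dvd m"
  using assms
proof (induction A rule: finite_induct)
  case (insert p A)
  have "coprime p (\<Prod>A)" using insert
    by (intro prod_coprime_right) (metis insertCI primes_coprime)
  then show ?case using insert by (simp add: divides_mult)
qed auto

text \<open>Each prime in \<open>(n, 2 n]\<close> divides the central binomial coefficient, which is
  at most \<open>4 ^ n\<close>. For \<open>n = 2 ^ j\<close> the resulting bound is an inequality of
  exponents of 2, free of logarithms.\<close>

lemma card_primes_dyadic: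
  "card {p::nat. prime p \<and> 2 ^ j < p \<and> p \<le> 2 * 2 ^ j} * j \<le> 2 * 2 ^ j"
proof -
  define n :: nat where "n = 2 ^ j"
  let ?A = "{p::nat. prime p \<and> n < p \<and> p \<le> 2 * n}"
  have fin: "finite ?A" by (rule finite_subset[of _ "{..2*n}"]) auto
  have "p dvd (2 * n) choose n" if p: "p \<in> ?A" for p
  proof -
    have "fact n * fact (2 * n - n) * ((2 * n) choose n) = (fact (2 * n) :: nat)"
      by (rule binomial_fact_lemma) simp
    moreover have "p dvd (fact (2 * n) :: nat)" using p by (simp add: prime_dvd_fact_iff)
    ultimately have "p dvd fact n * fact (2 * n - n) * ((2 * n) choose n)" by simp
    moreover have "\<not> p dvd (fact n :: nat)" using p by (simp add: prime_dvd_fact_iff)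
    ultimately show ?thesis using p by (auto simp: prime_dvd_mult_iff mult_2)
  qed
  then have "\<Prod>?A dvd (2 * n) choose n" using fin by (intro prod_primes_dvd) auto
  then have "\<Prod>?A \<le> (2 * n) choose n" by (rule dvd_imp_le) simp
  also have "(2 * n) choose n \<le> (\<Sum>k\<le>2*n. (2 * n) choose k)"
    by (rule member_le_sum) auto
  also have "\<dots> = 2 ^ (2 * n)" by (rule choose_row_sum)
  finally have "\<Prod>?A \<le> 2 ^ (2 * n)" .
  moreover have "n ^ card ?A \<le> \<Prod>?A"
    using prod_mono[of ?A "\<lambda>_. n" "\<lambda>p. p"] by simp
  ultimately have "(2::nat) ^ (j * card ?A) \<le> 2 ^ (2 * n)"
    unfolding power_mult n_def[symmetric] by simp
  then have "j * card ?A \<le> 2 * n" by simp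
  then show ?thesis unfolding n_def by (simp add: mult.commute)
qed

lemma sum_primes_dyadic:
  assumes "j > 0"
  shows "(\<Sum>p | prime p \<and> 2 ^ j < p \<and> p \<le> 2 * 2 ^ j. 1 / real p) \<le> 2 / real j"
proof -
  let ?A = "{p::nat. prime p \<and> 2 ^ j < p \<and> p \<le> 2 * 2 ^ j}"
  have "(\<Sum>p\<in>?A. 1 / real p) \<le> (\<Sum>p\<in>?A. 1 / 2 ^ j)"
  proof (rule sum_mono)
    fix p assume "p \<in> ?A"
    then have "real (2 ^ j) \<le> real p" by (subst of_nat_le_iff) auto
    then have "2 ^ j \<le> real p" by simp
    then show "1 / real p \<le> 1 / 2 ^ j" by (rule divide_left_mono) (use \<open>p \<in> ?A\<close> in \<open>auto intro: prime_gt_0_nat\<close>)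
  qed
  also have "\<dots> = real (card ?A) / 2 ^ j" by simp
  also have "\<dots> \<le> 2 / real j"
  proof -
    have "real (card ?A * j) \<le> real (2 * 2 ^ j)" using card_primes_dyadic by (subst of_nat_le_iff)
    then show ?thesis using assms by (simp add: field_simps)
  qed
  finally show ?thesis .
qed

lemma sum_primes_dyadic_range:
  assumes "i > 0"
  shows "(\<Sum>p | prime p \<and> 2 ^ i < p \<and> p \<le> 2 ^ (i + d). 1 / real p) \<le> 2 * real d / real i"
proof (induction d)
  case (Suc d)
  let ?A = "\<lambda>u v. {p::nat. prime p \<and> u < p \<and> p \<le> v}"
  have fin: "finite (?A u v)" for u v by (rule finite_subset[of _ "{..v}"]) auto
  have "(2::nat) ^ i \<le> 2 ^ (i + d)" by simp
  then have "?A (2 ^ i) (2 ^ (i + Suc d)) \<subseteq> ?A (2 ^ i) (2 ^ (i + d)) \<union> ?A (2 ^ (i + d)) (2 * 2 ^ (i + d))"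
    by auto
  then have "(\<Sum>p\<in>?A (2 ^ i) (2 ^ (i + Suc d)). 1 / real p) \<le> 
    (\<Sum>p\<in>?A (2 ^ i) (2 ^ (i + d)) \<union> ?A (2 ^ (i + d)) (2 * 2 ^ (i + d)). 1 / real p)"
    by (intro sum_mono2) (use fin in auto)
  also have "\<dots> \<le> (\<Sum>p\<in>?A (2 ^ i) (2 ^ (i + d)). 1 / real p) + (\<Sum>p\<in>?A (2 ^ (i + d)) (2 * 2 ^ (i + d)). 1 / real p)"
    by (subst sum.union_disjoint) (use fin in auto)
  also have "\<dots> \<le> 2 * real d / real i + 2 / real (i + d)"
    using Suc sum_primes_dyadic[of "i + d"] assms by auto
  also have "\<dots> \<le> 2 * real d / real i + 2 / real i"
    using assms by (intro add_left_mono divide_left_mono) auto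
  also have "\<dots> = 2 * real (Suc d) / real i" using assms by (simp add: field_simps)
  finally show ?case .
next
  case 0
  have *: "{p::nat. prime p \<and> 2 ^ i < p \<and> p \<le> 2 ^ (i + 0)} = {}" by auto
  show ?case unfolding * by simp
qed

lemma prod_one_minus_ge:
  fixes f :: "'a \<Rightarrow> real"
  assumes "finite A" "\<And>x. x \<in> A \<Longrightarrow> 0 \<le> f x \<and> f x \<le> 1"
  shows "1 - sum f A \<le> (\<Prod>x\<in>A. 1 - f x)"
  using assms
proof (induction A rule: finite_induct)
  case (insert y A)
  have "(1 - f y) * (1 - sum f A) \<le> (1 - f y) * (\<Prod>x\<in>A. 1 - f x)"
    using insert by (intro mult_left_mono) auto
  moreover have "0 \<le> f y * sum f A" using insert by (intro mult_nonneg_nonneg sum_nonneg) auto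
  ultimately show ?case using insert by (simp add: algebra_simps)
qed auto

text \<open>The block above \<open>2 ^ i\<close> contributes at least
  \<open>1 - 2 / i = (i - 2) / i\<close>, and these factors telescope to order
  \<open>1 / i ^ 2\<close>. The true order is \<open>1 / i\<close>; the loss stems from the constant
  2 in \<open>sum_primes_dyadic\<close>.\<close>

lemma prod_primes_lower:
  "\<exists>c>0. \<forall>i\<ge>3. c / real i ^ 2 \<le> (\<Prod>p | prime p \<and> p \<le> (2::nat) ^ i. 1 - 1 / real p)"
proof -
  let ?f = "\<lambda>i. \<Prod>p | prime p \<and> p \<le> (2::nat) ^ i. 1 - 1 / real p"
  let ?A = "\<lambda>v. {p::nat. prime p \<and> p \<le> v}"
  have fin: "finite (?A v)" for v by (rule finite_subset[of _ "{..v}"]) auto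
  have pos: "0 < 1 - 1 / real p" if "prime p" for p
    using prime_gt_1_nat[OF that] by (simp add: field_simps)
  have fpos: "?f i > 0" for i using pos by (intro prod_pos) auto
  \<comment> \<open>At \<open>i = 3\<close> the denominator \<open>(i - 1) * (i - 2)\<close> is 2,
    so the induction starts with equality.\<close>
  define c where "c = 2 * ?f 3"
  have c: "c > 0" using fpos[of 3] unfolding c_def by linarith
  have *: "c / ((real i - 1) * (real i - 2)) \<le> ?f i" if "i \<ge> 3" for i
    using that
  proof (induction i rule: dec_induct)
    case base
    then show ?case by (simp add: c_def)
  next
    case (step i)
    let ?B = "{p::nat. prime p \<and> 2 ^ i < p \<and> p \<le> 2 * 2 ^ i}"
    have finB: "finite ?B" by (rule finite_subset[of _ "{..2 * 2 ^ i}"]) auto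
    have "?A (2 ^ Suc i) = ?A (2 ^ i) \<union> ?B" by auto
    then have "?f (Suc i) = ?f i * (\<Prod>p\<in>?B. 1 - 1 / real p)"
      by (simp only:) (rule prod.union_disjoint, use fin finB in auto)
    moreover have "1 - 2 / real i \<le> (\<Prod>p\<in>?B. 1 - 1 / real p)"
    proof -
      have "1 - (\<Sum>p\<in>?B. 1 / real p) \<le> (\<Prod>p\<in>?B. 1 - 1 / real p)"
        by (rule prod_one_minus_ge[OF finB]) (auto simp: field_simps)
      then show ?thesis using sum_primes_dyadic[of i] step by simp
    qed
    moreover have "c / ((real i - 1) * (real i - 2)) * (1 - 2 / real i) = c / ((real (Suc i) - 1) * (real (Suc i) - 2))"
    proof -
      have "1 - 2 / real i = (real i - 2) / real i" using step by (simp add: field_simps)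
      then show ?thesis using step by simp
    qed
    moreover have "c / ((real i - 1) * (real i - 2)) * (1 - 2 / real i) \<le> ?f i * (\<Prod>p\<in>?B. 1 - 1 / real p)"
      using step fpos[of i] calculation(2) by (intro mult_mono) auto
    ultimately show ?case by simp
  qed
  show ?thesis
  proof (intro exI[of _ c] conjI allI impI c)
    fix i :: nat assume i: "i \<ge> 3"
    have "(real i - 1) * (real i - 2) \<le> real i ^ 2"
      unfolding power2_eq_square using i by (intro mult_mono) auto
    moreover have "0 < (real i - 1) * (real i - 2)" using i by simp
    ultimately have "c / real i ^ 2 \<le> c / ((real i - 1) * (real i - 2))"
      using i c by (intro divide_left_mono) auto
    with *[OF i] show "c / real i ^ 2 \<le> ?f i" by simp
  qed
qed

section \<open>The second moment method\<close>

lemma card_residue_lessThan: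
  fixes m X :: nat and c :: int
  assumes "m > 0"
  shows "real X / real m - 1 \<le> real (card {n. n < X \<and> int m dvd int n - c})"
    and "real (card {n. n < X \<and> int m dvd int n - c}) \<le> real X / real m + 1"
proof -
  define c0 where "c0 = nat (c mod int m)"
  have c0: "c0 < m" "int c0 = c mod int m" using assms by (auto simp: c0_def nat_less_iff)
  have iff: "int m dvd int n - c \<longleftrightarrow> n mod m = c0" for n
  proof -
    have "int m dvd int n - c \<longleftrightarrow> int n mod int m = c mod int m" by (simp add: mod_eq_dvd_iff)
    also have "\<dots> \<longleftrightarrow> n mod m = c0" using c0 by (metis of_nat_eq_iff zmod_int)
    finally show ?thesis .
  qed
  let ?S = "{n. n < X \<and> int m dvd int n - c}"
  have "?S = (\<lambda>j. c0 + m * j) ` {j. c0 + m * j < X}"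
  proof (rule Set.set_eqI)
    fix n
    show "n \<in> ?S \<longleftrightarrow> n \<in> (\<lambda>j. c0 + m * j) ` {j. c0 + m * j < X}"
    proof
      assume "n \<in> ?S"
      then have n: "n < X" "n mod m = c0" using iff by auto
      have "c0 + m * (n div m) = n" unfolding n(2)[symmetric] by simp
      then show "n \<in> (\<lambda>j. c0 + m * j) ` {j. c0 + m * j < X}"
        using n(1) by (intro image_eqI[of _ _ "n div m"]) simp_all
    next
      assume "n \<in> (\<lambda>j. c0 + m * j) ` {j. c0 + m * j < X}"
      then obtain j where "n = c0 + m * j" "n < X" by auto
      then show "n \<in> ?S" using iff c0(1) by simp
    qed
  qed
  moreover have "{j. c0 + m * j < X} = {..<(X + (m - 1 - c0)) div m}"
  proof (rule Set.set_eqI)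
    fix j
    have "j < (X + (m - 1 - c0)) div m \<longleftrightarrow> Suc j * m \<le> X + (m - 1 - c0)"
      using assms by (simp add: less_eq_div_iff_mult_less_eq Suc_le_eq[symmetric])
    then show "j \<in> {j. c0 + m * j < X} \<longleftrightarrow> j \<in> {..<(X + (m - 1 - c0)) div m}"
      using c0(1) by (auto simp: mult.commute)
  qed
  moreover have "inj_on (\<lambda>j. c0 + m * j) A" for A using assms by (auto simp: inj_on_def)
  ultimately have card: "card ?S = (X + (m - 1 - c0)) div m" by (simp add: card_image)
  define Y where "Y = X + (m - 1 - c0)"
  have "m * (Y div m) + Y mod m = Y" by simp
  moreover have "Y mod m < m" using assms by simp
  moreover have "X \<le> Y" "Y < X + m" using c0(1) by (auto simp: Y_def)
  ultimately have "X < m * (Y div m) + m" "m * (Y div m) < X + m" by linarith+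
  then have "real X < real (m * (Y div m) + m)" "real (m * (Y div m)) < real (X + m)"
    by (simp_all only: of_nat_less_iff)
  then show "real X / real m - 1 \<le> real (card ?S)" "real (card ?S) \<le> real X / real m + 1"
    unfolding card Y_def[symmetric] using assms by (simp_all add: field_simps)
qed

text \<open>Chinese remaindering: if there is a common solution, then the gcd divides
  \<open>c - c'\<close> and the solutions lie in one class modulo the lcm.\<close>

lemma card_two_residues_le:
  fixes m m' X :: nat and c c' :: int
  assumes "m > 0" "m' > 0"
  shows "real (card {n. n < X \<and> int m dvd int n - c \<and> int m' dvd int n - c'})
    \<le> real X * (if int (gcd m m') dvd c - c' then real (gcd m m') / (real m * real m') else 0) + 1"
proof (cases "\<exists>n. int m dvd int n - c \<and> int m' dvd int n - c'")
  case True
  then obtain n0 where n0: "int m dvd int n0 - c" "int m' dvd int n0 - c'" by auto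
  have "int (gcd m m') dvd int n0 - c" by (rule dvd_trans[OF _ n0(1)]) simp
  moreover have "int (gcd m m') dvd int n0 - c'" by (rule dvd_trans[OF _ n0(2)]) simp
  ultimately have "int (gcd m m') dvd (int n0 - c') - (int n0 - c)" by (rule dvd_diff[rotated])
  then have g: "int (gcd m m') dvd c - c'" by simp
  have "{n. n < X \<and> int m dvd int n - c \<and> int m' dvd int n - c'} \<subseteq> {n. n < X \<and> int (lcm m m') dvd int n - int n0}"
  proof safe
    fix n assume n: "int m dvd int n - c" "int m' dvd int n - c'"
    have "int m dvd (int n - c) - (int n0 - c)" "int m' dvd (int n - c') - (int n0 - c')"
      by (rule dvd_diff[OF n(1) n0(1)], rule dvd_diff[OF n(2) n0(2)])
    then have "int m dvd int n - int n0" "int m' dvd int n - int n0" by simp_all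
    then have "lcm (int m) (int m') dvd int n - int n0" by (rule lcm_least)
    then show "int (lcm m m') dvd int n - int n0" by (simp add: lcm_int_int_eq)
  qed
  then have "card {n. n < X \<and> int m dvd int n - c \<and> int m' dvd int n - c'} \<le> card {n. n < X \<and> int (lcm m m') dvd int n - int n0}"
    by (intro card_mono) auto
  then have "real (card {n. n < X \<and> int m dvd int n - c \<and> int m' dvd int n - c'}) \<le> real (card {n. n < X \<and> int (lcm m m') dvd int n - int n0})"
    by simp
  also have "\<dots> \<le> real X / real (lcm m m') + 1"
    using assms by (intro card_residue_lessThan(2)) (simp add: lcm_pos_nat)
  also have "real (lcm m m') = real m * real m' / real (gcd m m')"
    using prod_gcd_lcm_nat[of m m'] assms by (simp add: field_simps flip: of_nat_mult)
  finally show ?thesis using g by simp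
next
  case False
  then have none: "{n. n < X \<and> int m dvd int n - c \<and> int m' dvd int n - c'} = {}" by auto
  show ?thesis unfolding none by simp
qed

text \<open>\<open>S n\<close> counts the conditions met by \<open>n\<close> and has mean about
  \<open>M\<close>. It vanishes on the avoiding set, so each element there contributes
  \<open>M ^ 2\<close> to the sum of \<open>(S n - M) ^ 2\<close>. Pairs with coprime moduli are
  independent up to rounding and cancel; \<open>C\<close> collects the rest, including the diagonal
  where the modulus exceeds 1.\<close>

lemma second_moment_avoiding:
  fixes m :: "'a \<Rightarrow> nat" and c :: "'a \<Rightarrow> int" and F :: "'a set" and X :: nat
  assumes F: "finite F" "\<And>f. f \<in> F \<Longrightarrow> m f > 0"
  defines "M \<equiv> (\<Sum>f\<in>F. 1 / real (m f))"
  defines "C \<equiv> (\<Sum>f\<in>F. \<Sum>f' | f' \<in> F \<and> gcd (m f) (m f') > 1 \<and> int (gcd (m f) (m f')) dvd c f - c f'.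
             real (gcd (m f) (m f')) / (real (m f) * real (m f')))"
  shows "real (card {n. n < X \<and> (\<forall>f\<in>F. \<not> int (m f) dvd int n - c f)}) * M ^ 2
    \<le> real X * C + real (card F) ^ 2 + 2 * M * real (card F)"
proof -
  define hit where "hit f n = (if int (m f) dvd int n - c f then 1 else 0 :: real)" for f n
  define S where "S n = (\<Sum>f\<in>F. hit f n)" for n
  let ?B = "{n. n < X \<and> (\<forall>f\<in>F. \<not> int (m f) dvd int n - c f)}"
  have M0: "M \<ge> 0" unfolding M_def by (intro sum_nonneg) auto
  have "real (card ?B) * M ^ 2 = (\<Sum>n\<in>?B. (S n - M) ^ 2)"
  proof -
    have "S n = 0" if "n \<in> ?B" for n using that by (auto simp: S_def hit_def)
    then show ?thesis by simp
  qed
  also have "\<dots> \<le> (\<Sum>n<X. (S n - M) ^ 2)" by (rule sum_mono2) auto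
  also have "\<dots> = (\<Sum>n<X. S n ^ 2) - 2 * M * (\<Sum>n<X. S n) + real X * M ^ 2"
    by (simp add: power2_diff sum.distrib sum_subtractf sum_distrib_left algebra_simps)
  finally have main: "real (card ?B) * M ^ 2 \<le> (\<Sum>n<X. S n ^ 2) - 2 * M * (\<Sum>n<X. S n) + real X * M ^ 2" .
  have cnt: "(\<Sum>n<X. hit f n) = real (card {n. n < X \<and> int (m f) dvd int n - c f})" for f
  proof -
    have "(\<Sum>n<X. hit f n) = (\<Sum>n\<in>{n. n < X \<and> int (m f) dvd int n - c f}. 1)"
      unfolding hit_def by (rule sum.mono_neutral_cong_right) auto
    then show ?thesis by simp
  qed
  have cnt2: "(\<Sum>n<X. hit f n * hit f' n) = real (card {n. n < X \<and> int (m f) dvd int n - c f \<and> int (m f') dvd int n - c f'})" for f f'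
  proof -
    have "(\<Sum>n<X. hit f n * hit f' n) = (\<Sum>n\<in>{n. n < X \<and> int (m f) dvd int n - c f \<and> int (m f') dvd int n - c f'}. 1)"
      unfolding hit_def by (rule sum.mono_neutral_cong_right) auto
    then show ?thesis by simp
  qed
  have "(\<Sum>n<X. S n) = (\<Sum>f\<in>F. \<Sum>n<X. hit f n)" unfolding S_def by (rule sum.swap)
  also have "\<dots> \<ge> (\<Sum>f\<in>F. real X / real (m f) - 1)"
    unfolding cnt by (intro sum_mono card_residue_lessThan(1) F)
  finally have S1: "(\<Sum>n<X. S n) \<ge> real X * M - real (card F)"
    by (simp add: M_def sum_subtractf sum_distrib_left)
  define w where "w f f' = (if int (gcd (m f) (m f')) dvd c f - c f' then real (gcd (m f) (m f')) / (real (m f) * real (m f')) else 0)" for f f'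
  have "(\<Sum>n<X. S n ^ 2) = (\<Sum>n<X. \<Sum>f\<in>F. \<Sum>f'\<in>F. hit f n * hit f' n)"
    unfolding S_def by (simp add: power2_eq_square sum_product)
  also have "\<dots> = (\<Sum>f\<in>F. \<Sum>n<X. \<Sum>f'\<in>F. hit f n * hit f' n)" by (rule sum.swap)
  also have "\<dots> = (\<Sum>f\<in>F. \<Sum>f'\<in>F. \<Sum>n<X. hit f n * hit f' n)"
    by (rule sum.cong[OF refl], rule sum.swap)
  also have "\<dots> \<le> (\<Sum>f\<in>F. \<Sum>f'\<in>F. real X * w f f' + 1)"
    unfolding cnt2 w_def by (intro sum_mono card_two_residues_le F)
  also have "\<dots> = real X * (\<Sum>f\<in>F. \<Sum>f'\<in>F. w f f') + real (card F) ^ 2"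
    by (simp add: sum.distrib sum_distrib_left power2_eq_square)
  finally have S2: "(\<Sum>n<X. S n ^ 2) \<le> real X * (\<Sum>f\<in>F. \<Sum>f'\<in>F. w f f') + real (card F) ^ 2" .
  \<comment> \<open>The product term is exact for coprime moduli and is added for free, being
    nonnegative, for the others; over all pairs it sums to \<open>M ^ 2\<close>.\<close>
  have "(\<Sum>f'\<in>F. w f f') \<le> (\<Sum>f'\<in>F. 1 / real (m f) * (1 / real (m f'))) +
     (\<Sum>f' | f' \<in> F \<and> gcd (m f) (m f') > 1 \<and> int (gcd (m f) (m f')) dvd c f - c f'.
             real (gcd (m f) (m f')) / (real (m f) * real (m f')))" if f: "f \<in> F" for f
  proof -
    have "w f f' \<le> 1 / real (m f) * (1 / real (m f')) +
      (if gcd (m f) (m f') > 1 \<and> int (gcd (m f) (m f')) dvd c f - c f' then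
             real (gcd (m f) (m f')) / (real (m f) * real (m f')) else 0)" if "f' \<in> F" for f'
    proof (cases "gcd (m f) (m f') > 1")
      case False
      moreover have "gcd (m f) (m f') > 0" using F(2)[OF f] by simp
      ultimately have "gcd (m f) (m f') = 1" by linarith
      then show ?thesis by (simp add: w_def)
    qed (auto simp: w_def)
    then have "(\<Sum>f'\<in>F. w f f') \<le> (\<Sum>f'\<in>F. 1 / real (m f) * (1 / real (m f')) +
      (if gcd (m f) (m f') > 1 \<and> int (gcd (m f) (m f')) dvd c f - c f' then
             real (gcd (m f) (m f')) / (real (m f) * real (m f')) else 0))" by (rule sum_mono)
    then show ?thesis by (simp only: sum.distrib sum.inter_filter[OF F(1)])
  qed
  then have "(\<Sum>f\<in>F. \<Sum>f'\<in>F. w f f') \<le> (\<Sum>f\<in>F. (\<Sum>f'\<in>F. 1 / real (m f) * (1 / real (m f'))) +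
     (\<Sum>f' | f' \<in> F \<and> gcd (m f) (m f') > 1 \<and> int (gcd (m f) (m f')) dvd c f - c f'.
             real (gcd (m f) (m f')) / (real (m f) * real (m f'))))" by (rule sum_mono)
  also have "\<dots> = M ^ 2 + C"
    unfolding sum.distrib C_def[symmetric] by (simp only: M_def power2_eq_square sum_product)
  finally have W: "(\<Sum>f\<in>F. \<Sum>f'\<in>F. w f f') \<le> M ^ 2 + C" .
  have "real X * (\<Sum>f\<in>F. \<Sum>f'\<in>F. w f f') \<le> real X * (M ^ 2 + C)" using W by (rule mult_left_mono) simp
  moreover have "2 * M * (real X * M - real (card F)) \<le> 2 * M * (\<Sum>n<X. S n)"
    using S1 M0 by (intro mult_left_mono) auto
  ultimately show ?thesis using main S2 by (simp add: algebra_simps power2_eq_square)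
qed

section \<open>Reciprocal sums over residue classes, and divisors of numbers without small
  primes\<close>

lemma card_progression_le:
  fixes A :: "nat set"
  assumes "A \<subseteq> {u..<u + w}" "\<And>x y. x \<in> A \<Longrightarrow> y \<in> A \<Longrightarrow> [x = y] (mod g)" "g > 0"
  shows "real (card A) \<le> real w / real g + 1"
proof -
  have fin: "finite A" using assms(1) by (rule finite_subset) simp
  have "inj_on (\<lambda>x. (x - u) div g) A"
  proof (rule inj_onI)
    fix x y assume xy: "x \<in> A" "y \<in> A" "(x - u) div g = (y - u) div g"
    have u: "u \<le> x" "u \<le> y" using xy assms(1) by auto
    have "[(x - u) + u = (y - u) + u] (mod g)" using u assms(2)[OF xy(1,2)] by simp
    then have "[x - u = y - u] (mod g)" by (simp only: cong_add_rcancel_nat)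
    then have "(x - u) mod g = (y - u) mod g" by (simp only: cong_def)
    with xy(3) have "x - u = y - u" by (metis div_mult_mod_eq)
    with u show "x = y" by simp
  qed
  moreover have "(\<lambda>x. (x - u) div g) ` A \<subseteq> {..w div g}"
  proof safe
    fix x assume "x \<in> A"
    then have "x \<in> {u..<u + w}" using assms(1) by blast
    then show "(x - u) div g \<le> w div g" by (intro div_le_mono) auto
  qed
  ultimately have "card A \<le> card {..w div g}" by (metis card_inj_on_le finite_atMost)
  then have "real (card A) \<le> real (w div g) + 1" by simp
  also have "real (w div g) \<le> real w / real g" by (rule of_nat_div_le_of_nat)
  finally show ?thesis by simp
qed

text \<open>Each of the \<open>r\<close> blocks \<open>[W, 2 W)\<close> holds at most
  \<open>W / g + 1\<close> members of one class, with reciprocals at most \<open>1 / W\<close>. The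
  term \<open>1 / M\<close> pays for the rounding \<open>+ 1\<close>.\<close>

lemma sum_inverse_progression_le:
  fixes A :: "nat set"
  assumes "A \<subseteq> {M..<2 ^ r * M}" "\<And>x y. x \<in> A \<Longrightarrow> y \<in> A \<Longrightarrow> [x = y] (mod g)" "g > 0" "M > 0"
  shows "(\<Sum>x\<in>A. 1 / real x) \<le> real r * (1 / real g + 1 / real M)"
  using assms(1,2)
proof (induction r arbitrary: A)
  case (Suc r)
  let ?A1 = "A \<inter> {..<2 ^ r * M}" and ?A2 = "A \<inter> {2 ^ r * M..}"
  define W :: nat where "W = 2 ^ r * M"
  have W: "W > 0" "M \<le> W" using assms by (auto simp: W_def)
  have fin: "finite A" using Suc.prems(1) by (rule finite_subset) simp
  have "A = ?A1 \<union> ?A2" by auto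
  then have split: "(\<Sum>x\<in>A. 1 / real x) = (\<Sum>x\<in>?A1. 1 / real x) + (\<Sum>x\<in>?A2. 1 / real x)"
    using fin sum.union_disjoint[of ?A1 ?A2 "\<lambda>x. 1 / real x"] by fastforce
  have A1: "(\<Sum>x\<in>?A1. 1 / real x) \<le> real r * (1 / real g + 1 / real M)"
    by (rule Suc.IH) (use Suc.prems in auto)
  have "(\<Sum>x\<in>?A2. 1 / real x) \<le> (\<Sum>x\<in>?A2. 1 / real W)"
  proof (rule sum_mono)
    fix x assume "x \<in> ?A2"
    then have "real W \<le> real x" unfolding W_def by (subst of_nat_le_iff) simp
    then show "1 / real x \<le> 1 / real W" using W by (intro divide_left_mono) auto
  qed
  also have "\<dots> = real (card ?A2) / real W" by simp
  also have "\<dots> \<le> (real W / real g + 1) / real W"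
  proof (intro divide_right_mono card_progression_le[where u = W])
    show "?A2 \<subseteq> {W..<W + W}" using Suc.prems(1) by (auto simp: W_def)
  qed (use Suc.prems(2) assms(3) in auto)
  also have "\<dots> = 1 / real g + 1 / real W"
    using W by (simp add: add_divide_distrib)
  also have "\<dots> \<le> 1 / real g + 1 / real M"
    using W assms(4) by (intro add_left_mono divide_left_mono) auto
  finally show ?case using A1 unfolding split of_nat_Suc distrib_right mult_1_left by linarith
qed auto

lemma sum_inverse_squares_le:
  assumes "z > 0"
  shows "(\<Sum>g\<in>{z<..<n}. 1 / real g ^ 2) \<le> 1 / real z"
proof -
  \<comment> \<open>Telescoping form; \<open>max\<close> keeps the claim true while the range is
    still empty.\<close>
  have "(\<Sum>g\<in>{z<..<n}. 1 / real g ^ 2) \<le> 1 / real z - 1 / real (max n (z + 1) - 1)"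
  proof (induction n)
    case (Suc n)
    show ?case
    proof (cases "z < n")
      case True
      then have "{z<..<Suc n} = insert n {z<..<n}" "max n (z + 1) = n" by auto
      then have "(\<Sum>g\<in>{z<..<Suc n}. 1 / real g ^ 2) \<le> 1 / real n ^ 2 + (1 / real z - 1 / real (n - 1))"
        using Suc by simp
      also have "1 / real n ^ 2 \<le> 1 / real (n - 1) - 1 / real n"
      proof -
        have n: "real (n - 1) = real n - 1" "real n - 1 > 0" using True assms by auto
        have "1 / real (n - 1) - 1 / real n = 1 / ((real n - 1) * real n)"
          using n by (simp add: field_simps)
        moreover have "(real n - 1) * real n \<le> real n ^ 2" by (simp add: power2_eq_square algebra_simps)
        moreover have "(real n - 1) * real n > 0" using n by simp
        ultimately show ?thesis by (simp add: frac_le)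
      qed
      finally show ?thesis using True by simp
    next
      case False
      then have "{z<..<Suc n} = {}" by auto
      then show ?thesis using False by (simp add: max_def)
    qed
  qed (use assms in auto)
  also have "\<dots> \<le> 1 / real z" by simp
  finally show ?thesis .
qed

text \<open>A further prime factor \<open>p\<close> at most doubles the number of divisors, so its
  \<open>k\<close>-th power grows by at most \<open>2 ^ k\<close>, whereas \<open>m\<close> grows by
  \<open>p \<ge> 2 ^ k\<close>.\<close>

lemma card_divisors_le:
  fixes m :: nat
  assumes "m > 0" "\<And>p. prime p \<Longrightarrow> p dvd m \<Longrightarrow> 2 ^ k \<le> p"
  shows "card {d. d dvd m} ^ k \<le> m"
  using assms
proof (induction m rule: less_induct)
  case (less m)
  show ?case
  proof (cases "m = 1")
    case False
    then obtain p where p: "prime p" "p dvd m" using prime_factor_nat by blast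
    then obtain m' where m': "m = p * m'" by (auto elim: dvdE)
    have p1: "p > 1" using p prime_gt_1_nat by blast
    have m'0: "0 < m'" "m' < m" using less.prems(1) p1 by (auto simp: m')
    have IH: "card {d. d dvd m'} ^ k \<le> m'"
      by (rule less.IH) (use m'0 less.prems(2) in \<open>auto simp: m'\<close>)
    have fin: "finite {d. d dvd m'}" using m'0 by simp
    have "{d. d dvd m} \<subseteq> {d. d dvd m'} \<union> (*) p ` {d. d dvd m'}"
    proof safe
      fix d assume d: "d dvd m" "d \<notin> (*) p ` {d. d dvd m'}"
      have "\<not> p dvd d"
      proof
        assume "p dvd d"
        then obtain e where "d = p * e" by (auto elim: dvdE)
        with d p1 show False by (auto simp: m')
      qed
      then have "coprime d p" using p(1) prime_imp_coprime[of p d] coprime_commute[of d p] by simp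
      with d(1) show "d dvd m'" unfolding m' by (simp add: coprime_dvd_mult_right_iff)
    qed
    then have "card {d. d dvd m} \<le> card ({d. d dvd m'} \<union> (*) p ` {d. d dvd m'})"
      using fin by (intro card_mono) auto
    also have "\<dots> \<le> card {d. d dvd m'} + card ((*) p ` {d. d dvd m'})" by (rule card_Un_le)
    also have "\<dots> \<le> 2 * card {d. d dvd m'}" using card_image_le[OF fin, of "(*) p"] by simp
    finally have "card {d. d dvd m} ^ k \<le> (2 * card {d. d dvd m'}) ^ k" by (rule power_mono) simp
    also have "\<dots> = 2 ^ k * card {d. d dvd m'} ^ k" by (rule power_mult_distrib)
    also have "\<dots> \<le> p * m'" using less.prems(2)[OF p] IH by (rule mult_mono) auto
    finally show ?thesis by (simp add: m')
  qed auto
qed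

section \<open>Correlations of orbit moduli\<close>

text \<open>The modulus \<open>m\<close> of the introduction at \<open>f = (k, l)\<close>, with \<open>b\<close> in place of \<open>N s\<close>.\<close>

definition orbit_mod :: "nat \<Rightarrow> nat \<Rightarrow> nat \<Rightarrow> nat \<times> nat \<Rightarrow> nat" where
  "orbit_mod a b s f = s + snd f * (a + fst f * b)"

text \<open>Two distinct members of a class differ by at least \<open>g\<close>, so for
  \<open>g \<ge> 2 ^ r * M\<close> nothing remains. Leaving out \<open>x\<close> itself is what
  makes this vanishing possible.\<close>

lemma sum_inverse_other_residues_le:
  fixes x g r M :: nat
  assumes "g > 0" "M > 0"
  defines "S \<equiv> {y. M \<le> y \<and> y < 2 ^ r * M \<and> [y = x] (mod g) \<and> y \<noteq> x}"
  assumes "x < 2 ^ r * M"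
  shows "(\<Sum>y\<in>S. 1 / real y) \<le> (if g < 2 ^ r * M then real r * (1 / real g + 1 / real M) else 0)"
proof (cases "g < 2 ^ r * M")
  case True
  have "(\<Sum>y\<in>S. 1 / real y) \<le> real r * (1 / real g + 1 / real M)"
  proof (rule sum_inverse_progression_le[OF _ _ assms(1,2)])
    show "S \<subseteq> {M..<2 ^ r * M}" unfolding S_def by auto
    show "[y = y'] (mod g)" if "y \<in> S" "y' \<in> S" for y y'
      using that unfolding S_def by (auto intro: cong_trans cong_sym)
  qed
  then show ?thesis using True by simp
next
  case False
  have "y = x" if "[y = x] (mod g)" "y < 2 ^ r * M" for y
    using that False assms(4) by (intro cong_less_modulus_unique_nat[of y x g]) auto
  then have "S = {}" unfolding S_def by auto
  then show ?thesis using False by simp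
qed

text \<open>A prime shared with \<open>s\<close> would be at most \<open>s \<le> z\<close>, against
  roughness; one shared with \<open>a + k b\<close> would divide \<open>s\<close>, as the modulus is
  \<open>s + l (a + k b)\<close>.\<close>

lemma rough_coprime:
  assumes "\<And>p. prime p \<Longrightarrow> p dvd orbit_mod a b s f \<Longrightarrow> z < p" "s \<le> z" "s > 0"
  shows "coprime (orbit_mod a b s f) s" "coprime (orbit_mod a b s f) (a + fst f * b)"
proof -
  have no: False if "prime p" "p dvd orbit_mod a b s f" "p dvd s" for p
  proof -
    have "p \<le> s" using that assms(3) by (intro dvd_imp_le) auto
    with assms(1)[OF that(1,2)] assms(2) show False by simp
  qed
  have ex: "\<exists>p. prime p \<and> p dvd x \<and> p dvd y" if "\<not> coprime x y" for x y :: nat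
  proof -
    have "gcd x y \<noteq> 1" using that coprime_iff_gcd_eq_1 by blast
    then obtain p where "prime p" "p dvd gcd x y" using prime_factor_nat by blast
    then show ?thesis by (intro exI[of _ p]) simp
  qed
  show "coprime (orbit_mod a b s f) s" using ex no by blast
  show "coprime (orbit_mod a b s f) (a + fst f * b)"
  proof (rule ccontr)
    assume "\<not> ?thesis"
    then obtain p where p: "prime p" "p dvd orbit_mod a b s f" "p dvd a + fst f * b" using ex by blast
    then have "p dvd s" unfolding orbit_mod_def by (simp add: dvd_add_left_iff)
    with no p show False by blast
  qed
qed

text \<open>With \<open>k\<close> fixed modulo \<open>g\<close>, the condition
  \<open>s + l (a + k b) = 0\<close> modulo \<open>g\<close> is linear in \<open>l\<close> with
  invertible coefficient.\<close>

lemma orbit_mod_cong_snd: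
  assumes "g dvd orbit_mod a b s f" "g dvd orbit_mod a b s f'" "[fst f = fst f'] (mod g)"
    and "coprime (orbit_mod a b s f) (a + fst f * b)"
  shows "[snd f = snd f'] (mod g)"
proof -
  have cop: "coprime (a + fst f * b) g"
    using assms(4) coprime_divisors[OF dvd_refl assms(1)] coprime_commute by blast
  have "[s + snd f * (a + fst f * b) = s + snd f' * (a + fst f' * b)] (mod g)"
    using assms(1,2) by (simp add: orbit_mod_def cong_def)
  also have "[s + snd f' * (a + fst f' * b) = s + snd f' * (a + fst f * b)] (mod g)"
    by (intro cong_add cong_mult cong_refl cong_sym[OF assms(3)])
  finally have "[snd f * (a + fst f * b) = snd f' * (a + fst f * b)] (mod g)"
    by (simp only: cong_add_lcancel_nat)
  then show ?thesis using cop by (simp only: cong_mult_rcancel_nat)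
qed

text \<open>Compatibility means that \<open>g\<close> divides \<open>(k - k') s\<close>, and
  \<open>s\<close> is invertible modulo \<open>g\<close>. Fixing both classes saves about
  \<open>g ^ 2\<close> in the reciprocal sum, which beats the factor \<open>g\<close> in the weight
  of a correlated pair.\<close>

lemma orbit_mod_pair_cong:
  assumes "g dvd orbit_mod a b s f" "g dvd orbit_mod a b s f'"
    and "int g dvd int (fst f * s) - int (fst f' * s)"
    and "coprime (orbit_mod a b s f) s" "coprime (orbit_mod a b s f) (a + fst f * b)"
  shows "[fst f = fst f'] (mod g)" "[snd f = snd f'] (mod g)"
proof -
  have cop: "coprime s g"
    using assms(4) coprime_divisors[OF dvd_refl assms(1)] coprime_commute by blast
  have "[fst f * s = fst f' * s] (mod g)"
    using assms(3) by (simp only: cong_int_iff[symmetric] cong_iff_dvd_diff)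
  then show "[fst f = fst f'] (mod g)" using cop by (simp only: cong_mult_rcancel_nat)
  then show "[snd f = snd f'] (mod g)" by (rule orbit_mod_cong_snd[OF assms(1,2) _ assms(5)])
qed

lemma sum_Un_nonneg_le:
  fixes h :: "'a \<Rightarrow> real"
  assumes "finite A" "finite B" "\<And>x. 0 \<le> h x"
  shows "sum h (A \<union> B) \<le> sum h A + sum h B"
proof -
  have "sum h (A \<union> B) + sum h (A \<inter> B) = sum h A + sum h B"
    by (rule sum.union_inter[OF assms(1,2)])
  moreover have "0 \<le> sum h (A \<inter> B)" by (rule sum_nonneg) (rule assms(3))
  ultimately show ?thesis by linarith
qed

text \<open>The pairs split into \<open>k' = k\<close>, \<open>l' = l\<close>, and both different.
  In the first two cases one reciprocal is fixed and exponentially small, so they are negligible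
  even for huge \<open>g\<close>. In the third, \<open>k' \<noteq> k\<close> forces
  \<open>g < L\<close>, and as the \<open>l\<close> start at \<open>L\<close> the rounding term
  \<open>g / L\<close> is at most 1: for this reason the range of \<open>l\<close> begins where that
  of \<open>k\<close> ends.\<close>

lemma sum_common_divisor_le:
  fixes g e k l :: nat
  assumes "g > 0" "e > 0"
  defines "K \<equiv> 2 ^ (4 * e)" and "L \<equiv> 2 ^ (8 * e)" and "R \<equiv> 2 ^ (10 * e)"
  assumes kl: "K \<le> k" "k < L" "L \<le> l" "l < R"
  defines "P \<equiv> {f \<in> {K..<L} \<times> {L..<R}. [fst f = k] (mod g) \<and> [snd f = l] (mod g) \<and> f \<noteq> (k, l)}"
  shows "(\<Sum>f\<in>P. real g / (real (fst f) * real (snd f)))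
    \<le> 28 * real e ^ 2 / 2 ^ (2 * e) + (if g < L then 16 * real e ^ 2 / real g else 0)"
proof -
  define A where "A = {y. K \<le> y \<and> y < L \<and> [y = k] (mod g) \<and> y \<noteq> k}"
  define B where "B = {y. L \<le> y \<and> y < R \<and> [y = l] (mod g) \<and> y \<noteq> l}"
  define SA where "SA = (\<Sum>y\<in>A. 1 / real y)"
  define SB where "SB = (\<Sum>y\<in>B. 1 / real y)"
  have finAB: "finite A" "finite B" unfolding A_def B_def by auto
  have LK: "L = 2 ^ (4 * e) * K" "R = 2 ^ (2 * e) * L" "K > 0" "L > 0"
    unfolding K_def L_def R_def by (auto simp flip: power_add)
  have rLK: "real L = real K * real K" "real R = 2 ^ (2 * e) * real L" "real K = 2 ^ (2 * e) * 2 ^ (2 * e)"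
    "(2::real) ^ (2 * e) \<ge> 1"
    unfolding LK K_def by (auto simp flip: power_add)
  have SA: "SA \<le> (if g < L then real (4 * e) * (1 / real g + 1 / real K) else 0)"
    using sum_inverse_other_residues_le[of g K k "4 * e"] assms(1) LK kl unfolding SA_def A_def by simp
  have SB: "SB \<le> (if g < R then real (2 * e) * (1 / real g + 1 / real L) else 0)"
    using sum_inverse_other_residues_le[of g L l "2 * e"] assms(1) LK kl unfolding SB_def B_def by simp
  have SA0: "SA \<ge> 0" "SB \<ge> 0" unfolding SA_def SB_def by (auto intro!: sum_nonneg)
  let ?h = "\<lambda>f. 1 / real (fst f) * (1 / real (snd f))"
  have "P \<subseteq> {k} \<times> B \<union> A \<times> {l} \<union> A \<times> B"
  proof (rule subsetI)
    fix f assume f: "f \<in> P"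
    obtain k' l' where f': "f = (k', l')" by (cases f)
    have "k' = k \<or> k' \<in> A" "l' = l \<or> l' \<in> B" "\<not> (k' = k \<and> l' = l)"
      using f unfolding f' P_def A_def B_def by simp_all
    then show "f \<in> {k} \<times> B \<union> A \<times> {l} \<union> A \<times> B" unfolding f' by blast
  qed
  then have "(\<Sum>f\<in>P. ?h f) \<le> (\<Sum>f\<in>{k} \<times> B \<union> A \<times> {l} \<union> A \<times> B. ?h f)"
    using finAB by (intro sum_mono2) auto
  also have "\<dots> \<le> (\<Sum>f\<in>{k} \<times> B \<union> A \<times> {l}. ?h f) + (\<Sum>f\<in>A \<times> B. ?h f)"
    using finAB by (intro sum_Un_nonneg_le) auto
  also have "(\<Sum>f\<in>{k} \<times> B \<union> A \<times> {l}. ?h f) \<le> (\<Sum>f\<in>{k} \<times> B. ?h f) + (\<Sum>f\<in>A \<times> {l}. ?h f)"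
    using finAB by (intro sum_Un_nonneg_le) auto
  also have "(\<Sum>f\<in>{k} \<times> B. ?h f) = 1 / real k * SB"
    using finAB by (simp add: SB_def sum.cartesian_product' sum_distrib_left)
  also have "(\<Sum>f\<in>A \<times> {l}. ?h f) = SA * (1 / real l)"
    by (simp add: SA_def sum.cartesian_product' sum_divide_distrib)
  also have "(\<Sum>f\<in>A \<times> B. ?h f) = SA * SB"
    by (simp only: SA_def SB_def sum_product sum.cartesian_product split_def)
  finally have h: "(\<Sum>f\<in>P. ?h f) \<le> 1 / real k * SB + SA * (1 / real l) + SA * SB" by simp
  \<comment> \<open>Here \<open>g\<close> may reach \<open>R\<close>; the excess
    \<open>g / L\<close>, at most \<open>2 ^ (2 * e)\<close>, is absorbed by \<open>1 / k\<close>,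
    at most \<open>1 / 2 ^ (4 * e)\<close>.\<close>
  have t1: "real g * SB * (1 / real k) \<le> 4 * real e / 2 ^ (2 * e)"
  proof -
    have "real g * SB \<le> 4 * real e * 2 ^ (2 * e)"
    proof (cases "g < R")
      case True
      have "real g * SB \<le> real g * (real (2 * e) * (1 / real g + 1 / real L))"
        using SB True by (intro mult_left_mono) auto
      also have "\<dots> = real (2 * e) * (1 + real g / real L)"
        using assms(1) by (simp add: field_simps)
      also have "real g / real L \<le> 2 ^ (2 * e)"
      proof -
        have "real g \<le> 2 ^ (2 * e) * real L" unfolding rLK(2)[symmetric] using True by simp
        then show ?thesis using LK(4) by (simp add: divide_le_eq)
      qed
      also have "real (2 * e) * (1 + 2 ^ (2 * e)) \<le> real (2 * e) * (2 * 2 ^ (2 * e))"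
        using rLK(4) by (intro mult_left_mono) auto
      finally show ?thesis using assms(2) by simp
    qed (use SB in \<open>simp add: mult_nonneg_nonpos order_trans[of _ 0]\<close>)
    moreover have "1 / real k \<le> 1 / real K" using kl(1) LK(3) by (intro divide_left_mono) auto
    ultimately have "real g * SB * (1 / real k) \<le> 4 * real e * 2 ^ (2 * e) * (1 / real K)"
      by (rule mult_mono) auto
    also have "\<dots> = 4 * real e / 2 ^ (2 * e)" unfolding rLK(3) by simp
    finally show ?thesis .
  qed
  have t2: "real g * SA * (1 / real l) \<le> 8 * real e / 2 ^ (2 * e)"
  proof -
    have "real g * SA \<le> 8 * real e * real K"
    proof (cases "g < L")
      case True
      have "real g * SA \<le> real g * (real (4 * e) * (1 / real g + 1 / real K))"
        using SA True by (intro mult_left_mono) auto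
      also have "\<dots> = real (4 * e) * (1 + real g / real K)"
        using assms(1) by (simp add: field_simps)
      also have "real g / real K \<le> real K"
      proof -
        have "real g \<le> real K * real K" unfolding rLK(1)[symmetric] using True by simp
        then show ?thesis using LK(3) by (simp add: divide_le_eq)
      qed
      also have "real (4 * e) * (1 + real K) \<le> real (4 * e) * (2 * real K)"
        using LK by (intro mult_left_mono) auto
      finally show ?thesis using assms(2) by simp
    qed (use SA in \<open>simp add: mult_nonneg_nonpos order_trans[of _ 0]\<close>)
    moreover have "1 / real l \<le> 1 / real L" using kl(3) LK(4) by (intro divide_left_mono) auto
    ultimately have "real g * SA * (1 / real l) \<le> 8 * real e * real K * (1 / real L)"
      by (rule mult_mono) auto
    also have "\<dots> = 8 * real e / real K" unfolding rLK(1) using LK by simp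
    also have "\<dots> \<le> 8 * real e / 2 ^ (2 * e)" unfolding rLK(3) using rLK(4)
      by (intro divide_left_mono) (auto simp: mult_le_cancel_left1)
    finally show ?thesis .
  qed
  have t3: "real g * (SA * SB) \<le> 16 * real e ^ 2 / 2 ^ (2 * e) + (if g < L then 16 * real e ^ 2 / real g else 0)"
  proof (cases "g < L")
    case True
    have gR: "g < R"
    proof -
      have "L \<le> R" unfolding LK(2) by simp
      then show ?thesis using True by simp
    qed
    have "real g * SB \<le> real g * (real (2 * e) * (1 / real g + 1 / real L))"
      using SB gR by (intro mult_left_mono) auto
    also have "\<dots> = real (2 * e) * (1 + real g / real L)"
      using assms(1) by (simp add: field_simps)
    also have "\<dots> \<le> real (2 * e) * 2"
      using True by (intro mult_left_mono) (auto simp: divide_le_eq)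
    finally have "SA * (real g * SB) \<le> (real (4 * e) * (1 / real g + 1 / real K)) * (real (2 * e) * 2)"
      using SA0 by (intro mult_mono[OF SA[unfolded if_P[OF True]]]) auto
    also have "\<dots> = 16 * real e ^ 2 / real g + 16 * real e ^ 2 / real K"
      by (simp add: power2_eq_square algebra_simps)
    also have "16 * real e ^ 2 / real K \<le> 16 * real e ^ 2 / 2 ^ (2 * e)" unfolding rLK(3) using rLK(4)
      by (intro divide_left_mono) (auto simp: mult_le_cancel_left1)
    finally show ?thesis using True by (simp add: mult.left_commute)
  next
    case False
    then have "SA = 0" using SA SA0 by simp
    then show ?thesis using False by simp
  qed
  have e2: "real e \<le> real e ^ 2" using assms(2) by (simp add: power2_eq_square)
  have "(\<Sum>f\<in>P. real g / (real (fst f) * real (snd f))) = real g * (\<Sum>f\<in>P. ?h f)"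
    by (simp add: sum_distrib_left)
  also have "\<dots> \<le> real g * (1 / real k * SB + SA * (1 / real l) + SA * SB)"
    using h by (intro mult_left_mono) auto
  also have "\<dots> = real g * SB * (1 / real k) + real g * SA * (1 / real l) + real g * (SA * SB)"
    by (simp add: algebra_simps)
  also have "\<dots> \<le> 4 * real e / 2 ^ (2 * e) + 8 * real e / 2 ^ (2 * e) +
     (16 * real e ^ 2 / 2 ^ (2 * e) + (if g < L then 16 * real e ^ 2 / real g else 0))"
    using t1 t2 t3 by linarith
  also have "\<dots> \<le> 28 * real e ^ 2 / 2 ^ (2 * e) + (if g < L then 16 * real e ^ 2 / real g else 0)"
  proof -
    have "4 * real e / 2 ^ (2 * e) + 8 * real e / 2 ^ (2 * e) = 12 * real e / 2 ^ (2 * e)"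
      by (simp add: add_divide_distrib[symmetric])
    also have "\<dots> \<le> 12 * real e ^ 2 / 2 ^ (2 * e)" using e2 by (intro divide_right_mono) auto
    finally show ?thesis by (simp add: field_simps)
  qed
  finally show ?thesis .
qed

lemma orbit_mod_bounds:
  assumes "b > 0"
  shows "fst f * snd f \<le> orbit_mod a b s f"
    and "fst f > 0 \<Longrightarrow> snd f > 0 \<Longrightarrow> orbit_mod a b s f \<le> (a + b + s) * (fst f * snd f)"
proof -
  have "fst f * snd f * 1 \<le> fst f * snd f * b" using assms by (intro mult_le_mono2) simp
  also have "\<dots> \<le> orbit_mod a b s f" by (simp add: orbit_mod_def algebra_simps)
  finally show "fst f * snd f \<le> orbit_mod a b s f" by simp
next
  assume "fst f > 0" "snd f > 0"
  then have "1 \<le> fst f * snd f" "1 \<le> fst f" by (simp_all add: Suc_le_eq)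
  then have "s * 1 \<le> s * (fst f * snd f)" "snd f * a * 1 \<le> snd f * a * fst f"
    using mult_le_mono2 by blast+
  moreover have "(a + b + s) * (fst f * snd f) = snd f * a * fst f + snd f * (fst f * b) + s * (fst f * snd f)"
    "orbit_mod a b s f = s * 1 + (snd f * a * 1 + snd f * (fst f * b))"
    by (simp_all add: orbit_mod_def algebra_simps)
  ultimately show "orbit_mod a b s f \<le> (a + b + s) * (fst f * snd f)" by linarith
qed

text \<open>Moduli without small prime factors have few divisors (\<open>card_divisors_le\<close>), so the boundary
  terms of the harmonic sums are negligible.\<close>

lemma correlation_bound:
  fixes a b s e z G :: nat and F :: "(nat \<times> nat) set"
  defines "m \<equiv> orbit_mod a b s"
  assumes pos: "b > 0" "s > 0" "e > 0"
    and F: "F \<subseteq> {2 ^ (4 * e)..<2 ^ (8 * e)} \<times> {2 ^ (8 * e)..<2 ^ (10 * e)}"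
    and rough: "\<And>f p. f \<in> F \<Longrightarrow> prime p \<Longrightarrow> p dvd m f \<Longrightarrow> z < p"
    and z: "s \<le> z" "2 ^ 18 \<le> z"
    and G: "a + b + s \<le> G" and small: "28 * real G * real e ^ 2 \<le> 2 ^ e"
  shows "(\<Sum>f\<in>F. \<Sum>f' | f' \<in> F \<and> gcd (m f) (m f') > 1 \<and>
            int (gcd (m f) (m f')) dvd int (fst f * s) - int (fst f' * s).
          real (gcd (m f) (m f')) / (real (m f) * real (m f')))
    \<le> 2 * (\<Sum>f\<in>F. 1 / real (m f)) + 512 * real e ^ 4 / real z"
proof -
  define K :: nat where "K = 2 ^ (4 * e)"
  define L :: nat where "L = 2 ^ (8 * e)"
  define R :: nat where "R = 2 ^ (10 * e)"
  have K0: "K > 0" "L > 0" and L_eq: "L = 2 ^ (4 * e) * K" "R = 2 ^ (2 * e) * L"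
    unfolding K_def L_def R_def by (auto simp flip: power_add)
  have FKL: "K \<le> fst f" "fst f < L" "L \<le> snd f" "snd f < R" if "f \<in> F" for f
    using F that unfolding K_def L_def R_def by auto
  have finF: "finite F" using F by (rule finite_subset) auto
  have fpos: "fst f > 0" "snd f > 0" if "f \<in> F" for f using FKL[OF that] K0 by auto
  have mge: "fst f * snd f \<le> m f" for f unfolding m_def by (rule orbit_mod_bounds(1)[OF pos(1)])
  have mpos: "m f > 0" if "f \<in> F" for f
    using mge[of f] fpos[OF that] by (metis nat_0_less_mult_iff le_zero_eq not_gr_zero)
  have minv: "1 / real (m f) \<le> 1 / (real (fst f) * real (snd f))" if "f \<in> F" for f
  proof -
    have "real (fst f * snd f) \<le> real (m f)" using mge by (simp only: of_nat_le_iff)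
    then show ?thesis using fpos[OF that] by (intro divide_left_mono) (auto simp: mpos that)
  qed
  have cop: "coprime (m f) s" "coprime (m f) (a + fst f * b)" if "f \<in> F" for f
    using rough_coprime[of a b s f z] rough[OF that] z pos unfolding m_def by auto
  have gz: "z < g" if "f \<in> F" "g dvd m f" "g > 1" for f g
  proof -
    obtain p where p: "prime p" "p dvd g" using \<open>g > 1\<close> prime_factor_nat[of g] by auto
    then have "z < p" using rough[OF that(1)] that(2) dvd_trans by blast
    also have "p \<le> g" using p(2) that(3) by (intro dvd_imp_le) auto
    finally show ?thesis .
  qed
  define D where "D f = {g. g dvd m f \<and> g > 1}" for f
  have finD: "finite (D f)" if "f \<in> F" for f
    using mpos[OF that] unfolding D_def by (intro finite_subset[OF _ finite_divisors_nat[of "m f"]]) auto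
  define c where "c f f' \<longleftrightarrow> gcd (m f) (m f') > 1 \<and> int (gcd (m f) (m f')) dvd int (fst f * s) - int (fst f' * s)" for f f'
  define P where "P g f = {f' \<in> {K..<L} \<times> {L..<R}. [fst f' = fst f] (mod g) \<and> [snd f' = snd f] (mod g) \<and> f' \<noteq> f}" for g f
  have finP: "finite (P g f)" for g f unfolding P_def by simp
  \<comment> \<open>The map sending \<open>f'\<close> to the gcd together with \<open>f'\<close> is
    injective, so the sum may be enlarged to all divisors \<open>g > 1\<close> of \<open>m f\<close>
    and all \<open>f'\<close> congruent to \<open>f\<close> modulo \<open>g\<close>;
    \<open>g\<close> need no longer be the exact gcd.\<close>
  have off: "(\<Sum>f'\<in>{f'\<in>F. c f f'} - {f}. real (gcd (m f) (m f')) / real (m f'))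
      \<le> 1 + 16 * real e ^ 2 * (\<Sum>g\<in>{g\<in>D f. g < L}. 1 / real g)" if f: "f \<in> F" for f
  proof -
    let ?Q = "{f'\<in>F. c f f'} - {f}"
    let ?\<phi> = "\<lambda>f'. (gcd (m f) (m f'), f')"
    let ?h = "\<lambda>x. real (fst x) / (real (fst (snd x)) * real (snd (snd x)))"
    have "(\<Sum>f'\<in>?Q. real (gcd (m f) (m f')) / real (m f')) \<le> (\<Sum>f'\<in>?Q. ?h (?\<phi> f'))"
    proof (rule sum_mono)
      fix f' assume "f' \<in> ?Q"
      then have "real (gcd (m f) (m f')) * (1 / real (m f')) \<le> real (gcd (m f) (m f')) * (1 / (real (fst f') * real (snd f')))"
        by (intro mult_left_mono minv) auto
      then show "real (gcd (m f) (m f')) / real (m f') \<le> ?h (?\<phi> f')" by simp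
    qed
    also have "\<dots> = (\<Sum>x\<in>?\<phi> ` ?Q. ?h x)" by (subst sum.reindex) (auto simp: inj_on_def)
    also have "\<dots> \<le> (\<Sum>x\<in>Sigma (D f) (\<lambda>g. P g f). ?h x)"
    proof (rule sum_mono2)
      show "finite (Sigma (D f) (\<lambda>g. P g f))" using finD[OF f] finP by (intro finite_SigmaI) auto
      show "?\<phi> ` ?Q \<subseteq> Sigma (D f) (\<lambda>g. P g f)"
      proof (rule image_subsetI)
        fix f' assume f': "f' \<in> ?Q"
        then have F': "f' \<in> F" "f' \<noteq> f" "gcd (m f) (m f') > 1"
          "int (gcd (m f) (m f')) dvd int (fst f * s) - int (fst f' * s)" by (auto simp: c_def)
        have "[fst f = fst f'] (mod gcd (m f) (m f'))" "[snd f = snd f'] (mod gcd (m f) (m f'))"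
          using orbit_mod_pair_cong[of "gcd (m f) (m f')" a b s f f'] F'(4) cop[OF f] unfolding m_def by auto
        then have "f' \<in> P (gcd (m f) (m f')) f"
          using F' FKL[OF F'(1)] unfolding P_def by (auto simp: cong_sym mem_Times_iff)
        then show "?\<phi> f' \<in> Sigma (D f) (\<lambda>g. P g f)" using F'(3) by (simp add: D_def)
      qed
    qed auto
    also have "\<dots> = (\<Sum>g\<in>D f. \<Sum>f'\<in>P g f. real g / (real (fst f') * real (snd f')))"
      using finD[OF f] finP by (subst sum.Sigma) (auto simp: split_def)
    also have "\<dots> \<le> (\<Sum>g\<in>D f. 28 * real e ^ 2 / 2 ^ (2 * e) + (if g < L then 16 * real e ^ 2 / real g else 0))"
    proof (rule sum_mono)
      fix g assume "g \<in> D f"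
      then have "g > 0" by (auto simp: D_def)
      from sum_common_divisor_le[OF this pos(3), of "fst f" "snd f", folded K_def L_def R_def, OF FKL[OF f]]
      show "(\<Sum>f'\<in>P g f. real g / (real (fst f') * real (snd f'))) \<le>
        28 * real e ^ 2 / 2 ^ (2 * e) + (if g < L then 16 * real e ^ 2 / real g else 0)"
        unfolding P_def by simp
    qed
    also have "\<dots> = real (card (D f)) * (28 * real e ^ 2 / 2 ^ (2 * e)) + 16 * real e ^ 2 * (\<Sum>g\<in>{g\<in>D f. g < L}. 1 / real g)"
      using finD[OF f] by (simp add: sum.distrib sum.inter_filter[symmetric] sum_distrib_left)
    also have "real (card (D f)) * (28 * real e ^ 2 / 2 ^ (2 * e)) \<le> 1"
    proof -
      \<comment> \<open>The exponent is 18 = 8 + 10 because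
        \<open>m f \<le> G * 2 ^ (18 * e)\<close> by the ranges of \<open>k\<close> and
        \<open>l\<close>. This leaves at most \<open>G * 2 ^ e\<close> divisors, against the saving
        \<open>2 ^ (2 * e)\<close> per divisor.\<close>
      have "card {d. d dvd m f} ^ 18 \<le> m f"
      proof (rule card_divisors_le[OF mpos[OF f]])
        fix p assume "prime p" "p dvd m f"
        then have "z < p" by (rule rough[OF f])
        with z(2) show "2 ^ 18 \<le> p" by linarith
      qed
      also have "m f \<le> (a + b + s) * (fst f * snd f)"
        unfolding m_def by (rule orbit_mod_bounds(2)[OF pos(1) fpos[OF f]])
      also have "\<dots> \<le> G * (L * R)"
        using FKL[OF f] G by (intro mult_le_mono) auto
      also have "\<dots> = G * (2 ^ e) ^ 18"
        unfolding L_def R_def by (simp flip: power_add power_mult)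
      also have "\<dots> \<le> G ^ 18 * (2 ^ e) ^ 18"
      proof (intro mult_le_mono1 self_le_power)
        show "1 \<le> G" using pos G by linarith
      qed simp
      also have "\<dots> = (G * 2 ^ e) ^ 18" by (simp add: power_mult_distrib)
      finally have pow: "card {d. d dvd m f} ^ 18 \<le> (G * 2 ^ e) ^ 18" .
      have "card {d. d dvd m f} \<le> G * 2 ^ e"
      proof (rule ccontr)
        assume "\<not> ?thesis"
        then have "(G * 2 ^ e) ^ 18 < card {d. d dvd m f} ^ 18" by (intro power_strict_mono) linarith+
        with pow show False by linarith
      qed
      moreover have "card (D f) \<le> card {d. d dvd m f}"
        using mpos[OF f] unfolding D_def by (intro card_mono) auto
      ultimately have "card (D f) \<le> G * 2 ^ e" by linarith
      then have "real (card (D f)) \<le> real (G * 2 ^ e)" by (simp only: of_nat_le_iff)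
      then have "real (card (D f)) \<le> real G * 2 ^ e" by simp
      then have "real (card (D f)) * (28 * real e ^ 2 / 2 ^ (2 * e)) \<le> real G * 2 ^ e * (28 * real e ^ 2 / 2 ^ (2 * e))"
        by (intro mult_right_mono) auto
      also have "\<dots> = 28 * real G * real e ^ 2 / 2 ^ e" by (simp add: mult_2 power_add)
      also have "\<dots> \<le> 1" using small by simp
      finally show ?thesis .
    qed
    finally show ?thesis by simp
  qed
  \<comment> \<open>One copy of \<open>1 / m f\<close> is the diagonal term \<open>f' = f\<close>,
    the other bounds all the boundary terms.\<close>
  have inner: "(\<Sum>f' | f' \<in> F \<and> c f f'. real (gcd (m f) (m f')) / (real (m f) * real (m f')))
      \<le> 2 * (1 / real (m f)) + 16 * real e ^ 2 * (\<Sum>g\<in>{g\<in>D f. g < L}. 1 / real (m f) * (1 / real g))" if f: "f \<in> F" for f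
  proof -
    let ?t = "\<lambda>f'. real (gcd (m f) (m f')) / (real (m f) * real (m f'))"
    have "(\<Sum>f' | f' \<in> F \<and> c f f'. ?t f') \<le> (\<Sum>f'\<in>insert f ({f'\<in>F. c f f'} - {f}). ?t f')"
      using finF by (intro sum_mono2) auto
    also have "\<dots> = ?t f + (\<Sum>f'\<in>{f'\<in>F. c f f'} - {f}. ?t f')"
      using finF by (intro sum.insert) auto
    also have "?t f = 1 / real (m f)" using mpos[OF f] by simp
    also have "(\<Sum>f'\<in>{f'\<in>F. c f f'} - {f}. ?t f') = 1 / real (m f) * (\<Sum>f'\<in>{f'\<in>F. c f f'} - {f}. real (gcd (m f) (m f')) / real (m f'))"
      by (simp add: sum_distrib_left)
    also have "1 / real (m f) + \<dots> \<le> 1 / real (m f) + 1 / real (m f) * (1 + 16 * real e ^ 2 * (\<Sum>g\<in>{g\<in>D f. g < L}. 1 / real g))"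
      using off[OF f] by (intro add_left_mono mult_left_mono) auto
    also have "\<dots> = 2 * (1 / real (m f)) + 16 * real e ^ 2 * (1 / real (m f) * (\<Sum>g\<in>{g\<in>D f. g < L}. 1 / real g))"
      by (simp add: algebra_simps)
    finally show ?thesis by (simp only: sum_distrib_left)
  qed
  have inv_k: "(\<Sum>k\<in>{K..<L}. 1 / real k) \<le> 8 * real e"
  proof -
    have "(\<Sum>k\<in>{K..<L}. 1 / real k) \<le> real (4 * e) * (1 / real 1 + 1 / real K)"
      by (rule sum_inverse_progression_le) (use L_eq K0 in auto)
    also have "\<dots> \<le> real (4 * e) * 2" using K0 by (intro mult_left_mono) auto
    finally show ?thesis by simp
  qed
  \<comment> \<open>For fixed \<open>k\<close> the admissible \<open>l\<close> lie in one class
    modulo \<open>g\<close>, which gains a second factor \<open>1 / g\<close>. What remains is the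
    sum of \<open>1 / g ^ 2\<close> over \<open>g > z\<close>, the source of
    \<open>1 / z\<close>.\<close>
  have per_g: "(\<Sum>f\<in>{f\<in>F. g dvd m f}. 1 / real (m f)) \<le> 32 * real e ^ 2 / real g" if g: "0 < g" "g < L" for g
  proof -
    let ?B = "\<lambda>k. {l. (k, l) \<in> F \<and> g dvd m (k, l)}"
    have finB: "finite (?B k)" for k
      by (rule finite_subset[of _ "snd ` F"]) (use finF in \<open>auto intro: rev_image_eqI\<close>)
    have B: "(\<Sum>l\<in>?B k. 1 / real l) \<le> 4 * real e / real g" for k
    proof -
      have "(\<Sum>l\<in>?B k. 1 / real l) \<le> real (2 * e) * (1 / real g + 1 / real L)"
      proof (rule sum_inverse_progression_le[OF _ _ g(1) K0(2)])
        show "?B k \<subseteq> {L..<2 ^ (2 * e) * L}" unfolding L_eq(2)[symmetric] using FKL by fastforce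
        show "[l = l'] (mod g)" if "l \<in> ?B k" "l' \<in> ?B k" for l l'
          using orbit_mod_cong_snd[of g a b s "(k, l)" "(k, l')"] that cop(2)[of "(k, l)"] unfolding m_def by auto
      qed
      also have "\<dots> \<le> real (2 * e) * (1 / real g + 1 / real g)"
        using g by (intro mult_left_mono add_left_mono divide_left_mono) auto
      finally show ?thesis by simp
    qed
    have Sig: "{f\<in>F. g dvd m f} = Sigma {K..<L} ?B" using FKL by fastforce
    have "(\<Sum>f\<in>{f\<in>F. g dvd m f}. 1 / real (m f)) \<le> (\<Sum>f\<in>{f\<in>F. g dvd m f}. 1 / real (fst f) * (1 / real (snd f)))"
      by (rule sum_mono) (use minv in auto)
    also have "\<dots> = (\<Sum>k\<in>{K..<L}. \<Sum>l\<in>?B k. 1 / real k * (1 / real l))"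
      unfolding Sig using finB by (subst sum.Sigma) (auto simp: split_def)
    also have "\<dots> = (\<Sum>k\<in>{K..<L}. 1 / real k * (\<Sum>l\<in>?B k. 1 / real l))"
      by (simp only: sum_distrib_left)
    also have "\<dots> \<le> (\<Sum>k\<in>{K..<L}. 1 / real k * (4 * real e / real g))"
      by (intro sum_mono mult_left_mono B) auto
    also have "\<dots> = (\<Sum>k\<in>{K..<L}. 1 / real k) * (4 * real e / real g)" by (simp only: sum_distrib_right)
    also have "\<dots> \<le> 8 * real e * (4 * real e / real g)" by (intro mult_right_mono inv_k) auto
    finally show ?thesis by (simp add: power2_eq_square)
  qed
  have "(\<Sum>f\<in>F. \<Sum>g\<in>{g\<in>D f. g < L}. 1 / real (m f) * (1 / real g)) \<le>
     (\<Sum>f\<in>F. \<Sum>g\<in>{g\<in>{z<..<L}. g dvd m f}. 1 / real (m f) * (1 / real g))"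
    by (intro sum_mono sum_mono2) (use gz in \<open>auto simp: D_def\<close>)
  also have "\<dots> = (\<Sum>g\<in>{z<..<L}. \<Sum>f\<in>{f\<in>F. g dvd m f}. 1 / real (m f) * (1 / real g))"
    by (rule sum.swap_restrict[OF finF]) simp
  also have "\<dots> \<le> (\<Sum>g\<in>{z<..<L}. 32 * real e ^ 2 / real g * (1 / real g))"
    unfolding sum_distrib_right[symmetric] by (intro sum_mono mult_right_mono per_g) auto
  also have "\<dots> = 32 * real e ^ 2 * (\<Sum>g\<in>{z<..<L}. 1 / real g ^ 2)"
    by (simp add: sum_distrib_left power2_eq_square)
  also have "\<dots> \<le> 32 * real e ^ 2 * (1 / real z)"
    using z pos by (intro mult_left_mono sum_inverse_squares_le) auto
  finally have dbl: "(\<Sum>f\<in>F. \<Sum>g\<in>{g\<in>D f. g < L}. 1 / real (m f) * (1 / real g)) \<le> 32 * real e ^ 2 * (1 / real z)" .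
  have "(\<Sum>f\<in>F. \<Sum>f' | f' \<in> F \<and> c f f'. real (gcd (m f) (m f')) / (real (m f) * real (m f')))
    \<le> (\<Sum>f\<in>F. 2 * (1 / real (m f)) + 16 * real e ^ 2 * (\<Sum>g\<in>{g\<in>D f. g < L}. 1 / real (m f) * (1 / real g)))"
    by (intro sum_mono inner)
  also have "\<dots> = 2 * (\<Sum>f\<in>F. 1 / real (m f)) + 16 * real e ^ 2 * (\<Sum>f\<in>F. \<Sum>g\<in>{g\<in>D f. g < L}. 1 / real (m f) * (1 / real g))"
    by (simp only: sum.distrib sum_distrib_left)
  also have "\<dots> \<le> 2 * (\<Sum>f\<in>F. 1 / real (m f)) + 16 * real e ^ 2 * (32 * real e ^ 2 * (1 / real z))"
    using dbl by (intro add_left_mono mult_left_mono) auto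
  also have "\<dots> = 2 * (\<Sum>f\<in>F. 1 / real (m f)) + 512 * real e ^ 4 / real z"
    by (simp add: power2_eq_square power4_eq_xxxx)
  finally show ?thesis unfolding c_def by simp
qed

section \<open>Integers avoiding all orbit conditions\<close>

lemma sum_dyadic_ge:
  fixes M r :: nat and t :: real
  assumes "finite A" "M > 0"
    and "\<And>j. j < r \<Longrightarrow> t * real (2 ^ j * M) \<le> real (card (A \<inter> {2 ^ j * M..<2 * (2 ^ j * M)}))"
  shows "real r * (t / 2) \<le> (\<Sum>x\<in>A \<inter> {M..<2 ^ r * M}. 1 / real x)"
  using assms(3)
proof (induction r)
  case (Suc r)
  define W where "W = 2 ^ r * M"
  have W: "W > 0" "M \<le> W" "2 ^ Suc r * M = 2 * W" using assms by (auto simp: W_def)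
  have "t / 2 \<le> (\<Sum>x\<in>A \<inter> {W..<2 * W}. 1 / real x)"
  proof -
    have "t / 2 = t * real W / (2 * real W)" using W by simp
    also have "\<dots> \<le> real (card (A \<inter> {W..<2 * W})) / (2 * real W)"
      using Suc.prems[of r] by (intro divide_right_mono) (auto simp: W_def)
    also have "\<dots> = (\<Sum>x\<in>A \<inter> {W..<2 * W}. 1 / (2 * real W))" by simp
    also have "\<dots> \<le> (\<Sum>x\<in>A \<inter> {W..<2 * W}. 1 / real x)"
      using W by (intro sum_mono divide_left_mono) auto
    finally show ?thesis .
  qed
  moreover have "real r * (t / 2) \<le> (\<Sum>x\<in>A \<inter> {M..<W}. 1 / real x)"
    unfolding W_def using Suc.prems by (intro Suc.IH) simp
  moreover have "A \<inter> {M..<2 * W} = A \<inter> {M..<W} \<union> A \<inter> {W..<2 * W}"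
    using W(2) by (auto dest: order.trans[OF W(2)])
  moreover have "(\<Sum>x\<in>A \<inter> {M..<W} \<union> A \<inter> {W..<2 * W}. 1 / real x) =
     (\<Sum>x\<in>A \<inter> {M..<W}. 1 / real x) + (\<Sum>x\<in>A \<inter> {W..<2 * W}. 1 / real x)"
    using assms(1) by (intro sum.union_disjoint) auto
  ultimately show ?case unfolding W(3) by (simp add: algebra_simps add_divide_distrib)
qed simp

text \<open>The primes up to \<open>2\<^sup>i\<close> are sieved by inclusion-exclusion, those between \<open>2\<^sup>i\<close> and
  \<open>2\<^sup>i\<^sup>+\<^sup>i\<^sup>/\<^sup>8\<close> by the union bound: their reciprocals sum to at most \<open>1/4\<close>.\<close>

lemma rough_count:
  "\<exists>c>0. \<forall>i\<ge>3. \<forall>a s u. coprime a s \<longrightarrow> 4 * 2 ^ (2 ^ i) * (1 + (2 ^ i) ^ 2) * (2 ^ i) ^ 2 \<le> c * real u \<longrightarrow>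
      c / (2 * real i ^ 2) * real u \<le>
        real (card {l\<in>{u..<2 * u}. \<forall>p. prime p \<and> p dvd s + l * a \<longrightarrow> 2 ^ (i + i div 8) < p})"
proof -
  obtain c :: real where c: "c > 0"
    "\<And>i. i \<ge> 3 \<Longrightarrow> c / real i ^ 2 \<le> (\<Prod>p | prime p \<and> p \<le> 2 ^ i. 1 - 1 / real p)"
    using prod_primes_lower by blast
  show ?thesis
  proof (intro exI[of _ c] conjI allI impI c(1))
    fix i a s u :: nat
    assume i: "i \<ge> 3" and cop: "coprime a s" and u: "4 * 2 ^ (2 ^ i) * (1 + (2 ^ i) ^ 2) * (2 ^ i) ^ 2 \<le> c * real u"
    let ?P = "{p::nat. prime p \<and> p \<le> 2 ^ i}" and ?Q = "{p::nat. prime p \<and> 2 ^ i < p \<and> p \<le> 2 ^ (i + i div 8)}"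
    have sub: "?P \<subseteq> {1..2 ^ i}" "?Q \<subseteq> {1..2 ^ (i + i div 8)}" by (auto simp: Suc_le_eq prime_gt_0_nat)
    have fin: "finite ?P" "finite ?Q" using sub by (auto intro: finite_subset)
    have cardP: "card ?P \<le> 2 ^ i" using card_mono[OF _ sub(1)] by simp
    have "card ?Q \<le> 2 ^ (i + i div 8)" using card_mono[OF _ sub(2)] by simp
    also have "\<dots> \<le> 2 ^ (i * 2)" by (intro power_increasing) auto
    finally have cardQ: "card ?Q \<le> (2 ^ i) ^ 2" by (simp only: power_mult)
    let ?D = "sieve_density ?P a"
    have "c / real i ^ 2 \<le> (\<Prod>p\<in>?P. 1 - 1 / real p)" by (rule c(2)[OF i])
    also have "\<dots> \<le> ?D" unfolding sieve_density_def
      by (rule prod_mono) (auto simp: divide_le_eq dest: prime_ge_1_nat)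
    finally have D: "c / real i ^ 2 \<le> ?D" .
    have sumQ: "(\<Sum>p\<in>?Q. 1 / real p) \<le> 1 / 4"
    proof -
      have "(\<Sum>p\<in>?Q. 1 / real p) \<le> 2 * real (i div 8) / real i"
        using i by (intro sum_primes_dyadic_range) auto
      also have "\<dots> \<le> 2 * (real i / 8) / real i"
        using of_nat_div_le_of_nat[of i 8, where 'a=real] by (intro divide_right_mono mult_left_mono) auto
      finally show ?thesis using i by simp
    qed
    have i2: "real i ^ 2 \<le> (2 ^ i) ^ 2" 
      by (intro power_mono) (auto simp: of_nat_less_two_power less_imp_le)
    have err: "2 ^ card ?P * (1 + real (card ?Q)) \<le> c / (4 * real i ^ 2) * real u"
    proof -
      have "real (card ?Q) \<le> real ((2 ^ i) ^ 2)" using cardQ by (simp only: of_nat_le_iff)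
      then have "2 ^ card ?P * (1 + real (card ?Q)) \<le> 2 ^ (2 ^ i) * (1 + (2 ^ i) ^ 2)"
        using cardP by (intro mult_mono power_increasing) auto
      moreover have "2 ^ (2 ^ i) * (1 + (2 ^ i) ^ 2) * (4 * real i ^ 2) \<le> 2 ^ (2 ^ i) * (1 + (2 ^ i) ^ 2) * (4 * (2 ^ i) ^ 2)"
        using i2 by (intro mult_left_mono) auto
      moreover have "2 ^ (2 ^ i) * (1 + (2 ^ i) ^ 2) * (4 * (2 ^ i) ^ 2) \<le> c * real u" using u by (simp add: mult_ac)
      ultimately have "2 ^ card ?P * (1 + real (card ?Q)) * (4 * real i ^ 2) \<le> c * real u"
        by (meson mult_right_mono order_trans zero_le_mult_iff zero_le_numeral zero_le_power2)
      then show ?thesis using i by (simp add: field_simps)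
    qed
    \<comment> \<open>The union bound keeps 3/4 of the sieved density and the error costs at most
      1/4, so half survives.\<close>
    have "c / (2 * real i ^ 2) * real u = c / real i ^ 2 * real u * (3 / 4) - c / (4 * real i ^ 2) * real u"
      using i by (simp add: field_simps)
    also have "\<dots> \<le> ?D * real (2 * u - u) * (1 - (\<Sum>p\<in>?Q. 1 / real p)) - 2 ^ card ?P * (1 + real (card ?Q))"
    proof (intro diff_mono err)
      show "c / real i ^ 2 * real u * (3 / 4) \<le> ?D * real (2 * u - u) * (1 - (\<Sum>p\<in>?Q. 1 / real p))"
        using D sumQ c(1) sieve_density_bounds(1)[of ?P a] by (intro mult_mono) auto
    qed
    also have "\<dots> \<le> real (card {l\<in>{u..<2 * u}. \<forall>q\<in>?P \<union> ?Q. \<not> q dvd s + l * a})"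
      by (rule legendre_sieve_union) (use fin cop in auto)
    also have "{l\<in>{u..<2 * u}. \<forall>q\<in>?P \<union> ?Q. \<not> q dvd s + l * a} = {l\<in>{u..<2 * u}. \<forall>p. prime p \<and> p dvd s + l * a \<longrightarrow> 2 ^ (i + i div 8) < p}"
    proof -
      have "(2::nat) ^ i \<le> 2 ^ (i + i div 8)" by (intro power_increasing) auto
      then have "q \<in> ?P \<union> ?Q \<longleftrightarrow> prime q \<and> \<not> 2 ^ (i + i div 8) < q" for q :: nat
        by (cases "q \<le> 2 ^ i") (auto simp only: mem_Collect_eq Un_iff not_less not_le intro: order.trans)
      then have "(\<forall>q\<in>?P \<union> ?Q. \<not> q dvd x) \<longleftrightarrow> (\<forall>p. prime p \<and> p dvd x \<longrightarrow> 2 ^ (i + i div 8) < p)" for x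
        by blast
      then show ?thesis by simp
    qed
    finally show "c / (2 * real i ^ 2) * real u \<le>
        real (card {l\<in>{u..<2 * u}. \<forall>p. prime p \<and> p dvd s + l * a \<longrightarrow> 2 ^ (i + i div 8) < p})" .
  qed
qed


text \<open>Since the modulus is at most \<open>G * k * l\<close>, it suffices to bound reciprocal
  sums over \<open>k\<close> and over \<open>l\<close>. With \<open>e = 2 ^ i\<close> the
  \<open>k\<close> fill \<open>4 * e\<close> dyadic blocks, and for each \<open>k\<close> the
  \<open>l\<close> occupy \<open>2 * e\<close> blocks with sieved density of order
  \<open>1 / i ^ 2\<close>.\<close>

lemma orbit_family_mass:
  fixes a b s :: nat
  assumes "b > 0" "s > 0" "coprime a s" "s dvd b"
  defines "m \<equiv> orbit_mod a b s"
  defines "F \<equiv> \<lambda>i. {f \<in> {2 ^ (4 * 2 ^ i)..<2 ^ (8 * 2 ^ i)} \<times> {2 ^ (8 * 2 ^ i)..<2 ^ (10 * 2 ^ i)}.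
            \<forall>p. prime p \<and> p dvd m f \<longrightarrow> 2 ^ (i + i div 8) < p}"
  shows "\<exists>c>0. eventually (\<lambda>i. c * (2 ^ i) ^ 2 / real i ^ 2 \<le> (\<Sum>f\<in>F i. 1 / real (m f))) sequentially"
proof -
  obtain c :: real where c: "c > 0"
    "\<forall>i\<ge>3. \<forall>a s u. coprime a s \<longrightarrow> 4 * 2 ^ (2 ^ i) * (1 + (2 ^ i) ^ 2) * (2 ^ i) ^ 2 \<le> c * real u \<longrightarrow>
      c / (2 * real i ^ 2) * real u \<le>
        real (card {l\<in>{u..<2 * u}. \<forall>p. prime p \<and> p dvd s + l * a \<longrightarrow> 2 ^ (i + i div 8) < p})"
    using rough_count by blast
  define G where "G = a + b + s"
  have G0: "G > 0" using assms by (simp add: G_def)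
  have "eventually (\<lambda>e::nat. 4 * 2 ^ e * (1 + real e ^ 2) * real e ^ 2 \<le> c * 2 ^ (8 * e)) sequentially"
    using c(1) by real_asymp
  moreover have "filterlim (\<lambda>i. 2 ^ i :: nat) sequentially sequentially"
    by (intro filterlim_subseq) (auto simp: strict_mono_def)
  ultimately have ev: "eventually (\<lambda>i. 4 * 2 ^ (2 ^ i) * (1 + real (2 ^ i) ^ 2) * real (2 ^ i) ^ 2 \<le> c * 2 ^ (8 * 2 ^ i)) sequentially"
    by (rule eventually_compose_filterlim)
  show ?thesis
  proof (intro exI[of _ "c / (2 * real G)"] conjI)
    show "0 < c / (2 * real G)" using c(1) G0 by simp
    show "eventually (\<lambda>i. c / (2 * real G) * (2 ^ i) ^ 2 / real i ^ 2 \<le> (\<Sum>f\<in>F i. 1 / real (m f))) sequentially"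
      using ev eventually_ge_at_top[of 3]
    proof eventually_elim
      case (elim i)
      define e :: nat where "e = 2 ^ i"
      define K :: nat where "K = 2 ^ (4 * e)"
      define L :: nat where "L = 2 ^ (8 * e)"
      define R :: nat where "R = 2 ^ (10 * e)"
      have K0: "K > 0" "L > 0" and L_eq: "L = 2 ^ (4 * e) * K" "R = 2 ^ (2 * e) * L"
        unfolding K_def L_def R_def by (auto simp flip: power_add)
      let ?B = "\<lambda>k. {l\<in>{L..<R}. \<forall>p. prime p \<and> p dvd m (k, l) \<longrightarrow> 2 ^ (i + i div 8) < p}"
      have FS: "F i = Sigma {K..<L} ?B"
        unfolding F_def K_def L_def R_def e_def by auto
      have big: "4 * 2 ^ (2 ^ i) * (1 + (2 ^ i) ^ 2) * (2 ^ i) ^ 2 \<le> c * real (2 ^ j * L)" for j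
      proof -
        have "c * 2 ^ (8 * 2 ^ i) \<le> c * real (2 ^ j * L)"
          unfolding L_def e_def using c(1) by (intro mult_left_mono) (auto simp: mult_le_cancel_right1)
        then show ?thesis using elim(1) by simp
      qed
      have B: "real (2 * e) * (c / (2 * real i ^ 2) / 2) \<le> (\<Sum>l\<in>?B k. 1 / real l)" if "k \<in> {K..<L}" for k
      proof -
        let ?A = "{l\<in>{L..<R}. \<forall>p. prime p \<and> p dvd s + l * (a + k * b) \<longrightarrow> 2 ^ (i + i div 8) < p}"
        \<comment> \<open>\<open>s dvd b\<close> makes \<open>a + k * b\<close> coprime to
          \<open>s\<close> for every \<open>k\<close>, as the sieve in \<open>l\<close> requires of
          difference and first term.\<close>
        have cop: "coprime (a + k * b) s"
        proof -
          obtain b' where "b = s * b'" using assms(4) by (auto elim: dvdE)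
          then have "a + k * b = a + (k * b') * s" by simp
          then show ?thesis using assms(3) by (metis coprime_commute gcd_add_mult coprime_iff_gcd_eq_1 add.commute)
        qed
        have "real (2 * e) * (c / (2 * real i ^ 2) / 2) \<le> (\<Sum>l\<in>?A \<inter> {L..<2 ^ (2 * e) * L}. 1 / real l)"
        proof (rule sum_dyadic_ge)
          fix j assume j: "j < 2 * e"
          have "2 * (2 ^ j * L) = 2 ^ Suc j * L" by simp
          also have "\<dots> \<le> R" unfolding L_eq(2) using j by (intro mult_le_mono1 power_increasing) auto
          finally have jR: "2 * (2 ^ j * L) \<le> R" .
          have jL: "L \<le> 2 ^ j * L" by simp
          have "c / (2 * real i ^ 2) * real (2 ^ j * L) \<le>
            real (card {l\<in>{2 ^ j * L..<2 * (2 ^ j * L)}. \<forall>p. prime p \<and> p dvd s + l * (a + k * b) \<longrightarrow> 2 ^ (i + i div 8) < p})"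
            using c(2) elim(2) cop big by blast
          also have "{l\<in>{2 ^ j * L..<2 * (2 ^ j * L)}. \<forall>p. prime p \<and> p dvd s + l * (a + k * b) \<longrightarrow> 2 ^ (i + i div 8) < p}
             = ?A \<inter> {2 ^ j * L..<2 * (2 ^ j * L)}"
            using order.trans[OF jL] order.strict_trans2[OF _ jR] by (intro Set.set_eqI) auto
          finally show "c / (2 * real i ^ 2) * real (2 ^ j * L) \<le> real (card (?A \<inter> {2 ^ j * L..<2 * (2 ^ j * L)}))" .
        qed (use K0 in auto)
        also have "?A \<inter> {L..<2 ^ (2 * e) * L} = ?B k" unfolding L_eq(2)[symmetric] m_def orbit_mod_def by auto
        finally show ?thesis .
      qed
      have inv_k: "real (4 * e) * (1 / 2) \<le> (\<Sum>k\<in>{K..<L}. 1 / real k)"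
      proof -
        have "real (4 * e) * (1 / 2) \<le> (\<Sum>k\<in>{K..<L} \<inter> {K..<2 ^ (4 * e) * K}. 1 / real k)"
        proof (rule sum_dyadic_ge)
          fix j assume j: "j < 4 * e"
          have "2 * (2 ^ j * K) = 2 ^ Suc j * K" by simp
          also have "\<dots> \<le> L" unfolding L_eq(1) using j by (intro mult_le_mono1 power_increasing) auto
          finally have "2 * (2 ^ j * K) \<le> L" .
          moreover have "K \<le> 2 ^ j * K" by simp
          ultimately have "{K..<L} \<inter> {2 ^ j * K..<2 * (2 ^ j * K)} = {2 ^ j * K..<2 * (2 ^ j * K)}" by auto
          then show "1 * real (2 ^ j * K) \<le> real (card ({K..<L} \<inter> {2 ^ j * K..<2 * (2 ^ j * K)}))" by simp
        qed (use K0 in auto)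
        then show ?thesis unfolding L_eq(1)[symmetric] by simp
      qed
      let ?t = "real (2 * e) * (c / (2 * real i ^ 2) / 2)"
      have t0: "0 \<le> ?t" using c(1) by simp
      have t2: "1 / real G * (real (4 * e) * (1 / 2) * ?t) = 2 * (c / (2 * real G) * (2 ^ i) ^ 2 / real i ^ 2)"
        by (simp add: e_def power2_eq_square)
      have dbl: "x \<le> 2 * x" if "0 \<le> x" for x :: real using that by simp
      have "c / (2 * real G) * (2 ^ i) ^ 2 / real i ^ 2 \<le> 1 / real G * (real (4 * e) * (1 / 2) * ?t)"
        unfolding t2 by (rule dbl) (use c(1) in simp)
      also have "\<dots> \<le> 1 / real G * ((\<Sum>k\<in>{K..<L}. 1 / real k) * ?t)"
        using inv_k t0 by (intro mult_left_mono mult_right_mono) auto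
      also have "\<dots> \<le> 1 / real G * (\<Sum>k\<in>{K..<L}. 1 / real k * (\<Sum>l\<in>?B k. 1 / real l))"
        unfolding sum_distrib_right[of _ _ ?t] by (intro sum_mono mult_left_mono B) auto
      also have "\<dots> = 1 / real G * (\<Sum>f\<in>F i. 1 / real (fst f) * (1 / real (snd f)))"
        unfolding FS sum_distrib_left by (subst sum.Sigma) (auto simp: split_def)
      also have "\<dots> = (\<Sum>f\<in>F i. 1 / real G * (1 / real (fst f) * (1 / real (snd f))))"
        by (rule sum_distrib_left)
      also have "\<dots> \<le> (\<Sum>f\<in>F i. 1 / real (m f))"
      proof (rule sum_mono)
        fix f assume "f \<in> F i"
        then have f: "fst f > 0" "snd f > 0" using K0 unfolding FS by auto
        have "m f \<le> G * (fst f * snd f)" unfolding m_def G_def by (rule orbit_mod_bounds(2)[OF assms(1) f])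
        then have "real (m f) \<le> real (G * (fst f * snd f))" by (simp only: of_nat_le_iff)
        moreover have "0 < m f" using assms(2) unfolding m_def orbit_mod_def by simp
        ultimately have "1 / real (G * (fst f * snd f)) \<le> 1 / real (m f)"
          by (intro divide_left_mono) (use f G0 in auto)
        then show "1 / real G * (1 / real (fst f) * (1 / real (snd f))) \<le> 1 / real (m f)" by simp
      qed
      finally show ?case .
    qed
  qed
qed


text \<open>Avoiding all \<open>k\<close> and \<open>l\<close> is stronger than avoiding the finite
  family \<open>F i\<close>, to which the second moment applies. The decay of
  \<open>\<eta> i * 2 ^ i\<close> encodes o(1 / log X), with \<open>2 ^ i\<close> in the role of the
  logarithm.\<close>

lemma orbit_avoiding_count:
  fixes a b s :: nat
  assumes "b > 0" "s > 0" "coprime a s" "s dvd b"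
  shows "\<exists>\<eta>. (\<lambda>i. \<eta> i * 2 ^ i) \<longlonglongrightarrow> 0 \<and> eventually (\<lambda>i. \<forall>X. 2 ^ (40 * 2 ^ i) \<le> X \<longrightarrow>
      real (card {n. n < X \<and> (\<forall>k l. \<not> int (orbit_mod a b s (k, l)) dvd int n - int (k * s))}) \<le> \<eta> i * real X) sequentially"
proof -
  define m where "m = orbit_mod a b s"
  define F where "F i = {f \<in> {2 ^ (4 * 2 ^ i)..<2 ^ (8 * 2 ^ i)} \<times> {2 ^ (8 * 2 ^ i)..<2 ^ (10 * 2 ^ i)}.
            \<forall>p. prime p \<and> p dvd m f \<longrightarrow> 2 ^ (i + i div 8) < p}" for i :: nat
  define G where "G = a + b + s"
  have G0: "real G > 0" using assms by (simp add: G_def)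
  obtain c :: real where c: "c > 0"
    "eventually (\<lambda>i. c * (2 ^ i) ^ 2 / real i ^ 2 \<le> (\<Sum>f\<in>F i. 1 / real (m f))) sequentially"
    using orbit_family_mass[OF assms] unfolding F_def m_def by blast
  \<comment> \<open>The terms are \<open>2 / M\<close> and \<open>515 * (e ^ 4 / z) / M ^ 2\<close>
    at the lower bound \<open>c * e ^ 2 / i ^ 2\<close> for \<open>M\<close>. Of 515, 512 comes from
    the correlations and 3 from rounding. The real power is a lower bound for
    \<open>2 ^ (i div 8)\<close> that avoids integer division in the limit.\<close>
  define \<eta> where "\<eta> i = 2 * real i ^ 2 / (c * (2 ^ i) ^ 2) + 515 * real i ^ 4 / (c ^ 2 * (2 ^ i * (2 powr (real i / 8 - 1))))" for i :: nat
  have lim: "(\<lambda>i. \<eta> i * 2 ^ i) \<longlonglongrightarrow> 0"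
    unfolding \<eta>_def using c(1) by real_asymp
  have "eventually (\<lambda>e::nat. 28 * real G * real e ^ 2 \<le> 2 ^ e) sequentially"
    using G0 by real_asymp
  moreover have "filterlim (\<lambda>i. 2 ^ i :: nat) sequentially sequentially"
    by (intro filterlim_subseq) (auto simp: strict_mono_def)
  ultimately have ev: "eventually (\<lambda>i. 28 * real G * real (2 ^ i) ^ 2 \<le> 2 ^ (2 ^ i)) sequentially"
    by (rule eventually_compose_filterlim)
  have "eventually (\<lambda>i. \<forall>X. 2 ^ (40 * 2 ^ i) \<le> X \<longrightarrow>
      real (card {n. n < X \<and> (\<forall>k l. \<not> int (m (k, l)) dvd int n - int (k * s))}) \<le> \<eta> i * real X) sequentially"
    using c(2) ev eventually_ge_at_top[of "18 + s"]
  proof eventually_elim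
    case (elim i)
    show ?case
    proof (intro allI impI)
      fix X :: nat
      assume X: "2 ^ (40 * 2 ^ i) \<le> X"
      define e :: nat where "e = 2 ^ i"
      define z :: nat where "z = 2 ^ (i + i div 8)"
      define M where "M = (\<Sum>f\<in>F i. 1 / real (m f))"
      define bad where "bad = real (card {n. n < X \<and> (\<forall>k l. \<not> int (m (k, l)) dvd int n - int (k * s))})"
      define C where "C = (\<Sum>f\<in>F i. \<Sum>f' | f' \<in> F i \<and> gcd (m f) (m f') > 1 \<and>
            int (gcd (m f) (m f')) dvd int (fst f * s) - int (fst f' * s).
          real (gcd (m f) (m f')) / (real (m f) * real (m f')))"
      have i18: "i \<ge> 18" "i \<ge> s" using elim(3) by auto
      have e0: "e > 0" by (simp add: e_def)
      have z_ge: "2 ^ i \<le> z" unfolding z_def by (intro power_increasing) auto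
      have mpos: "0 < m f" for f using assms(2) unfolding m_def orbit_mod_def by simp
      have finF: "finite (F i)" unfolding F_def by (rule finite_subset[OF _ finite_cartesian_product]) auto
      have "C \<le> 2 * M + 512 * real e ^ 4 / real z"
        unfolding C_def M_def m_def
      proof (rule correlation_bound[OF assms(1,2) e0])
        show "F i \<subseteq> {2 ^ (4 * e)..<2 ^ (8 * e)} \<times> {2 ^ (8 * e)..<2 ^ (10 * e)}"
          unfolding F_def e_def by blast
        show "z < p" if "f \<in> F i" "prime p" "p dvd orbit_mod a b s f" for f p
          using that unfolding F_def z_def m_def by blast
        have "i < 2 ^ i" by (rule less_exp)
        then show "s \<le> z" using z_ge i18 by linarith
        have "(2::nat) ^ 18 \<le> 2 ^ i" using i18 by (intro power_increasing) auto
        then show "2 ^ 18 \<le> z" using z_ge by linarith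
        show "a + b + s \<le> G" by (simp add: G_def)
        show "28 * real G * real e ^ 2 \<le> 2 ^ e" using elim(2) by (simp add: e_def)
      qed
      moreover have "bad * M ^ 2 \<le> real X * C + real (card (F i)) ^ 2 + 2 * M * real (card (F i))"
      proof -
        have "bad \<le> real (card {n. n < X \<and> (\<forall>f\<in>F i. \<not> int (m f) dvd int n - int (fst f * s))})"
          unfolding bad_def by (intro of_nat_mono card_mono) (auto simp: split_paired_all)
        then have "bad * M ^ 2 \<le> real (card {n. n < X \<and> (\<forall>f\<in>F i. \<not> int (m f) dvd int n - int (fst f * s))}) * M ^ 2"
          by (rule mult_right_mono) simp
        also have "\<dots> \<le> real X * C + real (card (F i)) ^ 2 + 2 * M * real (card (F i))"
          unfolding M_def C_def by (rule second_moment_avoiding[OF finF mpos])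
        finally show ?thesis .
      qed
      moreover have "M \<le> real (card (F i))"
      proof -
        have "M \<le> (\<Sum>f\<in>F i. 1)" unfolding M_def
          by (intro sum_mono) (use mpos in \<open>simp add: divide_le_eq Suc_le_eq\<close>)
        then show ?thesis by simp
      qed
      \<comment> \<open>At most \<open>2 ^ (18 * e)\<close> pairs give a square of at most
        \<open>2 ^ (36 * e)\<close>, below \<open>X\<close>; this is what the exponent 40 is for.
        The factor \<open>e ^ 4 / z \<ge> 1\<close> only brings the rounding error into the shape of
        the correlation term.\<close>
      moreover have cardF: "real (card (F i)) ^ 2 \<le> real X * (real e ^ 4 / real z)"
      proof -
        have "card (F i) \<le> card ({2 ^ (4 * e)..<(2::nat) ^ (8 * e)} \<times> {2 ^ (8 * e)..<(2::nat) ^ (10 * e)})"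
          unfolding F_def e_def by (intro card_mono) auto
        also have "\<dots> \<le> 2 ^ (8 * e) * 2 ^ (10 * e)"
          unfolding card_cartesian_product by (intro mult_le_mono) auto
        also have "\<dots> = 2 ^ (18 * e)" by (simp flip: power_add)
        finally have "card (F i) ^ 2 \<le> (2 ^ (18 * e)) ^ 2" by (rule power_mono) simp
        also have "\<dots> \<le> 2 ^ (40 * e)" unfolding power_mult[symmetric] by (intro power_increasing) auto
        finally have "card (F i) ^ 2 \<le> X" using X e_def by simp
        then have "real (card (F i) ^ 2) \<le> real X" by (simp only: of_nat_le_iff)
        then have "real (card (F i)) ^ 2 \<le> real X" by simp
        moreover have "z \<le> e ^ 4"
          unfolding z_def e_def power_mult[symmetric] by (intro power_increasing) auto
        then have "real z \<le> real (e ^ 4)" by (simp only: of_nat_le_iff)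
        then have "1 \<le> real e ^ 4 / real z" unfolding z_def by (simp add: le_divide_eq)
        then have "real X * 1 \<le> real X * (real e ^ 4 / real z)" by (intro mult_left_mono) auto
        ultimately show ?thesis by linarith
      qed
      moreover have M0: "M > 0"
      proof -
        have "0 < c * (2 ^ i) ^ 2 / real i ^ 2" using c(1) i18 by simp
        then show ?thesis using elim(1) unfolding M_def by linarith
      qed
      ultimately have main: "bad * M ^ 2 \<le> real X * (2 * M + 515 * (real e ^ 4 / real z))"
      proof -
        assume C: "C \<le> 2 * M + 512 * real e ^ 4 / real z"
          and b: "bad * M ^ 2 \<le> real X * C + real (card (F i)) ^ 2 + 2 * M * real (card (F i))"
          and Mc: "M \<le> real (card (F i))"
        have "real X * C \<le> real X * (2 * M + 512 * real e ^ 4 / real z)" using C by (intro mult_left_mono) auto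
        moreover have "2 * M * real (card (F i)) \<le> 2 * real (card (F i)) ^ 2"
          using Mc by (simp add: mult_right_mono power2_eq_square)
        moreover have "real X * (2 * M + 512 * real e ^ 4 / real z) = real X * (2 * M) + 512 * (real X * (real e ^ 4 / real z))"
          "real X * (2 * M + 515 * (real e ^ 4 / real z)) = real X * (2 * M) + 515 * (real X * (real e ^ 4 / real z))"
          by (simp_all add: distrib_left)
        ultimately show ?thesis using b cardF by linarith
      qed
      have "bad \<le> real X * (2 / M + 515 * (real e ^ 4 / real z) / M ^ 2)"
      proof -
        have "bad = bad * M ^ 2 / M ^ 2" using M0 by simp
        also have "\<dots> \<le> real X * (2 * M + 515 * (real e ^ 4 / real z)) / M ^ 2"
          using main by (rule divide_right_mono) simp
        also have "real X * (2 * M + W) / M ^ 2 = real X * (2 / M + W / M ^ 2)" for W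
          using M0 by (simp add: field_simps power2_eq_square)
        finally show ?thesis .
      qed
      also have "\<dots> \<le> real X * \<eta> i"
      proof (intro mult_left_mono)
        define M0' where "M0' = c * (2 ^ i) ^ 2 / real i ^ 2"
        have M': "0 < M0'" "M0' \<le> M" using c(1) i18 elim(1) unfolding M0'_def M_def by simp_all
        have "2 / M \<le> 2 / M0'" using M' by (intro divide_left_mono) auto
        also have "\<dots> = 2 * real i ^ 2 / (c * (2 ^ i) ^ 2)" unfolding M0'_def by simp
        finally have p1: "2 / M \<le> 2 * real i ^ 2 / (c * (2 ^ i) ^ 2)" .
        have zz: "2 ^ i * 2 powr (real i / 8 - 1) \<le> real z"
        proof -
          have "real i / 8 - 1 \<le> real (i div 8)" by linarith
          then have "2 powr (real i / 8 - 1) \<le> 2 powr real (i div 8)" by (intro powr_mono) auto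
          also have "\<dots> = 2 ^ (i div 8)" by (simp add: powr_realpow)
          finally show ?thesis unfolding z_def by (simp add: power_add)
        qed
        have "515 * (real e ^ 4 / real z) / M ^ 2 \<le> 515 * (real e ^ 4 / (2 ^ i * 2 powr (real i / 8 - 1))) / M0' ^ 2"
          using zz M' by (intro frac_le mult_left_mono divide_left_mono power_mono mult_pos_pos) auto
        also have "\<dots> = 515 * real i ^ 4 / (c ^ 2 * (2 ^ i * (2 powr (real i / 8 - 1))))"
          unfolding M0'_def e_def using c(1) i18
          by (simp add: power_mult_distrib power_divide divide_simps flip: power_mult)
        finally show "2 / M + 515 * (real e ^ 4 / real z) / M ^ 2 \<le> \<eta> i"
          unfolding \<eta>_def using p1 by linarith
      qed simp
      finally show "real (card {n. n < X \<and> (\<forall>k l. \<not> int (m (k, l)) dvd int n - int (k * s))}) \<le> \<eta> i * real X"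
        unfolding bad_def by (simp add: mult.commute)
    qed
  qed
  with lim show ?thesis unfolding m_def by blast
qed

section \<open>Matrices in \<open>H N q\<close>\<close>

lemma mmul_simp: "mmul (a, b, c, d) (a', b', c', d') = (a*a' + b*c', a*b' + b*d', c*a' + d*c', c*b' + d*d')"
  by (simp add: mmul_def)

lemma minv_simp: "minv (a, b, c, d) = (d, -b, -c, a)"
  by (simp add: minv_def)

lemma mmul_assoc: "mmul (mmul x y) z = mmul x (mmul y z)"
  by (cases x; cases y; cases z) (simp add: mmul_simp algebra_simps)

lemma mmul_mid: "mmul mid x = x" "mmul x mid = x"
  by (cases x; simp add: mmul_simp mid_def)+

lemma minv_right: "mdet x = 1 \<Longrightarrow> mmul x (minv x) = mid"
  by (cases x) (simp add: mmul_simp minv_simp mid_def mdet_def algebra_simps)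

lemma minv_left: "mdet x = 1 \<Longrightarrow> mmul (minv x) x = mid"
  by (cases x) (simp add: mmul_simp minv_simp mid_def mdet_def algebra_simps)

lemma mdet_mmul: "mdet (mmul x y) = mdet x * mdet y"
  by (cases x; cases y) (simp add: mmul_simp mdet_def algebra_simps)

lemma mdet_minv: "mdet (minv x) = mdet x"
  by (cases x) (simp add: minv_simp mdet_def algebra_simps)

lemma Gamma0_iff: "(a, b, c, d) \<in> Gamma0 N \<longleftrightarrow> a*d - b*c = 1 \<and> int N dvd c"
  by (simp add: Gamma0_def)

lemma Gamma0_mmul:
  assumes "x \<in> Gamma0 N" "y \<in> Gamma0 N"
  shows "mmul x y \<in> Gamma0 N"
proof -
  obtain a b c d where x: "x = (a, b, c, d)" by (cases x)
  obtain a' b' c' d' where y: "y = (a', b', c', d')" by (cases y)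
  have "mdet x = 1" "mdet y = 1" using assms by (simp_all add: x y mdet_def Gamma0_iff)
  then have "mdet (mmul x y) = 1" by (simp add: mdet_mmul)
  then show ?thesis using assms unfolding x y mmul_simp Gamma0_iff by (simp add: mdet_def)
qed

lemma gen_sub_mono:
  assumes "A \<subseteq> gen_sub B"
  shows "gen_sub A \<subseteq> gen_sub B"
proof
  fix x assume "x \<in> gen_sub A"
  then show "x \<in> gen_sub B"
    by induction (use assms in \<open>auto intro: gen_id gen_mul gen_inv\<close>)
qed

lemma H_closed: "x \<in> H N q \<Longrightarrow> y \<in> H N q \<Longrightarrow> mmul x y \<in> H N q" "x \<in> H N q \<Longrightarrow> minv x \<in> H N q"
  unfolding H_def by (auto intro: gen_mul gen_inv)

lemma H_generator: "(int q, b, c, d) \<in> Gamma0 N \<Longrightarrow> (int q, b, c, d) \<in> H N q"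
  unfolding H_def by (intro gen_base) simp

text \<open>If \<open>g\<close> has upper left entry \<open>q\<close>, then so do
  \<open>g T^k\<close> and \<open>U^j g\<close>, and quotients of such generators are the
  unipotents. Coprimality provides a \<open>g\<close> with lower left entry
  \<open>N\<close>.\<close>

lemma unipotents_in_H:
  assumes "coprime q N"
  shows "(1, k, 0, 1) \<in> H N q" and "(1, 0, int N * j, 1) \<in> H N q"
proof -
  have "coprime (int q) (int N)" using assms by simp
  then obtain x where "[int q * x = 1] (mod int N)" using cong_solve_coprime_int by blast
  then obtain y where y: "int q * x - 1 = int N * y" by (auto simp: cong_iff_dvd_diff elim: dvdE)
  have g: "(int q, y, int N, x) \<in> H N q" by (rule H_generator) (use y in \<open>simp add: Gamma0_iff algebra_simps\<close>)
  have "(int q, int q * k + y, int N, int N * k + x) \<in> H N q"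
    by (rule H_generator) (use y in \<open>simp add: Gamma0_iff algebra_simps\<close>)
  from H_closed(1)[OF H_closed(2)[OF g] this] show "(1, k, 0, 1) \<in> H N q"
    using y by (simp add: mmul_simp minv_simp algebra_simps)
  have "(int q, y, int N * j * int q + int N, int N * j * y + x) \<in> H N q"
    by (rule H_generator) (use y in \<open>simp add: Gamma0_iff algebra_simps\<close>)
  from H_closed(1)[OF this H_closed(2)[OF g]] show "(1, 0, int N * j, 1) \<in> H N q"
  proof -
    assume *: "mmul (int q, y, int N * j * int q + int N, int N * j * y + x) (minv (int q, y, int N, x)) \<in> H N q"
    have det: "int q * x - int N * y = 1" using y by simp
    have "int q * x + y * - int N = 1" "int q * - y + y * int q = 0" using det by (simp_all add: algebra_simps)
    moreover have "(int N * j * int q + int N) * x + (int N * j * y + x) * - int N = int N * j * (int q * x - int N * y)"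
      "(int N * j * int q + int N) * - y + (int N * j * y + x) * int q = int q * x - int N * y"
      by (simp_all add: algebra_simps)
    ultimately show ?thesis using * unfolding mmul_simp minv_simp det by (simp only: mult_1_right)
  qed
qed

lemma in_H_of_dvd:
  assumes M: "(a, b, int N * s, d) \<in> Gamma0 N" and q: "coprime q N"
    and dvd: "int N * (s + l * (a + k * int N * s)) dvd int q - (a + k * int N * s)"
  shows "(a, b, int N * s, d) \<in> H N q"
proof -
  define a' b' c' d' where "a' = a + k * (int N * s)" and "b' = b + k * d"
    and "c' = int N * s + int N * l * a'" and "d' = d + int N * l * b'"
  have "c' dvd int q - a'" using dvd unfolding c'_def a'_def by (simp add: algebra_simps)
  \<comment> \<open>A further factor \<open>T^j\<close> turns \<open>a'\<close> into
    \<open>q\<close>. The matrix is then a generator, and the three unipotents are undone from the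
    left.\<close>
  then obtain j where "int q - a' = c' * j" by (rule dvdE)
  then have j: "int q = a' + j * c'" by (simp add: algebra_simps)
  have det: "a * d - b * (int N * s) = 1" using M by (simp add: Gamma0_iff)
  have "(a' + j * c') * d' - (b' + j * d') * c' = a * d - b * (int N * s)"
    unfolding c'_def d'_def a'_def b'_def by (simp add: algebra_simps)
  then have "(int q, b' + j * d', c', d') \<in> H N q"
    using j det by (intro H_generator) (simp add: Gamma0_iff c'_def)
  then have "mmul (1, - k, 0, 1) (mmul (1, 0, int N * (- l), 1) (mmul (1, - j, 0, 1) (int q, b' + j * d', c', d'))) \<in> H N q"
    by (intro H_closed(1) unipotents_in_H[OF q])
  also have "mmul (1, - k, 0, 1) (mmul (1, 0, int N * (- l), 1) (mmul (1, - j, 0, 1) (int q, b' + j * d', c', d')))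
    = (a, b, int N * s, d)"
    unfolding j mmul_simp by (simp add: c'_def d'_def a'_def b'_def algebra_simps)
  finally show ?thesis .
qed

section \<open>Generators of SL2(Z) and finite generation of \<open>Gamma1 N\<close>\<close>

lemma SL2_induct:
  assumes det: "mdet g = 1"
    and one: "P mid"
    and step: "\<And>g t. mdet g = 1 \<Longrightarrow> P g \<Longrightarrow> t \<in> {(1, 1, 0, 1), (1, -1, 0, 1), (0, -1, 1, 0), (0, 1, -1, 0)} \<Longrightarrow> P (mmul g t)"
  shows "P g"
proof -
  have T: "P (mmul g (1, k, 0, 1))" if "mdet g = 1" "P g" for g k
  proof (induction k rule: int_induct[of _ 0])
    case base
    then show ?case using that mmul_mid(2)[of g] by (simp add: mid_def)
  next
    case (step1 i)
    have "P (mmul (mmul g (1, i, 0, 1)) (1, 1, 0, 1))"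
      by (rule step) (use that step1 in \<open>simp_all add: mdet_mmul\<close>, simp add: mdet_def)
    then show ?case by (simp add: mmul_assoc mmul_simp add.commute)
  next
    case (step2 i)
    have "P (mmul (mmul g (1, i, 0, 1)) (1, -1, 0, 1))"
      by (rule step) (use that step2 in \<open>simp_all add: mdet_mmul\<close>, simp add: mdet_def)
    then show ?case by (simp add: mmul_assoc mmul_simp)
  qed
  \<comment> \<open>Euclidean algorithm on the bottom row. The factors stand on the right because
    Schreier's argument follows \<open>g\<close> to \<open>mmul g t\<close> through the coset
    representatives.\<close>
  have "\<forall>a b d. a * d - b * c = 1 \<longrightarrow> P (a, b, c, d)" for c
  proof (induction "nat \<bar>c\<bar>" arbitrary: c rule: less_induct)
    case (less c)
    show ?case
    proof (intro allI impI)
      fix a b d assume d1: "a * d - b * c = 1"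
      show "P (a, b, c, d)"
      proof (cases "c = 0")
        case True
        with d1 have ad: "a * d = 1" by simp
        then consider "a = 1" "d = 1" | "a = -1" "d = -1" by (auto simp: zmult_eq_1_iff)
        then show ?thesis
        proof cases
          case 1
          have "P (mmul mid (1, b, 0, 1))" by (rule T[OF _ one]) (simp add: mid_def mdet_def)
          then show ?thesis using 1 True by (simp add: mmul_mid)
        next
          case 2
          have "P (mmul mid (0, -1, 1, 0))" by (rule step[OF _ one]) (auto simp: mid_def mdet_def)
          then have p: "P (0, -1, 1, 0)" by (simp add: mmul_mid)
          have "P (mmul (0, -1, 1, 0) (0, -1, 1, 0))" by (rule step[OF _ p]) (auto simp: mdet_def)
          then have p: "P (-1, 0, 0, -1)" by (simp add: mmul_simp)
          have "P (mmul (-1, 0, 0, -1) (1, - b, 0, 1))" by (rule T[OF _ p]) (simp add: mdet_def)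
          then show ?thesis using 2 True by (simp add: mmul_simp)
        qed
      next
        case False
        \<comment> \<open>The remainder of \<open>d\<close> modulo \<open>c\<close> becomes the
          lower left entry after a translation and a rotation; the two right factors below undo
          both.\<close>
        define k where "k = - (d div c)"
        have dk: "d + k * c = d mod c" unfolding k_def by (simp add: minus_div_mult_eq_mod)
        have "nat \<bar>d + k * c\<bar> < nat \<bar>c\<bar>" unfolding dk using False by (simp add: abs_mod_less)
        moreover have "(b + k * a) * - c - (- a) * (d + k * c) = 1" using d1 by (simp add: algebra_simps)
        ultimately have p: "P (b + k * a, - a, d + k * c, - c)" using less by blast
        have p: "P (mmul (b + k * a, - a, d + k * c, - c) (0, 1, -1, 0))"
          by (rule step[OF _ p]) (use d1 in \<open>auto simp: mdet_def algebra_simps\<close>)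
        have "P (mmul (mmul (b + k * a, - a, d + k * c, - c) (0, 1, -1, 0)) (1, - k, 0, 1))"
          by (rule T[OF _ p]) (use d1 in \<open>auto simp: mdet_def mmul_simp algebra_simps\<close>)
        then show ?thesis by (simp add: mmul_simp algebra_simps)
      qed
    qed
  qed
  then show ?thesis using det by (cases g) (auto simp: mdet_def)
qed

definition mat_mod :: "nat \<Rightarrow> mat2 \<Rightarrow> mat2" where
  "mat_mod N M = (case M of (a, b, c, d) \<Rightarrow> (a mod int N, b mod int N, c mod int N, d mod int N))"

lemma mat_mod_mmul:
  assumes "mat_mod N x = mat_mod N x'" "mat_mod N y = mat_mod N y'"
  shows "mat_mod N (mmul x y) = mat_mod N (mmul x' y')"
proof -
  obtain a b c d where x: "x = (a, b, c, d)" by (cases x)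
  obtain a' b' c' d' where x': "x' = (a', b', c', d')" by (cases x')
  obtain e f g h where y: "y = (e, f, g, h)" by (cases y)
  obtain e' f' g' h' where y': "y' = (e', f', g', h')" by (cases y')
  have h: "[a = a'] (mod int N)" "[b = b'] (mod int N)" "[c = c'] (mod int N)" "[d = d'] (mod int N)"
    "[e = e'] (mod int N)" "[f = f'] (mod int N)" "[g = g'] (mod int N)" "[h = h'] (mod int N)"
    using assms by (simp_all add: x y x' y' mat_mod_def cong_def)
  have "[a * e + b * g = a' * e' + b' * g'] (mod int N)" "[a * f + b * h = a' * f' + b' * h'] (mod int N)"
    "[c * e + d * g = c' * e' + d' * g'] (mod int N)" "[c * f + d * h = c' * f' + d' * h'] (mod int N)"
    by (intro cong_add cong_mult h)+
  then show ?thesis by (simp add: x y x' y' mmul_simp mat_mod_def cong_def)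
qed

lemma Gamma1_cong:
  assumes "mat_mod N x = mat_mod N y" "y \<in> Gamma1 N" "mdet x = 1"
  shows "x \<in> Gamma1 N"
proof -
  obtain a b c d where x: "x = (a, b, c, d)" by (cases x)
  obtain a' b' c' d' where y: "y = (a', b', c', d')" by (cases y)
  have "a mod int N = a' mod int N" "c mod int N = c' mod int N" "d mod int N = d' mod int N"
    using assms(1) by (simp_all add: x y mat_mod_def)
  moreover have "c' mod int N = 0" "a' mod int N = 1 mod int N" "d' mod int N = 1 mod int N"
    using assms(2) by (simp_all add: y Gamma1_def cong_def)
  moreover have "a * d - b * c = 1" using assms(3) by (simp add: x mdet_def)
  ultimately show ?thesis unfolding x Gamma1_def cong_def dvd_eq_mod_eq_0 by simp
qed

lemma Gamma1_det: "x \<in> Gamma1 N \<Longrightarrow> mdet x = 1"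
  by (auto simp: Gamma1_def mdet_def)

text \<open>Schreier's lemma for the subgroup of finite index \<open>Gamma1 N\<close>; coset representatives are
  chosen by residues modulo \<open>N\<close>.\<close>

lemma Gamma1_finitely_generated:
  assumes "N \<ge> 1"
  shows "\<exists>A. finite A \<and> A \<subseteq> Gamma1 N \<and> Gamma1 N \<subseteq> gen_sub A"
proof -
  define E :: "mat2 set" where "E = {(1, 1, 0, 1), (1, -1, 0, 1), (0, -1, 1, 0), (0, 1, -1, 0)}"
  have detE: "mdet t = 1" if "t \<in> E" for t using that by (auto simp: E_def mdet_def)
  define rep where "rep c = (SOME g. mdet g = 1 \<and> mat_mod N g = c)" for c
  define \<rho> where "\<rho> g = rep (mat_mod N g)" for g
  have rho: "mdet (\<rho> g) = 1" "mat_mod N (\<rho> g) = mat_mod N g" if "mdet g = 1" for g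
    using someI[of "\<lambda>h. mdet h = 1 \<and> mat_mod N h = mat_mod N g" g] that unfolding \<rho>_def rep_def by auto
  have rho_cong: "\<rho> g = \<rho> h" if "mat_mod N g = mat_mod N h" for g h
    using that by (simp add: \<rho>_def)
  define R where "R = \<rho> ` {g. mdet g = 1}"
  have "mat_mod N g \<in> {0..<int N} \<times> {0..<int N} \<times> {0..<int N} \<times> {0..<int N}" for g
    using assms by (cases g) (simp add: mat_mod_def)
  then have "R \<subseteq> rep ` ({0..<int N} \<times> {0..<int N} \<times> {0..<int N} \<times> {0..<int N})"
    unfolding R_def \<rho>_def by blast
  then have finR: "finite R" by (rule finite_subset) auto
  define step where "step r t = mmul (mmul r t) (minv (\<rho> (mmul r t)))" for r t
  \<comment> \<open>Residues modulo \<open>N\<close> distinguish cosets of the principal congruence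
    subgroup, which contains every \<open>step r t\<close> and is in general smaller than
    \<open>Gamma1 N\<close>. The representatives inside \<open>Gamma1 N\<close> supply the rest;
    that of \<open>mid\<close> need not be \<open>mid\<close> itself.\<close>
  define A where "A = case_prod step ` (R \<times> E) \<union> {r \<in> R. r \<in> Gamma1 N}"
  have detR: "mdet r = 1" if "r \<in> R" for r using that rho(1) unfolding R_def by auto
  have "finite A" using finR unfolding A_def E_def by auto
  moreover have "A \<subseteq> Gamma1 N"
  proof -
    have "step r t \<in> Gamma1 N" if r: "r \<in> R" and t: "t \<in> E" for r t
    proof -
      have det: "mdet (mmul r t) = 1" using detR[OF r] detE[OF t] by (simp add: mdet_mmul)
      have "mat_mod N (step r t) = mat_mod N (mmul (\<rho> (mmul r t)) (minv (\<rho> (mmul r t))))"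
        unfolding step_def using rho(2)[OF det] by (intro mat_mod_mmul) auto
      also have "mmul (\<rho> (mmul r t)) (minv (\<rho> (mmul r t))) = mid"
        by (rule minv_right) (rule rho(1)[OF det])
      finally have "mat_mod N (step r t) = mat_mod N mid" .
      then show ?thesis
      proof (rule Gamma1_cong)
        show "mid \<in> Gamma1 N" by (simp add: mid_def Gamma1_def)
        show "mdet (step r t) = 1" using det rho(1)[OF det] by (simp add: step_def mdet_mmul mdet_minv)
      qed
    qed
    then show ?thesis unfolding A_def by auto
  qed
  moreover have "g \<in> gen_sub A" if g: "g \<in> Gamma1 N" for g
  proof -
    have det: "mdet g = 1" using g by (rule Gamma1_det)
    have "\<exists>h\<in>gen_sub A. g = mmul h (\<rho> g)"
      using det
    proof (rule SL2_induct)
      have d: "mdet mid = 1" by (simp add: mid_def mdet_def)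
      have "mid \<in> Gamma1 N" by (simp add: mid_def Gamma1_def)
      then have "\<rho> mid \<in> Gamma1 N" using rho[OF d] by (intro Gamma1_cong[of N "\<rho> mid" mid]) auto
      then have "\<rho> mid \<in> A" using d unfolding A_def R_def by blast
      then have "minv (\<rho> mid) \<in> gen_sub A" by (intro gen_inv gen_base)
      moreover have "mid = mmul (minv (\<rho> mid)) (\<rho> mid)" using minv_left[OF rho(1)[OF d]] by simp
      ultimately show "\<exists>h\<in>gen_sub A. mid = mmul h (\<rho> mid)" by blast
    next
      fix g t :: mat2 assume g: "mdet g = 1" "\<exists>h\<in>gen_sub A. g = mmul h (\<rho> g)"
        and t: "t \<in> {(1, 1, 0, 1), (1, -1, 0, 1), (0, -1, 1, 0), (0, 1, -1, 0)}"
      have tE: "t \<in> E" using t by (simp add: E_def)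
      obtain h where h: "h \<in> gen_sub A" "g = mmul h (\<rho> g)" using g(2) by blast
      have rg: "\<rho> g \<in> R" using g(1) unfolding R_def by blast
      let ?r = "mmul (\<rho> g) t"
      have det: "mdet ?r = 1" using rho(1)[OF g(1)] detE[OF tE] by (simp add: mdet_mmul)
      have eq: "\<rho> (mmul g t) = \<rho> ?r"
        by (intro rho_cong mat_mod_mmul) (use rho(2)[OF g(1)] in auto)
      have "step (\<rho> g) t \<in> A" using rg tE unfolding A_def by blast
      then have "mmul h (step (\<rho> g) t) \<in> gen_sub A" using h(1) gen_base by (intro gen_mul)
      moreover have "mmul g t = mmul (mmul h (step (\<rho> g) t)) (\<rho> (mmul g t))"
      proof -
        have "mmul g t = mmul h ?r" using h(2) mmul_assoc by metis
        also have "?r = mmul (step (\<rho> g) t) (\<rho> ?r)"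
          unfolding step_def mmul_assoc[of ?r] minv_left[OF rho(1)[OF det]] mmul_mid ..
        finally show ?thesis unfolding eq mmul_assoc .
      qed
      ultimately show "\<exists>h\<in>gen_sub A. mmul g t = mmul h (\<rho> (mmul g t))" by blast
    qed
    then obtain h where h: "h \<in> gen_sub A" "g = mmul h (\<rho> g)" by blast
    have "\<rho> g \<in> Gamma1 N" using rho[OF det] g by (intro Gamma1_cong[of N "\<rho> g" g]) auto
    then have "\<rho> g \<in> A" using det unfolding A_def R_def by blast
    then show ?thesis using h by (metis gen_mul gen_base)
  qed
  ultimately show ?thesis by blast
qed

section \<open>Sets with o(x / log x) elements up to x\<close>

definition sparse :: "nat set \<Rightarrow> bool" where
  "sparse A \<longleftrightarrow> ((\<lambda>x::real. real (card {q \<in> A. real q \<le> x}) * ln x / x) \<longlongrightarrow> 0) at_top"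

lemma finite_nat_real_le: "finite {q \<in> A. real q \<le> x}"
proof (rule finite_subset)
  show "{q \<in> A. real q \<le> x} \<subseteq> {..nat \<lfloor>x\<rfloor>}" by (auto simp: le_nat_floor)
qed simp

lemma sparse_subset:
  assumes "sparse A" "B \<subseteq> A"
  shows "sparse B"
  unfolding sparse_def
proof (rule tendsto_sandwich[OF _ _ tendsto_const])
  show "((\<lambda>x::real. real (card {q \<in> A. real q \<le> x}) * ln x / x) \<longlongrightarrow> 0) at_top"
    using assms(1) by (simp add: sparse_def)
  show "eventually (\<lambda>x::real. 0 \<le> real (card {q \<in> B. real q \<le> x}) * ln x / x) at_top"
    using eventually_ge_at_top[of 1] by eventually_elim simp
  show "eventually (\<lambda>x::real. real (card {q \<in> B. real q \<le> x}) * ln x / x \<le> real (card {q \<in> A. real q \<le> x}) * ln x / x) at_top"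
    using eventually_ge_at_top[of 1]
  proof eventually_elim
    case (elim x)
    have "card {q \<in> B. real q \<le> x} \<le> card {q \<in> A. real q \<le> x}"
      using assms(2) by (intro card_mono finite_nat_real_le) auto
    then show ?case using elim by (intro divide_right_mono mult_right_mono) auto
  qed
qed

lemma sparse_Un:
  assumes "sparse A" "sparse B"
  shows "sparse (A \<union> B)"
  unfolding sparse_def
proof (rule tendsto_sandwich[OF _ _ tendsto_const])
  show "((\<lambda>x::real. real (card {q \<in> A. real q \<le> x}) * ln x / x + real (card {q \<in> B. real q \<le> x}) * ln x / x) \<longlongrightarrow> 0) at_top"
    using tendsto_add[OF assms[unfolded sparse_def]] by simp
  show "eventually (\<lambda>x::real. 0 \<le> real (card {q \<in> A \<union> B. real q \<le> x}) * ln x / x) at_top"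
    using eventually_ge_at_top[of 1] by eventually_elim simp
  show "eventually (\<lambda>x::real. real (card {q \<in> A \<union> B. real q \<le> x}) * ln x / x \<le>
     real (card {q \<in> A. real q \<le> x}) * ln x / x + real (card {q \<in> B. real q \<le> x}) * ln x / x) at_top"
    using eventually_ge_at_top[of 1]
  proof eventually_elim
    case (elim x)
    have "{q \<in> A \<union> B. real q \<le> x} = {q \<in> A. real q \<le> x} \<union> {q \<in> B. real q \<le> x}" by auto
    then have "card {q \<in> A \<union> B. real q \<le> x} \<le> card {q \<in> A. real q \<le> x} + card {q \<in> B. real q \<le> x}"
      using card_Un_le by simp
    then have "real (card {q \<in> A \<union> B. real q \<le> x}) \<le> real (card {q \<in> A. real q \<le> x}) + real (card {q \<in> B. real q \<le> x})"
      by linarith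
    then show ?case unfolding add_divide_distrib[symmetric] distrib_right[symmetric] 
      using elim by (intro divide_right_mono mult_right_mono) auto
  qed
qed

lemma sparse_UN:
  assumes "finite I" "\<And>i. i \<in> I \<Longrightarrow> sparse (A i)"
  shows "sparse (\<Union>i\<in>I. A i)"
  using assms
proof (induction I rule: finite_induct)
  case empty
  then show ?case by (simp add: sparse_def)
next
  case (insert i I)
  then show ?case by (simp add: sparse_Un)
qed

text \<open>Every large \<open>x\<close> lies in a window where \<open>X\<close> is between
  \<open>2 ^ (40 * 2 ^ i)\<close> and \<open>2 ^ (80 * 2 ^ i)\<close>, so
  \<open>ln x \<le> 80 * 2 ^ i\<close> and the decay of \<open>\<eta> i * 2 ^ i\<close> controls
  density times logarithm. \<open>K\<close> leaves room for boundedly many elements outside the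
  estimate.\<close>

lemma sparse_of_scales:
  fixes A :: "nat set" and \<eta> :: "nat \<Rightarrow> real" and K :: real
  assumes \<eta>: "(\<lambda>i. \<eta> i * 2 ^ i) \<longlonglongrightarrow> 0"
    and A: "eventually (\<lambda>i. \<forall>X. 2 ^ (40 * 2 ^ i) \<le> X \<longrightarrow> real (card {q \<in> A. q < X}) \<le> K + \<eta> i * real X) sequentially"
  shows "sparse A"
  unfolding sparse_def
proof (rule tendstoI)
  fix \<epsilon> :: real assume eps: "\<epsilon> > 0"
  \<comment> \<open>\<open>X \<le> 2 * x\<close> and \<open>ln x \<le> 80 * 2 ^ i\<close> cost a
    factor 160, and half of \<epsilon> is reserved for \<open>K\<close>.\<close>
  have "eventually (\<lambda>i. dist (\<eta> i * 2 ^ i) 0 < \<epsilon> / 320) sequentially"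
    using \<eta> eps by (intro tendstoD) auto
  from eventually_conj[OF this A] obtain i0 where i0: 
    "\<And>i. i \<ge> i0 \<Longrightarrow> \<bar>\<eta> i * 2 ^ i\<bar> < \<epsilon> / 320"
    "\<And>i X. i \<ge> i0 \<Longrightarrow> 2 ^ (40 * 2 ^ i) \<le> X \<Longrightarrow> real (card {q \<in> A. q < X}) \<le> K + \<eta> i * real X"
    unfolding eventually_sequentially by (auto simp: dist_norm)
  have "((\<lambda>x::real. \<bar>K\<bar> * ln x / x) \<longlongrightarrow> 0) at_top" by real_asymp
  then have "eventually (\<lambda>x::real. dist (\<bar>K\<bar> * ln x / x) 0 < \<epsilon> / 2) at_top"
    using eps by (intro tendstoD) auto
  then show "eventually (\<lambda>x::real. dist (real (card {q \<in> A. real q \<le> x}) * ln x / x) 0 < \<epsilon>) at_top"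
    using eventually_ge_at_top[of "2 ^ (40 * 2 ^ i0) :: real"] eventually_ge_at_top[of 1]
  proof eventually_elim
    case (elim x)
    define X where "X = nat \<lfloor>x\<rfloor> + 1"
    have Xx: "x < real X" "real X \<le> 2 * x" using elim(3) unfolding X_def by linarith+
    have ex: "X < 2 ^ (40 * 2 ^ X)"
    proof -
      have less: "X < 2 ^ X" by (rule less_exp)
      then have "X \<le> 40 * 2 ^ X" by linarith
      then have "(2::nat) ^ X \<le> 2 ^ (40 * 2 ^ X)" by (intro power_increasing) simp_all
      with less show ?thesis by linarith
    qed
    define j where "j = (LEAST j. X < 2 ^ (40 * 2 ^ j))"
    have j: "X < 2 ^ (40 * 2 ^ j)" unfolding j_def by (rule LeastI[of _ X]) (rule ex)
    have ji0: "j > i0"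
    proof (rule ccontr)
      assume "\<not> j > i0"
      then have "(2::nat) ^ (40 * 2 ^ j) \<le> 2 ^ (40 * 2 ^ i0)" by (intro power_increasing mult_le_mono) auto
      then have "X < 2 ^ (40 * 2 ^ i0)" using j by linarith
      then have "real X < 2 ^ (40 * 2 ^ i0)" by simp
      then show False using elim(2) Xx(1) by linarith
    qed
    then obtain i where i: "j = Suc i" "i \<ge> i0" by (cases j) auto
    have Xi: "2 ^ (40 * 2 ^ i) \<le> X"
      using not_less_Least[of i "\<lambda>j. X < 2 ^ (40 * 2 ^ j)"] i(1) unfolding j_def by simp
    have lnx: "ln x \<le> 80 * 2 ^ i"
    proof -
      have "40 * 2 ^ j = 80 * (2::nat) ^ i" using i(1) by simp
      then have "real X < 2 ^ (80 * 2 ^ i)" using j by simp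
      then have "x < 2 ^ (80 * 2 ^ i)" using Xx(1) by linarith
      then have "ln x < ln (2 ^ (80 * 2 ^ i))" using elim(3) by (intro ln_less_cancel_iff[THEN iffD2]) auto
      also have "\<dots> = real (80 * 2 ^ i) * ln 2" by (rule ln_realpow)
      also have "\<dots> \<le> real (80 * 2 ^ i) * 1" using ln_2_less_1 by (intro mult_left_mono) auto
      finally show ?thesis by simp
    qed
    have ln0: "0 \<le> ln x" using elim(3) by simp
    have "card {q \<in> A. real q \<le> x} \<le> card {q \<in> A. q < X}"
      using Xx(1) by (intro card_mono) auto
    then have "real (card {q \<in> A. real q \<le> x}) \<le> K + \<eta> i * real X"
      using i0(2)[OF i(2) Xi] by linarith
    also have "\<dots> \<le> \<bar>K\<bar> + \<bar>\<eta> i\<bar> * (2 * x)"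
      using Xx by (intro add_mono mult_mono) auto
    finally have "real (card {q \<in> A. real q \<le> x}) * ln x / x \<le> (\<bar>K\<bar> + \<bar>\<eta> i\<bar> * (2 * x)) * ln x / x"
      using ln0 elim(3) by (intro divide_right_mono mult_right_mono) auto
    also have "\<dots> = \<bar>K\<bar> * ln x / x + 2 * \<bar>\<eta> i\<bar> * ln x" using elim(3) by (simp add: field_simps)
    also have "2 * \<bar>\<eta> i\<bar> * ln x \<le> 2 * \<bar>\<eta> i\<bar> * (80 * 2 ^ i)" using lnx by (intro mult_left_mono) auto
    also have "\<dots> = 160 * \<bar>\<eta> i * 2 ^ i\<bar>" by (simp add: abs_mult)
    also have "\<dots> < \<epsilon> / 2" using i0(1)[OF i(2)] by simp
    also have "\<bar>K\<bar> * ln x / x + \<epsilon> / 2 < \<epsilon>"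
      using elim(1) abs_ge_self[of "\<bar>K\<bar> * ln x / x"] unfolding dist_real_def diff_0_right by linarith
    finally have "real (card {q \<in> A. real q \<le> x}) * ln x / x < \<epsilon>" by simp
    moreover have "0 \<le> real (card {q \<in> A. real q \<le> x}) * ln x / x" using ln0 elim(3) by simp
    ultimately show ?case by (simp add: dist_norm)
  qed
qed

section \<open>Exceptional moduli\<close>

text \<open>Left multiplication by \<open>T\<close> and \<open>U\<close> preserves the upper left
  entry modulo \<open>N\<close>, so only \<open>q\<close> in this residue class can be reached from
  \<open>M\<close>.\<close>

definition missed :: "nat \<Rightarrow> mat2 \<Rightarrow> nat set" where
  "missed N M = {q. 0 < q \<and> coprime q N \<and> [int q = fst M] (mod int N) \<and> M \<notin> H N q}"

lemma sparse_missed_pos: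
  assumes N: "N \<ge> 1" and M: "(a, b, int N * s, d) \<in> Gamma0 N" and pos: "a > 0" "s > 0"
  shows "sparse (missed N (a, b, int N * s, d))"
proof -
  define a' where "a' = nat a"
  define s' where "s' = nat s"
  have as: "a = int a'" "s = int s'" "a' > 0" "s' > 0" using pos by (simp_all add: a'_def s'_def)
  have det: "a * d - b * (int N * s) = 1" using M by (simp add: Gamma0_iff)
  have "coprime a s"
  proof (rule coprimeI)
    fix c assume "c dvd a" "c dvd s"
    then have "c dvd a * d - b * (int N * s)" by (intro dvd_diff) auto
    then show "is_unit c" using det by simp
  qed
  then have cop: "coprime a' s'" by (simp add: as)
  define bad where "bad X = {n. n < X \<and> (\<forall>k l. \<not> int (orbit_mod a' (N * s') s' (k, l)) dvd int n - int (k * s'))}" for X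
  have "N * s' > 0" "s' > 0" "s' dvd N * s'" using N as by simp_all
  from orbit_avoiding_count[OF this(1,2) cop this(3)] obtain \<eta> where \<eta>: "(\<lambda>i. \<eta> i * 2 ^ i) \<longlonglongrightarrow> 0"
    "eventually (\<lambda>i. \<forall>X. 2 ^ (40 * 2 ^ i) \<le> X \<longrightarrow> real (card (bad X)) \<le> \<eta> i * real X) sequentially"
    unfolding bad_def by blast
  \<comment> \<open>The finitely many \<open>q < a'\<close> become the constant \<open>K\<close> of
    \<open>sparse_of_scales\<close>; any other missed \<open>q\<close> is \<open>a' + N * n\<close>
    with \<open>n\<close> satisfying none of the congruences.\<close>
  have sub: "{q \<in> missed N (a, b, int N * s, d). q < X} \<subseteq> {..<a'} \<union> (\<lambda>n. a' + N * n) ` bad X" for X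
  proof
    fix q assume "q \<in> {q \<in> missed N (a, b, int N * s, d). q < X}"
    then have q: "coprime q N" "[int q = a] (mod int N)" "(a, b, int N * s, d) \<notin> H N q" "q < X"
      by (auto simp: missed_def)
    show "q \<in> {..<a'} \<union> (\<lambda>n. a' + N * n) ` bad X"
    proof (cases "q < a'")
      case False
      have "[q = a'] (mod N)" using q(2) by (simp add: as cong_int_iff)
      then have "N dvd q - a'" using False cong_altdef_nat[of a' q N] by simp
      then obtain n where n: "q - a' = N * n" by (rule dvdE)
      then have qn: "q = a' + N * n" using False by simp
      have "n \<le> N * n" using N by simp
      then have nX: "n < X" using qn q(4) by linarith
      have "\<not> int (orbit_mod a' (N * s') s' (k, l)) dvd int n - int (k * s')" for k l
      proof
        assume dvd: "int (orbit_mod a' (N * s') s' (k, l)) dvd int n - int (k * s')"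
        have "int (orbit_mod a' (N * s') s' (k, l)) = s + int l * (a + int k * int N * s)"
          by (simp add: orbit_mod_def as)
        moreover have "int N * (int n - int (k * s')) = int q - (a + int k * int N * s)"
          by (simp add: qn as algebra_simps)
        ultimately have "int N * (s + int l * (a + int k * int N * s)) dvd int q - (a + int k * int N * s)"
          using mult_dvd_mono[OF dvd_refl dvd, of "int N"] by simp
        from in_H_of_dvd[OF M q(1) this] q(3) show False by simp
      qed
      then have "n \<in> bad X" using nX by (simp add: bad_def)
      then show ?thesis using qn by blast
    qed simp
  qed
  have cnt: "real (card {q \<in> missed N (a, b, int N * s, d). q < X}) \<le> real a' + real (card (bad X))" for X
  proof -
    have fin: "finite (bad X)" unfolding bad_def by simp
    have "card {q \<in> missed N (a, b, int N * s, d). q < X} \<le> card ({..<a'} \<union> (\<lambda>n. a' + N * n) ` bad X)"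
      using sub fin by (intro card_mono) auto
    also have "\<dots> \<le> card {..<a'} + card ((\<lambda>n. a' + N * n) ` bad X)" by (rule card_Un_le)
    also have "\<dots> \<le> a' + card (bad X)" using card_image_le[OF fin] by simp
    finally show ?thesis by linarith
  qed
  have "eventually (\<lambda>i. \<forall>X. 2 ^ (40 * 2 ^ i) \<le> X \<longrightarrow>
    real (card {q \<in> missed N (a, b, int N * s, d). q < X}) \<le> real a' + \<eta> i * real X) sequentially"
  proof (rule eventually_mono[OF \<eta>(2)], intro allI impI)
    fix i X :: nat assume "\<forall>X. 2 ^ (40 * 2 ^ i) \<le> X \<longrightarrow> real (card (bad X)) \<le> \<eta> i * real X" "2 ^ (40 * 2 ^ i) \<le> X"
    then have "real (card (bad X)) \<le> \<eta> i * real X" by blast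
    then show "real (card {q \<in> missed N (a, b, int N * s, d). q < X}) \<le> real a' + \<eta> i * real X"
      using cnt[of X] by linarith
  qed
  with \<eta>(1) show ?thesis by (rule sparse_of_scales)
qed


text \<open>\<open>T\<close> and \<open>U\<close> lie in \<open>H N q\<close>, so multiplying
  \<open>M\<close> by them on the left loses no missed \<open>q\<close>. This moves \<open>M\<close>
  to a positive first column: \<open>a\<close> nonzero, then \<open>s > 0\<close>, then
  \<open>a > 0\<close>.\<close>

lemma sparse_missed:
  assumes N: "N \<ge> 1" and M: "M \<in> Gamma0 N"
  shows "sparse (missed N M)"
proof -
  have shift: "missed N M \<subseteq> missed N (mmul u M)"
    if M: "M \<in> Gamma0 N" and u: "u = (1, k, 0, 1) \<or> u = (1, 0, int N * k, 1)" for M u k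
  proof
    fix q assume q: "q \<in> missed N M"
    obtain a b c d where Me: "M = (a, b, c, d)" by (cases M)
    have "int N dvd c" using M by (simp add: Me Gamma0_iff)
    then have "[a + k * c = a + k * 0] (mod int N)" by (intro cong_add cong_mult) (auto simp: cong_0_iff)
    then have "[fst (mmul u M) = fst M] (mod int N)" using u by (auto simp: Me mmul_simp)
    then have "[int q = fst (mmul u M)] (mod int N)"
      using q unfolding missed_def by (auto intro: cong_trans cong_sym)
    moreover have "mmul u M \<notin> H N q"
    proof
      assume uM: "mmul u M \<in> H N q"
      have "u \<in> H N q" using unipotents_in_H[of q N] q u by (auto simp: missed_def)
      from H_closed(1)[OF H_closed(2)[OF this] uM] have "mmul (minv u) (mmul u M) \<in> H N q" .
      moreover have "mdet u = 1" using u by (auto simp: mdet_def)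
      then have "mmul (minv u) (mmul u M) = M" by (simp add: mmul_assoc[symmetric] minv_left mmul_mid)
      ultimately show False using q by (simp add: missed_def)
    qed
    ultimately show "q \<in> missed N (mmul u M)" using q by (simp add: missed_def)
  qed
  have uG: "u \<in> Gamma0 N" if "u = (1, k, 0, 1) \<or> u = (1, 0, int N * k, 1)" for u k
    using that by (auto simp: Gamma0_iff)
  obtain a b c d where Me: "M = (a, b, c, d)" by (cases M)
  have det: "a * d - b * c = 1" and c: "int N dvd c" using M by (simp_all add: Me Gamma0_iff)
  \<comment> \<open>If \<open>a = 0\<close>, the determinant forces \<open>c\<close> to be nonzero,
    so adding the bottom row once suffices.\<close>
  define M1 where "M1 = mmul (1, if a = 0 then 1 else 0, 0, 1) M"
  have M1: "M1 \<in> Gamma0 N" "missed N M \<subseteq> missed N M1" unfolding M1_def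
    using shift[OF M] Gamma0_mmul[OF uG M] by blast+
  obtain a1 b1 c1 d1 where M1e: "M1 = (a1, b1, c1, d1)" by (cases M1)
  have a1: "a1 \<noteq> 0" using M1e det unfolding M1_def Me mmul_simp by (auto split: if_splits)
  obtain s1 where s1: "c1 = int N * s1" using M1(1) unfolding M1e Gamma0_iff by (auto elim: dvdE)
  \<comment> \<open>The sign makes \<open>l * a1\<close> positive and
    \<open>\<bar>s1\<bar> + 1\<close> makes it outweigh \<open>s1\<close>.\<close>
  define l where "l = sgn a1 * (\<bar>s1\<bar> + 1)"
  define M2 where "M2 = mmul (1, 0, int N * l, 1) M1"
  have M2: "M2 \<in> Gamma0 N" "missed N M1 \<subseteq> missed N M2" unfolding M2_def
    using shift[OF M1(1)] Gamma0_mmul[OF uG M1(1)] by blast+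
  define s2 where "s2 = s1 + l * a1"
  have "l * a1 = \<bar>a1\<bar> * (\<bar>s1\<bar> + 1)" unfolding l_def by (simp add: abs_sgn mult_ac)
  moreover have "\<bar>s1\<bar> + 1 \<le> \<bar>a1\<bar> * (\<bar>s1\<bar> + 1)" using mult_right_mono[of 1 "\<bar>a1\<bar>" "\<bar>s1\<bar> + 1"] a1 by simp
  ultimately have s2: "s2 > 0" unfolding s2_def by linarith
  have M2e: "M2 = (a1, b1, int N * s2, int N * l * b1 + d1)"
    unfolding M2_def M1e mmul_simp s1 s2_def by (simp add: algebra_simps)
  define k where "k = \<bar>a1\<bar> + 1"
  define M3 where "M3 = mmul (1, k, 0, 1) M2"
  have M3: "M3 \<in> Gamma0 N" "missed N M2 \<subseteq> missed N M3" unfolding M3_def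
    using shift[OF M2(1)] Gamma0_mmul[OF uG M2(1)] by blast+
  have M3e: "M3 = (a1 + k * (int N * s2), b1 + k * (int N * l * b1 + d1), int N * s2, int N * l * b1 + d1)"
    unfolding M3_def M2e mmul_simp by simp
  have "1 \<le> int N * s2" using N s2 by (simp add: int_one_le_iff_zero_less)
  then have "k * 1 \<le> k * (int N * s2)" unfolding k_def by (intro mult_left_mono) auto
  moreover have "- a1 < k" unfolding k_def by linarith
  ultimately have "a1 + k * (int N * s2) > 0" by linarith
  from sparse_missed_pos[OF N M3(1)[unfolded M3e] this s2] have "sparse (missed N M3)" unfolding M3e .
  then show ?thesis using M1(2) M2(2) M3(2) by (blast intro: sparse_subset)
qed

text \<open>A generator \<open>g\<close> of \<open>Gamma1 N\<close> has upper left entry 1 modulo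
  \<open>N\<close>, so \<open>missed N g\<close> only concerns \<open>q\<close> congruent to 1. For
  the class of \<open>r\<close> one writes \<open>g = (g h) h^-1\<close> with \<open>h\<close> of
  upper left entry \<open>r\<close>; both \<open>h\<close> and \<open>g h\<close> have this entry
  modulo \<open>N\<close>. Inserting \<open>mid\<close> accounts for \<open>h\<close>
  itself.\<close>

lemma sparse_exceptional:
  assumes N: "N \<ge> 1"
  shows "sparse {q. 0 < q \<and> coprime q N \<and> \<not> Gamma1 N \<subseteq> H N q}"
proof -
  obtain A where A: "finite A" "A \<subseteq> Gamma1 N" "Gamma1 N \<subseteq> gen_sub A"
    using Gamma1_finitely_generated[OF N] by blast
  have "\<exists>h\<in>Gamma0 N. fst h = int r" if "coprime r N" for r
  proof -
    have "coprime (int r) (int N)" using that by simp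
    then obtain x where "[int r * x = 1] (mod int N)" using cong_solve_coprime_int by blast
    then obtain y where "int r * x - 1 = int N * y" by (auto simp: cong_iff_dvd_diff elim: dvdE)
    then show ?thesis by (intro bexI[of _ "(int r, y, int N, x)"]) (simp_all add: Gamma0_iff algebra_simps)
  qed
  then obtain h where h: "\<And>r. coprime r N \<Longrightarrow> h r \<in> Gamma0 N" "\<And>r. coprime r N \<Longrightarrow> fst (h r) = int r" by metis
  have G10: "g \<in> Gamma0 N" if "g \<in> insert mid A" for g
    using that A(2) by (auto simp: Gamma1_def Gamma0_def mid_def)
  have fst_gh: "[fst (mmul g M) = fst M] (mod int N)" if g: "g \<in> insert mid A" and M: "M \<in> Gamma0 N" for g M
  proof -
    obtain a b c d where ge: "g = (a, b, c, d)" by (cases g)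
    obtain a' b' c' d' where Me: "M = (a', b', c', d')" by (cases M)
    have "[a = 1] (mod int N)" using g A(2) by (auto simp: ge mid_def Gamma1_def)
    moreover have "[c' = 0] (mod int N)" using M by (simp add: Me Gamma0_iff cong_0_iff)
    ultimately have "[a * a' + b * c' = 1 * a' + b * 0] (mod int N)" by (intro cong_add cong_mult) auto
    then show ?thesis by (simp add: ge Me mmul_simp)
  qed
  let ?I = "{r. r < N \<and> coprime r N} \<times> insert mid A"
  have "sparse (\<Union>(r, g)\<in>?I. missed N (mmul g (h r)))"
  proof (rule sparse_UN)
    fix i assume "i \<in> ?I"
    then show "sparse (case i of (r, g) \<Rightarrow> missed N (mmul g (h r)))"
      using G10 h(1) by (auto simp only: split: prod.splits intro!: sparse_missed[OF N] Gamma0_mmul)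
  qed (use A(1) in auto)
  then show ?thesis
  proof (rule sparse_subset)
    show "{q. 0 < q \<and> coprime q N \<and> \<not> Gamma1 N \<subseteq> H N q} \<subseteq> (\<Union>(r, g)\<in>?I. missed N (mmul g (h r)))"
    proof (rule subsetI, rule ccontr)
      fix q assume q: "q \<in> {q. 0 < q \<and> coprime q N \<and> \<not> Gamma1 N \<subseteq> H N q}"
        and notin: "q \<notin> (\<Union>(r, g)\<in>?I. missed N (mmul g (h r)))"
      define r where "r = q mod N"
      have r: "r < N" "coprime r N" using q N unfolding r_def by auto
      have "mmul g (h r) \<in> H N q" if g: "g \<in> insert mid A" for g
      proof -
        have "[int q = int r] (mod int N)" unfolding r_def by (simp add: cong_def zmod_int)
        also have "[int r = fst (mmul g (h r))] (mod int N)"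
          using fst_gh[OF g h(1)[OF r(2)]] h(2)[OF r(2)] by (simp add: cong_sym)
        finally show ?thesis using notin q r g by (auto simp: missed_def)
      qed
      note inH = this
      have hr: "h r \<in> H N q" using inH[of mid] by (simp add: mmul_mid)
      have "g \<in> H N q" if "g \<in> A" for g
      proof -
        have "mdet (h r) = 1" using h(1)[OF r(2)] by (cases "h r") (simp add: Gamma0_iff mdet_def)
        then have "g = mmul (mmul g (h r)) (minv (h r))" by (simp add: mmul_assoc minv_right mmul_mid)
        also have "\<dots> \<in> H N q" using that by (intro H_closed(1)[OF inH H_closed(2)[OF hr]]) simp
        finally show ?thesis .
      qed
      then have "gen_sub A \<subseteq> H N q" unfolding H_def by (intro gen_sub_mono) blast
      then show False using A(3) q by blast
    qed
  qed
qed

section \<open>Counting primes and the theorem\<close>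

text \<open>The reciprocals of \<open>n * ((n - 1) choose k)\<close> form Leibniz's harmonic
  triangle, where an entry for \<open>Suc k\<close> is the difference of two entries for
  \<open>k\<close> in rows \<open>n - 1\<close> and \<open>n\<close>. By induction each is an
  integer over \<open>Lcm {1..n}\<close>, and a positive integer is at least 1.\<close>

lemma Lcm_ge_binomial:
  assumes "k < n"
  shows "n * ((n - 1) choose k) \<le> Lcm {1..n}"
proof -
  have L0: "Lcm {1..n} > (0::nat)" for n by (intro Nat.gr0I) (auto simp: Lcm_0_iff)
  have "real (Lcm {1..n}) / real (n * ((n - 1) choose k)) \<in> \<int>"
    using assms
  proof (induction k arbitrary: n)
    case 0
    then have "n dvd Lcm {1..n}" by (intro dvd_Lcm) auto
    then show ?case by (auto elim!: dvdE)
  next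
    case (Suc k)
    obtain n' where n: "n = Suc (Suc n')" "k \<le> n'" using Suc.prems by (cases n; cases "n - 1") auto
    have n1: "n - 1 = Suc n'" using n by simp
    define A where "A = n' choose k"
    have A0: "real A > 0" using n by (simp add: A_def)
    have "Suc k * (Suc n' choose Suc k) = Suc n' * A" unfolding A_def by (rule Suc_times_binomial)
    then have "real (Suc k * (Suc n' choose Suc k)) = real (Suc n' * A)" by simp
    then have b1: "real (Suc n' choose Suc k) = real (Suc n') * real A / real (Suc k)" by (simp add: field_simps)
    have "(Suc n' - k) * (Suc n' choose k) = Suc n' * A"
      unfolding A_def using binomial_absorb_comp[of "Suc n'" k] by simp
    then have "real ((Suc n' - k) * (Suc n' choose k)) = real (Suc n' * A)" by simp
    then have b2: "real (Suc n' choose k) = real (Suc n') * real A / real (Suc n' - k)"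
      using n by (simp add: field_simps)
    have nk: "real (Suc n' - k) = real n' + 1 - real k" "real n' + 1 - real k > 0" using n by auto
    have id: "1 / (real n * real (Suc n' choose Suc k)) = 1 / (real (Suc n') * real A) - 1 / (real n * real (Suc n' choose k))"
    proof -
      have n0: "real n > 0" "real (Suc n') > 0" using n by auto
      have "1 / (real n * real (Suc n' choose Suc k)) = real (Suc k) / (real n * (real (Suc n') * real A))"
        unfolding b1 by simp
      moreover have "1 / (real n * real (Suc n' choose k)) = real (Suc n' - k) / (real n * (real (Suc n') * real A))"
        unfolding b2 by simp
      moreover have "1 / (real (Suc n') * real A) = real n / (real n * (real (Suc n') * real A))"
        using n0 by simp
      moreover have "real (Suc k) = real n - real (Suc n' - k)" using n nk by simp
      ultimately show ?thesis by (simp only: diff_divide_distrib)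
    qed
    have "real (Lcm {1..Suc n'}) / real (Suc n' * (n' choose k)) \<in> \<int>"
      using Suc.IH[of "Suc n'"] n by simp
    moreover have "Lcm {1..Suc n'} dvd Lcm {1..n}" by (intro Lcm_subset) (auto simp: n)
    then obtain c where "Lcm {1..n} = Lcm {1..Suc n'} * c" by (rule dvdE)
    then have "real (Lcm {1..n}) / (real (Suc n') * real A) = real (Lcm {1..Suc n'}) / real (Suc n' * (n' choose k)) * real c"
      by (simp only: A_def of_nat_mult times_divide_eq_left)
    ultimately have "real (Lcm {1..n}) / (real (Suc n') * real A) \<in> \<int>"
      by (simp only: Ints_mult Ints_of_nat)
    moreover have "real (Lcm {1..n}) / (real n * real (Suc n' choose k)) \<in> \<int>"
      using Suc.IH[OF Suc_lessD[OF Suc.prems], unfolded n1 of_nat_mult] .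
    ultimately have "real (Lcm {1..n}) / (real (Suc n') * real A) - real (Lcm {1..n}) / (real n * real (Suc n' choose k)) \<in> \<int>"
      by (rule Ints_diff)
    also have "real (Lcm {1..n}) / (real (Suc n') * real A) - real (Lcm {1..n}) / (real n * real (Suc n' choose k))
       = real (Lcm {1..n}) * (1 / (real n * real (Suc n' choose Suc k)))"
      unfolding id by (simp add: right_diff_distrib)
    finally show ?case by (simp only: n1 of_nat_mult times_divide_eq_right mult_1_right)
  qed
  then obtain j where j: "real (Lcm {1..n}) / real (n * ((n - 1) choose k)) = of_int j" by (rule Ints_cases)
  have pos: "0 < n * ((n - 1) choose k)" using assms by simp
  have "0 < real (Lcm {1..n}) / real (n * ((n - 1) choose k))"
    using L0[of n] pos by (intro divide_pos_pos) (simp_all only: of_nat_0_less_iff)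
  then have "1 \<le> real (Lcm {1..n}) / real (n * ((n - 1) choose k))" unfolding j by simp
  then have "real (n * ((n - 1) choose k)) \<le> real (Lcm {1..n})" using pos by (simp add: le_divide_eq split: if_splits)
  then show ?thesis by (simp only: of_nat_le_iff)
qed

text \<open>Each prime power exactly dividing the lcm already divides a single number up to
  \<open>n\<close>, hence is at most \<open>n\<close>.\<close>

lemma Lcm_le_power_card_primes: "Lcm {1..n} \<le> n ^ card {p. prime p \<and> p \<le> n}" if "n \<ge> 1" for n :: nat
proof -
  have L0: "Lcm {1..n} > (0::nat)" for n by (intro Nat.gr0I) (auto simp: Lcm_0_iff)
  have step: "p ^ multiplicity p (Lcm {1..n}) \<le> max 1 n \<and> (p dvd Lcm {1..n} \<longrightarrow> p \<le> n)" if p: "prime p" for p n :: nat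
  proof (induction n)
    case 0
    then show ?case using p by (auto simp: prime_nat_iff)
  next
    case (Suc n)
    have "{1..Suc n} = insert (Suc n) {1..n}" by auto
    then have L: "Lcm {1..Suc n} = lcm (Suc n) (Lcm {1..n})" by simp
    have "multiplicity p (Lcm {1..Suc n}) = max (multiplicity p (Suc n)) (multiplicity p (Lcm {1..n}))"
      unfolding L using L0[of n] p by (intro multiplicity_lcm) auto
    moreover have "p ^ multiplicity p (Suc n) \<le> Suc n" by (intro dvd_imp_le multiplicity_dvd) simp
    ultimately have "p ^ multiplicity p (Lcm {1..Suc n}) \<le> max 1 (Suc n)"
      using Suc by (auto simp: max_def split: if_splits)
    moreover have "p \<le> Suc n" if "p dvd Lcm {1..Suc n}"
    proof -
      have "lcm (Suc n) (Lcm {1..n}) dvd Suc n * Lcm {1..n}" by (intro lcm_least dvd_triv_left dvd_triv_right)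
      then have "p dvd Suc n * Lcm {1..n}" using that unfolding L by (rule dvd_trans[rotated])
      then have "p dvd Suc n \<or> p dvd Lcm {1..n}" using p by (simp only: prime_dvd_mult_iff)
      then show ?thesis using Suc dvd_imp_le[of p "Suc n"] by auto
    qed
    ultimately show ?case by blast
  qed
  have sub: "prime_factors (Lcm {1..n}) \<subseteq> {p. prime p \<and> p \<le> n}"
    using step by auto
  have fin: "finite {p. prime p \<and> p \<le> n}" by simp
  have "Lcm {1..n} = (\<Prod>p\<in>prime_factors (Lcm {1..n}). p ^ multiplicity p (Lcm {1..n}))"
    by (rule prime_factorization_nat[OF L0])
  also have "\<dots> \<le> (\<Prod>p\<in>prime_factors (Lcm {1..n}). n)"
  proof (rule prod_mono)
    fix p assume "p \<in> prime_factors (Lcm {1..n})"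
    then have "p ^ multiplicity p (Lcm {1..n}) \<le> max 1 n" using step by blast
    then show "0 \<le> p ^ multiplicity p (Lcm {1..n}) \<and> p ^ multiplicity p (Lcm {1..n}) \<le> n" using that by simp
  qed
  also have "\<dots> = n ^ card (prime_factors (Lcm {1..n}))" by simp
  also have "\<dots> \<le> n ^ card {p. prime p \<and> p \<le> n}"
    using that sub fin by (intro power_increasing card_mono) auto
  finally show ?thesis .
qed

text \<open>Row \<open>2 * m\<close> has \<open>2 * m + 1\<close> binomials, each at most the middle
  one, and this number is just the factor in \<open>Lcm_ge_binomial\<close>.\<close>

lemma two_power_le_Lcm: "2 ^ (2 * m) \<le> Lcm {1..2 * m + 1}" for m :: nat
proof -
  have "(2::nat) ^ (2 * m) = (\<Sum>k\<le>2 * m. (2 * m) choose k)" by (rule choose_row_sum[symmetric])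
  also have "\<dots> \<le> (\<Sum>k\<le>2 * m. (2 * m) choose m)" by (intro sum_mono binomial_maximum')
  also have "\<dots> = (2 * m + 1) * ((2 * m + 1 - 1) choose m)" by simp
  also have "\<dots> \<le> Lcm {1..2 * m + 1}" by (rule Lcm_ge_binomial) simp
  finally show ?thesis .
qed

lemma primes_le_real: "{p::nat. prime p \<and> real p \<le> x} = {p. prime p \<and> p \<le> nat \<lfloor>x\<rfloor>}" if "x \<ge> 0" for x
  using that by (auto simp: le_nat_iff le_floor_iff)

text \<open>For the largest odd \<open>n = 2 * m + 1\<close> up to \<open>x\<close>,
  \<open>Lcm {1..n}\<close> lies between \<open>4 ^ m\<close> and \<open>n\<close> to the number of
  primes up to \<open>n\<close>. The constant 1/4 absorbs \<open>ln 2\<close> and a rounding loss of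
  at most 3.\<close>

lemma chebyshev_lower:
  "eventually (\<lambda>x::real. x / 4 \<le> real (card {p::nat. prime p \<and> real p \<le> x}) * ln x) at_top"
proof -
  have "eventually (\<lambda>x::real. x / 4 \<le> (x - 3) * ln 2) at_top"
    using eventually_ge_at_top[of 6]
  proof eventually_elim
    case (elim x)
    have "(x - 3) * (1 / 2) \<le> (x - 3) * ln 2" using elim ln2_ge_two_thirds by (intro mult_left_mono) auto
    moreover have "x / 4 \<le> (x - 3) * (1 / 2)" using elim by simp
    ultimately show ?case by (rule order.trans[rotated])
  qed
  then show ?thesis using eventually_ge_at_top[of 3]
  proof eventually_elim
    case (elim x)
    define m where "m = (nat \<lfloor>x\<rfloor> - 1) div 2"
    have m: "x - 3 \<le> real (2 * m)" "real (2 * m + 1) \<le> x" "2 * m + 1 \<ge> 1" using elim(2) unfolding m_def by linarith+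
    let ?P = "{p. prime p \<and> p \<le> 2 * m + 1}" and ?Q = "{p::nat. prime p \<and> real p \<le> x}"
    have "?P \<subseteq> ?Q" using m(2) by auto
    moreover have "finite ?Q" using elim(2) by (subst primes_le_real) auto
    ultimately have PQ: "card ?P \<le> card ?Q" by (intro card_mono)
    have "(2::nat) ^ (2 * m) \<le> (2 * m + 1) ^ card ?P"
      using two_power_le_Lcm[of m] Lcm_le_power_card_primes[OF m(3)] by linarith
    then have "real (2 ^ (2 * m)) \<le> real ((2 * m + 1) ^ card ?P)" by (simp only: of_nat_le_iff)
    then have "ln (2 ^ (2 * m)) \<le> ln (real (2 * m + 1) ^ card ?P)" by (subst ln_le_cancel_iff) simp_all
    then have "real (2 * m) * ln 2 \<le> real (card ?P) * ln (real (2 * m + 1))"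
      by (simp only: ln_realpow)
    also have "\<dots> \<le> real (card ?Q) * ln x"
      using PQ m(2) by (intro mult_mono) auto
    finally have "real (2 * m) * ln 2 \<le> real (card ?Q) * ln x" .
    moreover have "(x - 3) * ln 2 \<le> real (2 * m) * ln 2" using m(1) by (intro mult_right_mono) auto
    ultimately show ?case using elim(1) by linarith
  qed
qed

text \<open>This is the sieve at \<open>a = 1\<close>, \<open>s = 0\<close> over the prime factors
  of \<open>N\<close>; its density is then Euler's product for \<open>totient N / N\<close>.\<close>

lemma coprime_density:
  assumes "N \<ge> 1"
  shows "((\<lambda>x::real. real (card {q::nat. 0 < q \<and> coprime q N \<and> real q \<le> x}) / x) \<longlongrightarrow> real (totient N) / real N) at_top"
proof -
  let ?P = "prime_factors N"
  have dens: "sieve_density ?P 1 = real (totient N) / real N"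
  proof -
    have "real (totient N) = real N * (\<Prod>p\<in>?P. 1 - 1 / real p)" by (rule totient_formula2)
    moreover have "sieve_density ?P 1 = (\<Prod>p\<in>?P. 1 - 1 / real p)"
      unfolding sieve_density_def by (intro prod.cong) (auto simp: in_prime_factors_iff)
    ultimately show ?thesis using assms by simp
  qed
  have bound: "\<bar>real (card {q::nat. 0 < q \<and> coprime q N \<and> real q \<le> x}) / x - real (totient N) / real N\<bar> \<le> (2 ^ card ?P + 1) / x"
    if x: "x \<ge> 1" for x :: real
  proof -
    define X where "X = nat \<lfloor>x\<rfloor>"
    have X: "real X \<le> x" "x < real X + 1" using x unfolding X_def by linarith+
    have "{q::nat. 0 < q \<and> coprime q N \<and> real q \<le> x} = {l\<in>{1..<X + 1}. \<forall>q\<in>?P. \<not> q dvd 0 + l * 1}"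
    proof -
      have "coprime q N \<longleftrightarrow> (\<forall>p\<in>?P. \<not> p dvd q)" for q
      proof
        assume "coprime q N"
        then have "p = 1" if "p dvd q" "p dvd N" for p
          using coprime_common_divisor_nat that by blast
        then show "\<forall>p\<in>?P. \<not> p dvd q"
          by (metis in_prime_factors_iff not_prime_1)
      next
        assume none: "\<forall>p\<in>?P. \<not> p dvd q"
        show "coprime q N"
        proof (rule ccontr)
          assume "\<not> coprime q N"
          then have "gcd q N \<noteq> 1" using coprime_iff_gcd_eq_1 by blast
          then obtain p where "prime p" "p dvd gcd q N" using prime_factor_nat by blast
          then show False using none assms by (auto simp: in_prime_factors_iff)
        qed
      qed
      moreover have "real q \<le> x \<longleftrightarrow> q < X + 1" for q
        using x unfolding X_def by (auto simp: less_Suc_eq_le le_nat_iff le_floor_iff)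
      ultimately show ?thesis by auto
    qed
    moreover have "\<bar>real (card {l\<in>{1..<X + 1}. \<forall>q\<in>?P. \<not> q dvd 0 + l * 1}) - sieve_density ?P 1 * real (X + 1 - 1)\<bar> \<le> 2 ^ card ?P - 1"
      by (rule legendre_sieve) (auto simp: in_prime_factors_iff)
    ultimately have c: "\<bar>real (card {q::nat. 0 < q \<and> coprime q N \<and> real q \<le> x}) - sieve_density ?P 1 * real X\<bar> \<le> 2 ^ card ?P"
      by simp
    have D: "0 \<le> sieve_density ?P 1" "sieve_density ?P 1 \<le> 1"
      using sieve_density_bounds[of ?P 1] by (auto simp: in_prime_factors_iff)
    have "\<bar>sieve_density ?P 1 * real X - sieve_density ?P 1 * x\<bar> = sieve_density ?P 1 * (x - real X)"
      using D X by (simp add: abs_mult right_diff_distrib[symmetric])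
    also have "\<dots> \<le> 1 * 1" using D X by (intro mult_mono) auto
    finally have "\<bar>real (card {q::nat. 0 < q \<and> coprime q N \<and> real q \<le> x}) - sieve_density ?P 1 * x\<bar> \<le> 2 ^ card ?P + 1"
      using c by linarith
    then have "\<bar>real (card {q::nat. 0 < q \<and> coprime q N \<and> real q \<le> x}) - sieve_density ?P 1 * x\<bar> / x \<le> (2 ^ card ?P + 1) / x"
      using x by (intro divide_right_mono) auto
    moreover have "\<bar>real (card {q::nat. 0 < q \<and> coprime q N \<and> real q \<le> x}) - sieve_density ?P 1 * x\<bar> / x =
       \<bar>real (card {q::nat. 0 < q \<and> coprime q N \<and> real q \<le> x}) / x - sieve_density ?P 1\<bar>"
    proof -
      have "y / x - sieve_density ?P 1 = (y - sieve_density ?P 1 * x) / x" for y using x by (simp add: field_simps)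
      then show ?thesis using x by (simp add: abs_divide)
    qed
    ultimately show ?thesis unfolding dens by simp
  qed
  have "((\<lambda>x::real. (2 ^ card ?P + 1) / x) \<longlongrightarrow> 0) at_top" by real_asymp
  then have "((\<lambda>x::real. real (card {q::nat. 0 < q \<and> coprime q N \<and> real q \<le> x}) / x - real (totient N) / real N) \<longlongrightarrow> 0) at_top"
    by (rule Lim_null_comparison[OF eventually_mono[OF eventually_ge_at_top[of 1]], rotated]) (simp only: real_norm_def bound)
  then show ?thesis by (rule LIM_zero_cancel)
qed

theorem theorem3p2:
  fixes N :: nat
  assumes "N \<ge> 1"
  shows "((\<lambda>x::real. real (card {q::nat. 0 < q \<and> coprime q N \<and> Gamma1 N \<subseteq> H N q \<and> real q \<le> x}) / x)
            \<longlongrightarrow> real (totient N) / real N) at_top \<and>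
         ((\<lambda>x::real. real (card {q::nat. prime q \<and> \<not> q dvd N \<and> Gamma1 N \<subseteq> H N q \<and> real q \<le> x})
                    / real (card {p::nat. prime p \<and> real p \<le> x}))
            \<longlongrightarrow> 1) at_top"
proof
  let ?B = "{q. 0 < q \<and> coprime q N \<and> \<not> Gamma1 N \<subseteq> H N q}"
  let ?bad = "\<lambda>x. real (card {q \<in> ?B. real q \<le> x})"
  let ?\<pi> = "\<lambda>x. real (card {p::nat. prime p \<and> real p \<le> x})"
  have B: "((\<lambda>x::real. ?bad x * ln x / x) \<longlongrightarrow> 0) at_top"
    using sparse_exceptional[OF assms] by (simp only: sparse_def)
  have fin: "finite {q. P q \<and> real q \<le> x}" for P x
    using finite_nat_real_le[of "Collect P" x] by simp
  show "((\<lambda>x::real. real (card {q::nat. 0 < q \<and> coprime q N \<and> Gamma1 N \<subseteq> H N q \<and> real q \<le> x}) / x)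
            \<longlongrightarrow> real (totient N) / real N) at_top"
  proof -
    have "((\<lambda>x::real. ?bad x / x) \<longlongrightarrow> 0) at_top"
    proof (rule tendsto_sandwich[OF _ _ tendsto_const B])
      show "eventually (\<lambda>x. 0 \<le> ?bad x / x) at_top"
        using eventually_ge_at_top[of 1] by eventually_elim simp
      show "eventually (\<lambda>x. ?bad x / x \<le> ?bad x * ln x / x) at_top"
        using eventually_ge_at_top[of "exp 1"]
      proof eventually_elim
        case (elim x)
        have x0: "x > 0" using elim exp_gt_zero[of 1] by linarith
        then have "1 \<le> ln x" using elim by (simp add: ln_ge_iff)
        then have "?bad x * 1 \<le> ?bad x * ln x" by (intro mult_left_mono) auto
        then show ?case using x0 by (simp add: divide_right_mono)
      qed
    qed
    from tendsto_diff[OF coprime_density[OF assms] this]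
    have "((\<lambda>x::real. real (card {q::nat. 0 < q \<and> coprime q N \<and> real q \<le> x}) / x - ?bad x / x) \<longlongrightarrow> real (totient N) / real N) at_top"
      by simp
    moreover have "real (card {q::nat. 0 < q \<and> coprime q N \<and> real q \<le> x}) / x - ?bad x / x =
      real (card {q::nat. 0 < q \<and> coprime q N \<and> Gamma1 N \<subseteq> H N q \<and> real q \<le> x}) / x" for x
    proof -
      have "{q::nat. 0 < q \<and> coprime q N \<and> real q \<le> x} =
        {q::nat. 0 < q \<and> coprime q N \<and> Gamma1 N \<subseteq> H N q \<and> real q \<le> x} \<union> {q \<in> ?B. real q \<le> x}" by auto
      then have "card {q::nat. 0 < q \<and> coprime q N \<and> real q \<le> x} =
        card {q::nat. 0 < q \<and> coprime q N \<and> Gamma1 N \<subseteq> H N q \<and> real q \<le> x} + card {q \<in> ?B. real q \<le> x}"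
        using fin[of "\<lambda>q. 0 < q \<and> coprime q N \<and> Gamma1 N \<subseteq> H N q" x] fin[of "\<lambda>q. q \<in> ?B" x]
        by (simp only:) (rule card_Un_disjoint, auto)
      then show ?thesis by (simp add: add_divide_distrib)
    qed
    ultimately show ?thesis by simp
  qed
  show "((\<lambda>x::real. real (card {q::nat. prime q \<and> \<not> q dvd N \<and> Gamma1 N \<subseteq> H N q \<and> real q \<le> x}) / ?\<pi> x) \<longlongrightarrow> 1) at_top"
  proof (rule tendsto_sandwich)
    \<comment> \<open>Primes absent from \<open>?G\<close> divide \<open>N\<close>, at most
      \<open>?w\<close> of them, or are exceptional. The 4 below inverts the constant of
      \<open>chebyshev_lower\<close>, which converts \<open>x / ln x\<close> into the prime
      count.\<close>
    let ?w = "real (card {p. p dvd N})"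
    let ?G = "\<lambda>x. real (card {q::nat. prime q \<and> \<not> q dvd N \<and> Gamma1 N \<subseteq> H N q \<and> real q \<le> x})"
    have "((\<lambda>x::real. ln x / x) \<longlongrightarrow> 0) at_top" by real_asymp
    from tendsto_mult_right_zero[OF this, of ?w] have "((\<lambda>x::real. ?w * ln x / x) \<longlongrightarrow> 0) at_top" by simp
    from tendsto_diff[OF tendsto_const tendsto_mult_left[OF tendsto_add[OF this B]], of 1 4] have "((\<lambda>x. 1 - 4 * (?w * ln x / x + ?bad x * ln x / x)) \<longlongrightarrow> 1 - 4 * (0 + 0)) at_top"
      .
    then show "((\<lambda>x. 1 - 4 * (?w * ln x / x + ?bad x * ln x / x)) \<longlongrightarrow> 1) at_top" by simp
    show "((\<lambda>x. 1) \<longlongrightarrow> (1::real)) (at_top :: real filter)" by simp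
    have G\<pi>: "?G x \<le> ?\<pi> x" for x
      using fin[of prime x] by (intro of_nat_mono card_mono) auto
    then show "eventually (\<lambda>x. ?G x / ?\<pi> x \<le> 1) at_top"
      by (intro always_eventually allI) (simp add: divide_le_eq)
    show "eventually (\<lambda>x. 1 - 4 * (?w * ln x / x + ?bad x * ln x / x) \<le> ?G x / ?\<pi> x) at_top"
      using chebyshev_lower eventually_ge_at_top[of 2]
    proof eventually_elim
      case (elim x)
      have "{p::nat. prime p \<and> real p \<le> x} \<subseteq>
        {q::nat. prime q \<and> \<not> q dvd N \<and> Gamma1 N \<subseteq> H N q \<and> real q \<le> x} \<union> ({p. p dvd N} \<union> {q \<in> ?B. real q \<le> x})"
        by (auto simp: prime_imp_coprime prime_gt_0_nat)
      then have "card {p::nat. prime p \<and> real p \<le> x} \<le>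
        card ({q::nat. prime q \<and> \<not> q dvd N \<and> Gamma1 N \<subseteq> H N q \<and> real q \<le> x} \<union> ({p. p dvd N} \<union> {q \<in> ?B. real q \<le> x}))"
        using fin[of "\<lambda>q. prime q \<and> \<not> q dvd N \<and> Gamma1 N \<subseteq> H N q" x] fin[of "\<lambda>q. q \<in> ?B" x] assms
        by (intro card_mono) (auto simp: conj_assoc)
      also have "\<dots> \<le> card {q::nat. prime q \<and> \<not> q dvd N \<and> Gamma1 N \<subseteq> H N q \<and> real q \<le> x} + (card {p. p dvd N} + card {q \<in> ?B. real q \<le> x})"
        by (rule order.trans[OF card_Un_le]) (rule add_left_mono[OF card_Un_le])
      finally have sum: "?\<pi> x \<le> ?G x + (?w + ?bad x)" by linarith
      have "0 < x / 4" using elim(2) by simp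
      then have "0 < ?\<pi> x * ln x" using elim(1) by linarith
      then have \<pi>0: "0 < ?\<pi> x" using elim(2) by (simp add: zero_less_mult_iff)
      have "1 \<le> 4 * (?\<pi> x * ln x) / x" using elim by (simp add: le_divide_eq)
      then have "(?w + ?bad x) * 1 \<le> (?w + ?bad x) * (4 * (?\<pi> x * ln x) / x)" by (intro mult_left_mono) auto
      also have "\<dots> = 4 * (?w * ln x / x + ?bad x * ln x / x) * ?\<pi> x" by (simp add: algebra_simps add_divide_distrib)
      finally have "?\<pi> x * (1 - 4 * (?w * ln x / x + ?bad x * ln x / x)) \<le> ?G x" using sum by (simp add: algebra_simps)
      then show ?case using \<pi>0 by (simp add: le_divide_eq mult.commute)
    qed
  qed
qed

end
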